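(* Let $A$ satisfy the standing assumptions (i)–(v) of the context and $\inf_{x\in\Omega}A(x,1)>0$, and let $f$, $b_1,b_2,b_3$ and $E$ be as in the context. Suppose $u\in W^{1,A}_{\mathrm{loc}}(\Omega)$ is a local minimizer of $E$, and that there exists a constant $T_0\ge1$ such that $\widehat{\mathfrak{A}}(T_0)=1$. Then there exist positive constants $c_3=c_3(b_i,A)$ and $c_4=c_4(b_i,A)$ such that for any $x_0\in\Omega$, $Q_R(x_0)\subset\Omega$, $0<\rho<R$ and $a\in(-\infty,+\infty)$, $$\int_{Q_\rho(x_0)}A(x,|\nabla u|)\,\mathrm{d}x\le c_3\int_{Q_R(x_0)}A\Big(x,\Big|\frac{u-a}{R-\rho}\Big|\Big)\,\mathrm{d}x+c_4|Q_R(x_0)|.$$ In particular, there exist positive constants $c_5=c_5(b_i,n,A)$ and $c_6=c_6(b_i,n,A)$ such that for any $x_0\in\Omega$ and $Q_R(x_0)\subset\Omega$, $$\frac{1}{|Q_{R/2}(x_0)|}\int_{Q_{R/2}(x_0)}A(x,|\nabla u|)\,\mathrm{d}x\le\frac{c_5}{|Q_R(x_0)|}\int_{Q_R(x_0)}A\Big(x,\Big|\frac{u-u_R}{R}\Big|\Big)\,\mathrm{d}x+c_6,$$ where $u_R$ is the mean value of $u$ over $Q_R(x_0)$.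
   Context: Throughout $n\ge2$ and $\Omega\subset\mathbb{R}^n$ is a bounded domain with the cone property. $Q_R(x)=\{y:|y_i-x_i|\le R,\ i=1,\dots,n\}$. N-functions: even convex continuous $A:\mathbb{R}\to[0,\infty)$ with $A(0)=0$, $A(t)>0$ for $t\ne0$, $A(t)/t\to0$ as $t\to0+$, $A(t)/t\to\infty$ as $t\to\infty$. $A\in N(\Omega)$ means $A:\Omega\times\mathbb{R}\to[0,\infty)$, $A(\cdot,t)$ is measurable for every $t\ge0$, and $A(x,\cdot)$ is an N-function for a.e. $x$. $A^{-1}(x,\cdot)$ is the inverse of $A(x,\cdot)$ on $[0,\infty)$. $L^A(\Omega)$ is the space of measurable $u$ with $\int_\Omega A(x,|u|/\lambda)\,\mathrm{d}x<\infty$ for some $\lambda>0$, with Luxemburg norm $\|u\|_A=\inf\{\lambda>0:\int_\Omega A(x,|u|/\lambda)\,\mathrm{d}x\le1\}$; $W^{1,A}(\Omega)=\{u\in L^A(\Omega):|\nabla u|\in L^A(\Omega)\}$ with norm $\|u\|_A+\|\,|\nabla u|\,\|_A$; $W^{1,A}_0(\Omega)$ is the closure of $C_0^\infty(\Omega)$ in it; "loc" has the usual meaning. All Musielak–Orlicz spaces considered are assumed reflexive. Operators on functions $\mathfrak{C}:[0,\infty)\to[0,\infty)$: $\widehat{\mathfrak{C}}(\beta)=1/\mathfrak{C}(1/\beta)$ for $\beta>0$, $\widehat{\mathfrak{C}}(0)=0$; $\mathfrak{C}_*$ is defined by $\mathfrak{C}_*^{-1}(\sigma)=\dfrac{1}{\sigma^{1/n}\mathfrak{C}^{-1}(\sigma^{-1})}$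 for $\sigma>0$, $\mathfrak{C}_*^{-1}(0)=0$. $\mathfrak{C}\in\nabla_{\mathbb{R}^+}$ means: there are $M_0,M_1,M_2>0$ with $M_1\widehat{\mathfrak{C}}(\alpha)\widehat{\mathfrak{C}}(\beta)\le\mathfrak{C}(M_0\alpha\beta)\le M_2\mathfrak{C}(\alpha)\mathfrak{C}(\beta)$ for all $\alpha,\beta>0$. Standing assumptions on $A$: (i) $A\in N(\Omega)$ and for a.e. $x$ the function $t\mapsto A(x,t)^{-1/n}$ is convex and differentiable on $(0,\infty)$. Define $A^*$, even in the second variable, by $(A^* )^{-1}(x,s)=s^{\frac{n+1}{n}}\,\partial_s\big(A^{-1}(x,s)\big)$ for $s>0$ and $A^*(x,0)=0$. (ii) $A^*\in N(\Omega)$. (iii) $A^*:\overline\Omega\times\mathbb{R}\to[0,\infty)$ is continuous and $A^*(x,t)\in(0,\infty)$ for $x\in\overline\Omega$, $t>0$. (iv) There are positive constants $\delta_0<\frac1n$, $C_0$, $t_0$ with $|\nabla_xA^*(x,t)|\le C_0(A^*(x,t))^{1+\delta_0}$ for $x\in\Omega$, $|t|\ge t_0$, wherever $\nabla_xA^*(x,t)$ exists. (v) For every $\Omega_0\subseteq\Omega$ with the cone property there is a strictly increasing differentiable function $\mathfrak{A}^*_{\Omega_0}\in\nabla_{\mathbb{R}^+}$ on $[0,\infty)$, with constants $M_0,M_1,M_2$ independent of $\Omega_0$, such that $A^*(x,\alpha t)\le\mathfrak{A}^*_{\Omega_0}(\alpha)A^*(x,t)$ for all $\alpha\ge0$, $t\in\mathbb{R}$,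 $x\in\Omega_0$, and $n\mathfrak{A}^*_{\Omega_0}(\alpha)>\alpha(\mathfrak{A}^*_{\Omega_0})'(\alpha)$ for $\alpha>0$. Control function of $A$: $\mathfrak{A}:=(\mathfrak{A}^*_{\Omega})_*$; it is continuous and strictly increasing and $\mathfrak{A}(\alpha)A(x,t)\le A(x,\alpha t)\le\widehat{\mathfrak{A}}(\alpha)A(x,t)$ for $\alpha\ge0$, $t\in\mathbb{R}$, $x\in\Omega$. Functional: $E(v)=E(v;\Omega)=\int_\Omega f(x,\nabla v(x))\,\mathrm{d}x$ (and $E(v;U)$ is the same integral over $U$), where $f:\Omega\times\mathbb{R}^n\to\mathbb{R}$ is a Carathéodory function with $b_2A(x,\sum_i|z_i|)-b_1\le f(x,z)\le b_3A(x,\sum_i|z_i|)+b_1$ for constants $b_1\ge0$, $b_2>0$, $b_3\ge0$. $u\in W^{1,A}_{\mathrm{loc}}(\Omega)$ is a local minimizer of $E$ if $E(u;\mathrm{supp}\,\varphi)\le E(u+\varphi;\mathrm{supp}\,\varphi)$ for every $\varphi\in W_0^{1,A}(\Omega)$ with $\mathrm{supp}\,\varphi\subset\subset\Omega$. *)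

theory Defs
  imports "HOL-Analysis.Analysis"
begin

text \<open>The ambient space \<open>\<real>\<^sup>n\<close> is \<open>real ^ 'n\<close>, with \<open>n = CARD('n)\<close>. Functions on a subset of it are
  total functions whose values off that subset are irrelevant; elements of function spaces are
  representatives, so the norms below are seminorms vanishing exactly on null functions.\<close>


subsection \<open>Domains\<close>

definition domain :: "(real ^ 'n) set \<Rightarrow> bool" where
  "domain \<Omega> \<longleftrightarrow> open \<Omega> \<and> connected \<Omega> \<and> \<Omega> \<noteq> {}"

text \<open>Finite closed cone with vertex \<open>x\<close>, axis direction \<open>e\<close> (a unit vector), half-aperture \<open>\<theta>\<close> and height \<open>h\<close>.\<close>

definition finite_cone :: "real ^ 'n \<Rightarrow> real ^ 'n \<Rightarrow> real \<Rightarrow> real \<Rightarrow> (real ^ 'n) set" where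
  "finite_cone x e \<theta> h = {x + y | y. norm y \<le> h \<and> norm y * cos \<theta> \<le> y \<bullet> e}"

definition cone_property :: "(real ^ 'n) set \<Rightarrow> bool" where
  "cone_property U \<longleftrightarrow>
     (\<exists>\<theta> h. 0 < \<theta> \<and> \<theta> \<le> pi / 2 \<and> 0 < h \<and> (\<forall>x\<in>U. \<exists>e. norm e = 1 \<and> finite_cone x e \<theta> h \<subseteq> U))"

definition cube :: "real ^ 'n \<Rightarrow> real \<Rightarrow> (real ^ 'n) set" where
  "cube x R = {y. \<forall>i. \<bar>y $ i - x $ i\<bar> \<le> R}"


subsection \<open>N-functions\<close>

definition N_function :: "(real \<Rightarrow> real) \<Rightarrow> bool" where
  "N_function A \<longleftrightarrow>
     (\<forall>t. A (- t) = A t) \<and> convex_on UNIV A \<and> continuous_on UNIV A \<and>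
     A 0 = 0 \<and> (\<forall>t. t \<noteq> 0 \<longrightarrow> 0 < A t) \<and>
     ((\<lambda>t. A t / t) \<longlongrightarrow> 0) (at_right 0) \<and> filterlim (\<lambda>t. A t / t) at_top at_top"

definition N_class :: "(real ^ 'n) set \<Rightarrow> (real ^ 'n \<Rightarrow> real \<Rightarrow> real) \<Rightarrow> bool" where
  "N_class \<Omega> A \<longleftrightarrow>
     (\<forall>x\<in>\<Omega>. \<forall>t. 0 \<le> A x t) \<and>
     (\<forall>t\<ge>0. (\<lambda>x. A x t) \<in> borel_measurable (lebesgue_on \<Omega>)) \<and>
     (AE x in lebesgue_on \<Omega>. N_function (A x))"

definition inv_nonneg :: "(real \<Rightarrow> real) \<Rightarrow> real \<Rightarrow> real" where
  "inv_nonneg g = inv_into {0..} g"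


subsection \<open>Musielak--Orlicz and Musielak--Orlicz--Sobolev spaces\<close>

definition modular :: "(real ^ 'n \<Rightarrow> real \<Rightarrow> real) \<Rightarrow> (real ^ 'n) set \<Rightarrow> (real ^ 'n \<Rightarrow> real) \<Rightarrow> ennreal" where
  "modular A U v = (\<integral>\<^sup>+ x. ennreal (A x (v x)) \<partial>lebesgue_on U)"

definition LA :: "(real ^ 'n \<Rightarrow> real \<Rightarrow> real) \<Rightarrow> (real ^ 'n) set \<Rightarrow> (real ^ 'n \<Rightarrow> real) set" where
  "LA A U = {u \<in> borel_measurable (lebesgue_on U). \<exists>l>0. modular A U (\<lambda>x. \<bar>u x\<bar> / l) < \<infinity>}"

definition LA_norm :: "(real ^ 'n \<Rightarrow> real \<Rightarrow> real) \<Rightarrow> (real ^ 'n) set \<Rightarrow> (real ^ 'n \<Rightarrow> real) \<Rightarrow> real" where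
  "LA_norm A U u = Inf {l. 0 < l \<and> modular A U (\<lambda>x. \<bar>u x\<bar> / l) \<le> 1}"

definition partial_deriv :: "'n \<Rightarrow> (real ^ 'n \<Rightarrow> real) \<Rightarrow> real ^ 'n \<Rightarrow> real" where
  "partial_deriv i \<phi> x = frechet_derivative \<phi> (at x) (axis i 1)"

primrec Ck :: "nat \<Rightarrow> (real ^ 'n \<Rightarrow> real) \<Rightarrow> bool" where
  "Ck 0 \<phi> = continuous_on UNIV \<phi>"
| "Ck (Suc k) \<phi> = ((\<forall>x. \<phi> differentiable at x) \<and> (\<forall>i. Ck k (partial_deriv i \<phi>)))"

definition supp :: "(real ^ 'n) set \<Rightarrow> (real ^ 'n \<Rightarrow> real) \<Rightarrow> (real ^ 'n) set" where
  "supp U \<phi> = closure {x \<in> U. \<phi> x \<noteq> 0}"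

text \<open>Elements of \<open>C\<^sub>0\<^sup>\<infinity>(U)\<close> are extended by zero to the whole space.\<close>

definition test_functions :: "(real ^ 'n) set \<Rightarrow> (real ^ 'n \<Rightarrow> real) set" where
  "test_functions U = {\<phi>. (\<forall>k. Ck k \<phi>) \<and> compact (supp UNIV \<phi>) \<and> supp UNIV \<phi> \<subseteq> U}"

definition locally_integrable :: "(real ^ 'n) set \<Rightarrow> (real ^ 'n \<Rightarrow> 'b::{banach, second_countable_topology}) \<Rightarrow> bool" where
  "locally_integrable U g \<longleftrightarrow> (\<forall>K. compact K \<and> K \<subseteq> U \<longrightarrow> integrable (lebesgue_on K) g)"

definition is_weak_gradient :: "(real ^ 'n) set \<Rightarrow> (real ^ 'n \<Rightarrow> real) \<Rightarrow> (real ^ 'n \<Rightarrow> real ^ 'n) \<Rightarrow> bool" where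
  "is_weak_gradient U u g \<longleftrightarrow>
     locally_integrable U u \<and> locally_integrable U g \<and>
     (\<forall>\<phi>\<in>test_functions U. \<forall>i.
        (LINT x|lebesgue_on U. u x * partial_deriv i \<phi> x) = - (LINT x|lebesgue_on U. g x $ i * \<phi> x))"

text \<open>A representative of the weak gradient; unique up to null sets when it exists.\<close>

definition weak_gradient :: "(real ^ 'n) set \<Rightarrow> (real ^ 'n \<Rightarrow> real) \<Rightarrow> real ^ 'n \<Rightarrow> real ^ 'n" where
  "weak_gradient U u = (SOME g. is_weak_gradient U u g)"

definition W1A :: "(real ^ 'n \<Rightarrow> real \<Rightarrow> real) \<Rightarrow> (real ^ 'n) set \<Rightarrow> (real ^ 'n \<Rightarrow> real) set" where
  "W1A A U = {u \<in> LA A U. (\<exists>g. is_weak_gradient U u g) \<and> (\<lambda>x. norm (weak_gradient U u x)) \<in> LA A U}"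

definition W1A_norm :: "(real ^ 'n \<Rightarrow> real \<Rightarrow> real) \<Rightarrow> (real ^ 'n) set \<Rightarrow> (real ^ 'n \<Rightarrow> real) \<Rightarrow> real" where
  "W1A_norm A U u = LA_norm A U u + LA_norm A U (\<lambda>x. norm (weak_gradient U u x))"

definition W1A_0 :: "(real ^ 'n \<Rightarrow> real \<Rightarrow> real) \<Rightarrow> (real ^ 'n) set \<Rightarrow> (real ^ 'n \<Rightarrow> real) set" where
  "W1A_0 A U = {u \<in> W1A A U. \<forall>\<epsilon>>0. \<exists>\<phi>\<in>test_functions U \<inter> W1A A U. W1A_norm A U (\<lambda>x. u x - \<phi> x) < \<epsilon>}"

definition W1A_loc :: "(real ^ 'n \<Rightarrow> real \<Rightarrow> real) \<Rightarrow> (real ^ 'n) set \<Rightarrow> (real ^ 'n \<Rightarrow> real) set" where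
  "W1A_loc A \<Omega> = {u. \<forall>U. open U \<and> compact (closure U) \<and> closure U \<subseteq> \<Omega> \<longrightarrow> u \<in> W1A A U}"


subsection \<open>Reflexivity\<close>

text \<open>A function space is given by a set \<open>V\<close> of functions, with pointwise operations, and a seminorm
  \<open>N\<close> on it. Its dual consists again of real functions, so that the construction can be iterated.
  A bounded functional vanishes on the kernel of the seminorm, hence nothing changes when
  passing to the quotient normed space.\<close>

definition normed_dual :: "('b \<Rightarrow> real) set \<Rightarrow> (('b \<Rightarrow> real) \<Rightarrow> real) \<Rightarrow> (('b \<Rightarrow> real) \<Rightarrow> real) set" where
  "normed_dual V N = {l.
     (\<forall>u\<in>V. \<forall>v\<in>V. l (\<lambda>x. u x + v x) = l u + l v) \<and>
     (\<forall>c. \<forall>v\<in>V. l (\<lambda>x. c * v x) = c * l v) \<and>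
     (\<exists>K. \<forall>v\<in>V. \<bar>l v\<bar> \<le> K * N v)}"

definition dual_norm :: "('b \<Rightarrow> real) set \<Rightarrow> (('b \<Rightarrow> real) \<Rightarrow> real) \<Rightarrow> (('b \<Rightarrow> real) \<Rightarrow> real) \<Rightarrow> real" where
  "dual_norm V N l = Inf {K. 0 \<le> K \<and> (\<forall>v\<in>V. \<bar>l v\<bar> \<le> K * N v)}"

definition reflexive_space :: "('b \<Rightarrow> real) set \<Rightarrow> (('b \<Rightarrow> real) \<Rightarrow> real) \<Rightarrow> bool" where
  "reflexive_space V N \<longleftrightarrow>
     (\<forall>\<Phi>\<in>normed_dual (normed_dual V N) (dual_norm V N). \<exists>v\<in>V. \<forall>l\<in>normed_dual V N. \<Phi> l = l v)"


subsection \<open>Operators on functions on the half-line\<close>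

definition hat_op :: "(real \<Rightarrow> real) \<Rightarrow> real \<Rightarrow> real" where
  "hat_op C \<beta> = (if \<beta> = 0 then 0 else 1 / C (1 / \<beta>))"

text \<open>\<open>star_inv n C\<close> is the prescribed inverse of \<open>star_op n C\<close>. The definition of \<open>star_op n C\<close> makes
  sense when \<open>C\<close> and \<open>star_inv n C\<close> are invertible on the half-line.\<close>

definition star_inv :: "nat \<Rightarrow> (real \<Rightarrow> real) \<Rightarrow> real \<Rightarrow> real" where
  "star_inv n C \<sigma> = (if \<sigma> = 0 then 0 else 1 / (\<sigma> powr (1 / real n) * inv_nonneg C (1 / \<sigma>)))"

definition star_defined :: "nat \<Rightarrow> (real \<Rightarrow> real) \<Rightarrow> bool" where
  "star_defined n C \<longleftrightarrow> bij_betw C {0..} {0..} \<and> bij_betw (star_inv n C) {0..} {0..}"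

definition star_op :: "nat \<Rightarrow> (real \<Rightarrow> real) \<Rightarrow> real \<Rightarrow> real" where
  "star_op n C = inv_nonneg (star_inv n C)"

definition nabla_with :: "real \<Rightarrow> real \<Rightarrow> real \<Rightarrow> (real \<Rightarrow> real) \<Rightarrow> bool" where
  "nabla_with M0 M1 M2 C \<longleftrightarrow>
     (\<forall>\<alpha>>0. \<forall>\<beta>>0. M1 * hat_op C \<alpha> * hat_op C \<beta> \<le> C (M0 * \<alpha> * \<beta>) \<and> C (M0 * \<alpha> * \<beta>) \<le> M2 * C \<alpha> * C \<beta>)"


subsection \<open>Standing assumptions\<close>

text \<open>\<open>As\<close> stands for \<open>A\<^sup>*\<close> and \<open>CA \<Omega>0\<close> for the control function of \<open>A\<^sup>*\<close> on \<open>\<Omega>0\<close>.\<close>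

definition assumption_i :: "(real ^ 'n) set \<Rightarrow> (real ^ 'n \<Rightarrow> real \<Rightarrow> real) \<Rightarrow> bool" where
  "assumption_i \<Omega> A \<longleftrightarrow>
     N_class \<Omega> A \<and>
     (AE x in lebesgue_on \<Omega>.
        convex_on {0<..} (\<lambda>t. A x t powr (- 1 / real CARD('n))) \<and>
        (\<lambda>t. A x t powr (- 1 / real CARD('n))) differentiable_on {0<..})"

text \<open>The defining equation of \<open>A\<^sup>*\<close>. It is meaningful only where \<open>A x\<close> is an N-function, hence almost
  everywhere; this determines \<open>As\<close> on the closure of \<open>\<Omega>\<close> once \<open>As\<close> is required to be continuous.\<close>

definition is_A_star :: "(real ^ 'n) set \<Rightarrow> (real ^ 'n \<Rightarrow> real \<Rightarrow> real) \<Rightarrow> (real ^ 'n \<Rightarrow> real \<Rightarrow> real) \<Rightarrow> bool" where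
  "is_A_star \<Omega> A As \<longleftrightarrow>
     (AE x in lebesgue_on \<Omega>.
        (\<forall>t. As x (- t) = As x t) \<and> As x 0 = 0 \<and>
        (\<forall>s>0. inv_nonneg (As x) s =
           s powr ((real CARD('n) + 1) / real CARD('n)) * deriv (inv_nonneg (A x)) s))"

definition assumption_iii :: "(real ^ 'n) set \<Rightarrow> (real ^ 'n \<Rightarrow> real \<Rightarrow> real) \<Rightarrow> bool" where
  "assumption_iii \<Omega> As \<longleftrightarrow>
     (\<forall>x\<in>closure \<Omega>. \<forall>t. 0 \<le> As x t) \<and>
     continuous_on (closure \<Omega> \<times> UNIV) (\<lambda>(x, t). As x t) \<and>
     (\<forall>x\<in>closure \<Omega>. \<forall>t>0. 0 < As x t)"

definition assumption_iv :: "(real ^ 'n) set \<Rightarrow> (real ^ 'n \<Rightarrow> real \<Rightarrow> real) \<Rightarrow> bool" where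
  "assumption_iv \<Omega> As \<longleftrightarrow>
     (\<exists>\<delta>0 C0 t0. 0 < \<delta>0 \<and> \<delta>0 < 1 / real CARD('n) \<and> 0 < C0 \<and> 0 < t0 \<and>
        (\<forall>x\<in>\<Omega>. \<forall>t g. t0 \<le> \<bar>t\<bar> \<and> GDERIV (\<lambda>y. As y t) x :> g \<longrightarrow>
           norm g \<le> C0 * As x t powr (1 + \<delta>0)))"

definition assumption_v ::
  "(real ^ 'n) set \<Rightarrow> (real ^ 'n \<Rightarrow> real \<Rightarrow> real) \<Rightarrow> ((real ^ 'n) set \<Rightarrow> real \<Rightarrow> real) \<Rightarrow> bool" where
  "assumption_v \<Omega> As CA \<longleftrightarrow>
     (\<exists>M0 M1 M2. 0 < M0 \<and> 0 < M1 \<and> 0 < M2 \<and>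
        (\<forall>\<Omega>0. \<Omega>0 \<subseteq> \<Omega> \<and> cone_property \<Omega>0 \<longrightarrow>
           (\<forall>\<alpha>\<ge>0. 0 \<le> CA \<Omega>0 \<alpha>) \<and>
           strict_mono_on {0..} (CA \<Omega>0) \<and>
           CA \<Omega>0 differentiable_on {0..} \<and>
           nabla_with M0 M1 M2 (CA \<Omega>0) \<and>
           (\<forall>\<alpha>\<ge>0. \<forall>t. \<forall>x\<in>\<Omega>0. As x (\<alpha> * t) \<le> CA \<Omega>0 \<alpha> * As x t) \<and>
           (\<forall>\<alpha>>0. real CARD('n) * CA \<Omega>0 \<alpha> > \<alpha> * deriv (CA \<Omega>0) \<alpha>)))"

definition control_function :: "(real ^ 'n) set \<Rightarrow> ((real ^ 'n) set \<Rightarrow> real \<Rightarrow> real) \<Rightarrow> real \<Rightarrow> real" where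
  "control_function \<Omega> CA = star_op CARD('n) (CA \<Omega>)"


subsection \<open>The functional and its local minimizers\<close>

definition caratheodory_function :: "(real ^ 'n) set \<Rightarrow> (real ^ 'n \<Rightarrow> real ^ 'n \<Rightarrow> real) \<Rightarrow> bool" where
  "caratheodory_function \<Omega> f \<longleftrightarrow>
     (\<forall>z. (\<lambda>x. f x z) \<in> borel_measurable (lebesgue_on \<Omega>)) \<and>
     (AE x in lebesgue_on \<Omega>. continuous_on UNIV (f x))"

definition growth_condition ::
  "(real ^ 'n) set \<Rightarrow> (real ^ 'n \<Rightarrow> real \<Rightarrow> real) \<Rightarrow> real \<Rightarrow> real \<Rightarrow> real \<Rightarrow> (real ^ 'n \<Rightarrow> real ^ 'n \<Rightarrow> real) \<Rightarrow> bool" where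
  "growth_condition \<Omega> A b1 b2 b3 f \<longleftrightarrow>
     (\<forall>x\<in>\<Omega>. \<forall>z. b2 * A x (\<Sum>i\<in>UNIV. \<bar>z $ i\<bar>) - b1 \<le> f x z \<and> f x z \<le> b3 * A x (\<Sum>i\<in>UNIV. \<bar>z $ i\<bar>) + b1)"

text \<open>The energy \<open>E(v; U)\<close> of a function \<open>v\<close> on \<open>\<Omega>\<close> over \<open>U \<subseteq> \<Omega>\<close> takes values in \<open>(-\<infinity>, \<infinity>]\<close>: under the
  growth condition the negative part has a finite integral over bounded sets.\<close>

definition energy ::
  "(real ^ 'n) set \<Rightarrow> (real ^ 'n \<Rightarrow> real ^ 'n \<Rightarrow> real) \<Rightarrow> (real ^ 'n \<Rightarrow> real) \<Rightarrow> (real ^ 'n) set \<Rightarrow> ereal" where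
  "energy \<Omega> f v U =
     enn2ereal (\<integral>\<^sup>+ x. ennreal (f x (weak_gradient \<Omega> v x)) \<partial>lebesgue_on U) -
     enn2ereal (\<integral>\<^sup>+ x. ennreal (- f x (weak_gradient \<Omega> v x)) \<partial>lebesgue_on U)"

definition local_minimizer ::
  "(real ^ 'n) set \<Rightarrow> (real ^ 'n \<Rightarrow> real \<Rightarrow> real) \<Rightarrow> (real ^ 'n \<Rightarrow> real ^ 'n \<Rightarrow> real) \<Rightarrow> (real ^ 'n \<Rightarrow> real) \<Rightarrow> bool" where
  "local_minimizer \<Omega> A f u \<longleftrightarrow>
     u \<in> W1A_loc A \<Omega> \<and>
     (\<forall>\<phi>\<in>W1A_0 A \<Omega>. compact (supp \<Omega> \<phi>) \<and> supp \<Omega> \<phi> \<subseteq> \<Omega> \<longrightarrow>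
        energy \<Omega> f u (supp \<Omega> \<phi>) \<le> energy \<Omega> f (\<lambda>x. u x + \<phi> x) (supp \<Omega> \<phi>))"

definition mean_value :: "(real ^ 'n) set \<Rightarrow> (real ^ 'n \<Rightarrow> real) \<Rightarrow> real" where
  "mean_value Q u = (LINT x|lebesgue_on Q. u x) / measure lebesgue Q"

end

theory Submission
  imports Defs
begin

text \<open>The normalisation \<open>T\<^sub>0\<close> forces \<open>C = \<AA>\<^sup>*\<^sub>\<Omega>\<close> to satisfy \<open>C(1) = 1\<close>. Since \<open>A\<^sup>*(x,\<alpha>t)/A\<^sup>*(x,t)\<close> lies between
  \<open>1/C(1/\<alpha>)\<close> and \<open>C(\<alpha>)\<close>, and both bounds equal \<open>1\<close> with the same derivative \<open>q\<close> at \<open>\<alpha> = 1\<close>, one gets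
  \<open>t \<partial>\<^sub>tA\<^sup>* = q A\<^sup>*\<close>. Hence \<open>A\<^sup>*(x,t) = A\<^sup>*(x,1) t\<^sup>q\<close>, and therefore \<open>A(x,t) = A(x,1) t\<^sup>p\<close> with \<open>1/p = 1/q - 1/n\<close>
  and a weight \<open>A(x,1)\<close> that is bounded from above and away from zero. In this weighted \<open>L\<^sup>p\<close>
  setting mollification shows that a compactly supported Sobolev function belongs to \<open>W1A_0\<close>, so that
  \<open>-\<eta>(u - a)\<close> with a cutoff \<open>\<eta>\<close> is an admissible variation; comparison of energies bounds the energy
  of \<open>u\<close> on \<open>Q\<^sub>t\<close> by its energy on \<open>Q\<^sub>t - Q\<^sub>s\<close>, and hole filling with an iteration over
  geometrically spaced cubes gives the Caccioppoli inequality.\<close>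

subsection \<open>The structure of \<open>A\<close>\<close>

lemma has_real_derivative_sandwich:
  fixes f g h :: "real \<Rightarrow> real"
  assumes g: "(g has_real_derivative D) (at x)" and h: "(h has_real_derivative D) (at x)"
    and eq: "g x = f x" "h x = f x" and le: "\<forall>\<^sub>F y in at x. g y \<le> f y \<and> f y \<le> h y"
  shows "(f has_real_derivative D) (at x)"
proof -
  let ?q = "\<lambda>k y. (k y - k x) / (y - x) - D"
  have lim: "(?q g \<longlongrightarrow> 0) (at x)" "(?q h \<longlongrightarrow> 0) (at x)"
    using g h by (auto simp: has_field_derivative_iff intro: LIM_zero)
  have "((\<lambda>y. \<bar>?q g y\<bar> + \<bar>?q h y\<bar>) \<longlongrightarrow> 0) (at x)"
    using tendsto_add[OF tendsto_rabs_zero[OF lim(1)] tendsto_rabs_zero[OF lim(2)]] by simp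
  moreover have "\<forall>\<^sub>F y in at x. norm (?q f y) \<le> \<bar>?q g y\<bar> + \<bar>?q h y\<bar>"
    using le eventually_neq_at_within[of x x]
  proof eventually_elim
    case (elim y)
    show ?case
    proof (cases "y > x")
      case True
      then have "?q g y \<le> ?q f y" "?q f y \<le> ?q h y"
        using elim eq by (auto intro!: divide_right_mono)
      then show ?thesis by auto
    next
      case False
      then have "?q h y \<le> ?q f y" "?q f y \<le> ?q g y"
        using elim eq by (auto intro!: divide_right_mono_neg)
      then show ?thesis by auto
    qed
  qed
  ultimately have "(?q f \<longlongrightarrow> 0) (at x)"
    by (rule Lim_null_comparison[rotated])
  then show ?thesis
    by (simp add: has_field_derivative_iff LIM_zero_iff)
qed

lemma power_if_control_tangent:
  fixes g C :: "real \<Rightarrow> real"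
  assumes pos: "\<And>t. t > 0 \<Longrightarrow> g t > 0"
    and ctrl: "\<And>\<alpha> t. \<alpha> \<ge> 0 \<Longrightarrow> g (\<alpha> * t) \<le> C \<alpha> * g t"
    and C1: "C 1 = 1" and C': "(C has_real_derivative q) (at 1)"
    and t: "t > 0"
  shows "g t = g 1 * t powr q"
proof -
  have der: "(g has_real_derivative q * g y / y) (at y)" if y: "y > 0" for y
  proof (rule has_real_derivative_sandwich[of "\<lambda>z. g y / C (y / z)" _ _ "\<lambda>z. C (z / y) * g y"])
    have C'': "(C has_real_derivative q) (at (y / y))" "C (y / y) \<noteq> 0" using C' C1 y by auto
    have d1: "((\<lambda>z. z / y) has_real_derivative 1 / y) (at y)"
      using y by (auto intro!: derivative_eq_intros)
    have d2: "((\<lambda>z. y / z) has_real_derivative - 1 / y) (at y)"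
      using y by (auto intro!: derivative_eq_intros simp: divide_simps power2_eq_square)
    have c1: "((\<lambda>z. C (z / y)) has_real_derivative q * (1 / y)) (at y)"
      by (rule DERIV_chain2[OF C''(1) d1])
    have c2: "((\<lambda>z. C (y / z)) has_real_derivative q * (- 1 / y)) (at y)"
      by (rule DERIV_chain2[OF C''(1) d2])
    show "((\<lambda>z. C (z / y) * g y) has_real_derivative q * g y / y) (at y)"
      using DERIV_cmult_right[OF c1, of "g y"] by simp
    show "((\<lambda>z. g y / C (y / z)) has_real_derivative q * g y / y) (at y)"
      using DERIV_divide[OF DERIV_const[of "g y"] c2 C''(2)] y C1 by (simp add: mult.commute)
    show "g y / C (y / y) = g y" "C (y / y) * g y = g y" using C1 y by auto
    have "\<forall>\<^sub>F z in at y. z > 0" using y eventually_at_in_open'[of "{0<..}" y] by simp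
    then show "\<forall>\<^sub>F z in at y. g y / C (y / z) \<le> g z \<and> g z \<le> C (z / y) * g y"
    proof eventually_elim
      case (elim z)
      have *: "g y \<le> C (y / z) * g z" using ctrl[of "y / z" z] elim y by simp
      have "C (y / z) > 0"
        using * pos[OF y] pos[OF elim] by (smt (verit) mult_nonpos_nonneg)
      then show ?case using * ctrl[of "z / y" y] elim y by (simp add: divide_simps mult.commute)
    qed
  qed
  have const: "((\<lambda>y. g y * y powr (- q)) has_real_derivative 0) (at y)" if "y > 0" for y
    using that
    by (auto intro!: derivative_eq_intros der simp: powr_diff powr_minus divide_simps)
  have "(\<lambda>y. g y * y powr (- q)) t = (\<lambda>y. g y * y powr (- q)) 1"
    using t const by (intro DERIV_isconst3[of 0 "t + 2"]) auto
  then show ?thesis using t by (simp add: powr_minus field_simps)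
qed

lemma N_function_increasing:
  assumes "N_function A" "0 \<le> s" "s < t"
  shows "A s < A t"
proof -
  have cv: "convex_on UNIV A" and 0: "A 0 = 0" and pos: "A t > 0"
    using assms by (auto simp: N_function_def)
  have "A ((1 - s / t) *\<^sub>R 0 + (s / t) *\<^sub>R t) \<le> (1 - s / t) * A 0 + (s / t) * A t"
    using assms by (intro convex_onD[OF cv]) auto
  then have "A s \<le> (s / t) * A t" using assms 0 by simp
  also have "\<dots> < 1 * A t" using assms pos by (intro mult_strict_right_mono) auto
  finally show ?thesis by simp
qed

lemma N_function_bij:
  assumes A: "N_function A"
  shows "bij_betw A {0..} {0..}"
proof -
  have inj: "inj_on A {0..}"
    by (rule linorder_inj_onI) (use N_function_increasing[OF A] in \<open>force+\<close>)
  have nonneg: "A t \<ge> 0" for t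
    using A by (cases "t = 0") (auto simp: N_function_def less_imp_le)
  have "y \<in> A ` {0..}" if y: "y \<ge> 0" for y
  proof -
    have "eventually (\<lambda>t. A t / t \<ge> y) at_top"
      using A by (auto simp: N_function_def filterlim_at_top)
    then have "eventually (\<lambda>t. A t / t \<ge> y \<and> t \<ge> 1) at_top"
      using eventually_ge_at_top[of 1] by (rule eventually_conj)
    then obtain t where t: "A t / t \<ge> y" "t \<ge> 1" by (auto simp: eventually_at_top_linorder)
    have "y \<le> y * t" using y t mult_left_mono[of 1 t y] by simp
    also have "\<dots> \<le> A t" using t by (simp add: field_simps)
    finally have "y \<le> A t" .
    moreover have "A 0 \<le> y" "continuous_on {0..t} A"
      using A y by (auto simp: N_function_def intro: continuous_on_subset)
    ultimately obtain x where "0 \<le> x" "x \<le> t" "A x = y"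
      using IVT'[of A 0 y t] t by auto
    then show ?thesis by auto
  qed
  with inj nonneg show ?thesis by (auto simp: bij_betw_def)
qed

lemma N_function_power_exponent:
  assumes A: "N_function A" and eq: "\<And>t. t > 0 \<Longrightarrow> A t = c * t powr p" and c: "c > 0"
  shows "p > 1"
proof (rule ccontr)
  assume "\<not> p > 1"
  have lim: "((\<lambda>t. A t / t) \<longlongrightarrow> 0) (at_right 0)" using A by (simp add: N_function_def)
  have "\<forall>\<^sub>F t in at_right 0. t < (1::real)" "\<forall>\<^sub>F t in at_right 0. t > (0::real)"
    by (auto simp: eventually_at_right_field intro: exI[of _ 1])
  then have "\<forall>\<^sub>F t in at_right 0. c \<le> A t / t"
  proof eventually_elim
    case (elim t)
    have "1 = t powr 0" using elim by simp
    also have "\<dots> \<le> t powr (p - 1)" using elim \<open>\<not> p > 1\<close> by (intro powr_mono') auto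
    finally have "1 \<le> t powr (p - 1)" .
    then have "c * 1 \<le> c * t powr (p - 1)" using c by (intro mult_left_mono) auto
    also have "\<dots> = A t / t" using elim by (simp add: eq powr_diff)
    finally show ?case by simp
  qed
  then have "c \<le> 0" using tendsto_lowerbound[OF lim] by simp
  with c show False by simp
qed

lemma inv_nonneg_power:
  assumes B: "\<And>t. t > 0 \<Longrightarrow> B t = b * t powr q" "B 0 = 0" and b: "b > 0" "q > 0" and s: "s > 0"
  shows "inv_nonneg B s = (s / b) powr (1 / q)"
  unfolding inv_nonneg_def
proof (rule inv_into_f_eq)
  show "inj_on B {0..}"
  proof (rule linorder_inj_onI)
    fix x y :: real assume xy: "x < y" "x \<in> {0..}" "y \<in> {0..}"
    show "B x \<noteq> B y"
    proof (cases "x = 0")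
      case True then show ?thesis using B xy b by auto
    next
      case False
      then have "b * x powr q < b * y powr q" using xy b by (auto intro!: powr_less_mono2)
      then show ?thesis using B xy False by auto
    qed
  qed auto
  show "B ((s / b) powr (1 / q)) = s" using B b s by (simp add: powr_powr)
qed auto

lemma sobolev_conjugate_power:
  fixes n q b :: real
  assumes A: "N_function A" and n: "n > 0"
    and diff: "(\<lambda>t. A t powr (- 1 / n)) differentiable_on {0<..}"
    and star: "\<And>s. s > 0 \<Longrightarrow> inv_nonneg B s = s powr ((n + 1) / n) * deriv (inv_nonneg A) s"
    and B: "\<And>t. t > 0 \<Longrightarrow> B t = b * t powr q" "B 0 = 0" and b: "b > 0" "0 < q" "q < n"
  defines "r \<equiv> 1 / q - 1 / n"
  shows "r > 0" "r < 1" "A 1 = (r * b powr (1 / q)) powr (1 / r)" "A t = A 1 * \<bar>t\<bar> powr (1 / r)"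
proof -
  show r: "r > 0" using b n by (simp add: r_def frac_less2)
  have pos: "A t > 0" if "t > 0" for t using A that by (auto simp: N_function_def)
  have diffA: "A differentiable (at t)" if t: "t > 0" for t
  proof -
    have "(\<lambda>t. A t powr (- 1 / n)) differentiable (at t)"
      using diff t by (auto simp: differentiable_on_def at_within_open[OF _ open_greaterThan])
    then obtain D where "((\<lambda>t. A t powr (- 1 / n)) has_real_derivative D) (at t)"
      by (auto simp: real_differentiable_def)
    from DERIV_chain2[OF has_real_derivative_powr this, of "- n"]
    obtain D' where "((\<lambda>t. (A t powr (- 1 / n)) powr (- n)) has_real_derivative D') (at t)"
      using pos[OF t] by auto
    moreover have "\<forall>\<^sub>F y in nhds t. (A y powr (- 1 / n)) powr (- n) = A y"
    proof -
      have "\<forall>\<^sub>F y in nhds t. y > 0" using t eventually_nhds_in_open[of "{0<..}" t] by simp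
      then show ?thesis by eventually_elim (use n pos in \<open>simp add: powr_powr less_imp_le\<close>)
    qed
    ultimately have "(A has_real_derivative D') (at t)"
      using DERIV_cong_ev[of t t "\<lambda>t. (A t powr (- 1 / n)) powr (- n)" A D' D'] by simp
    then show ?thesis by (auto simp: real_differentiable_def)
  qed
  have derA: "(A has_real_derivative b powr (1 / q) * A t powr (1 - r)) (at t)" if t: "t > 0" for t
  proof -
    obtain D where D: "(A has_real_derivative D) (at t)"
      using diffA[OF t] by (auto simp: real_differentiable_def)
    have cv: "convex_on UNIV A" using A by (simp add: N_function_def)
    have "A 0 \<ge> A t + D * (0 - t)"
      using convex_on_imp_above_tangent[OF cv _ _ _ D, of 0] by simp
    then have "D \<noteq> 0" using A pos[OF t] by (auto simp: N_function_def)
    have "(inv_nonneg A has_real_derivative inverse D) (at (A t))"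
      unfolding has_field_derivative_def
    proof (rule has_derivative_inverse_strong[of "{0<..}" t A "inv_nonneg A" "(*) D"])
      show "(A has_derivative (*) D) (at t)" using D by (simp add: has_field_derivative_def)
      show "(*) D \<circ> (*) (inverse D) = id" using \<open>D \<noteq> 0\<close> by (auto simp: fun_eq_iff)
      show "continuous_on {0<..} A" using A by (auto simp: N_function_def intro: continuous_on_subset)
      show "inv_nonneg A (A z) = z" if "z \<in> {0<..}" for z
        using that N_function_bij[OF A]
        by (auto simp: inv_nonneg_def bij_betw_def intro!: inv_into_f_f)
    qed (use t in auto)
    then have "deriv (inv_nonneg A) (A t) = 1 / D" by (simp add: DERIV_imp_deriv inverse_eq_divide)
    then have "(A t / b) powr (1 / q) = A t powr ((n + 1) / n) / D"
      using star[OF pos[OF t]] inv_nonneg_power[OF B b(1,2) pos[OF t]] by simp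
    then have "D = A t powr ((n + 1) / n) / (A t / b) powr (1 / q)"
      using \<open>D \<noteq> 0\<close> pos[OF t] b by (simp add: field_simps)
    also have "\<dots> = b powr (1 / q) * A t powr ((n + 1) / n - 1 / q)"
      unfolding powr_diff using powr_divide[of "A t" b "1 / q"] pos[OF t] b by simp
    also have "(n + 1) / n - 1 / q = 1 - r" using n by (simp add: r_def add_divide_distrib)
    finally show ?thesis using D by simp
  qed
  define f where "f t = A t powr r - r * b powr (1 / q) * t" for t
  have const: "(f has_real_derivative 0) (at t)" if t: "t > 0" for t
    unfolding f_def using pos[OF t]
    by (auto intro!: derivative_eq_intros derA[OF t] simp: powr_diff)
  have f1: "f t = f 1" if "t > 0" for t
    using that const by (intro DERIV_isconst3[of 0 "t + 2"]) auto
  have "(f \<longlongrightarrow> f 0) (at_right 0)"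
  proof -
    have "continuous_on UNIV A" using A by (simp add: N_function_def)
    then have "isCont A 0" by (simp add: continuous_on_eq_continuous_at)
    then have "(A \<longlongrightarrow> A 0) (at_right 0)" by (simp add: isCont_def filterlim_at_split)
    moreover have "\<forall>\<^sub>F t in at_right 0. 0 \<le> A t"
      using pos by (auto simp: eventually_at_right_field intro!: exI[of _ 1] less_imp_le)
    moreover have "A 0 = 0" using A by (simp add: N_function_def)
    ultimately have "((\<lambda>t. A t powr r) \<longlongrightarrow> 0) (at_right 0)"
      using tendsto_powr2[of A 0 "at_right 0" "\<lambda>_. r" r] r by simp
    then have "(f \<longlongrightarrow> 0 - r * b powr (1 / q) * 0) (at_right 0)"
      unfolding f_def by (intro tendsto_intros)
    then show ?thesis by (simp add: f_def \<open>A 0 = 0\<close>)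
  qed
  moreover have "(f \<longlongrightarrow> f 1) (at_right 0)"
    by (rule tendsto_eventually, unfold eventually_at_right_field, blast intro: f1 zero_less_one)
  ultimately have "f 1 = f 0" by (intro tendsto_unique[of "at_right 0" f]) auto
  moreover have "A 0 = 0" using A by (simp add: N_function_def)
  then have "f 0 = 0" by (simp add: f_def)
  ultimately have f0: "f t = 0" if "t > 0" for t
    using f1[OF that] by simp
  have pw: "A t = (r * b powr (1 / q)) powr (1 / r) * t powr (1 / r)" if t: "t > 0" for t
  proof -
    have "A t = (A t powr r) powr (1 / r)" using r pos[OF t] by (simp add: powr_powr)
    also have "A t powr r = r * b powr (1 / q) * t" using f0[OF t] by (simp add: f_def)
    also have "(r * b powr (1 / q) * t) powr (1 / r) = (r * b powr (1 / q)) powr (1 / r) * t powr (1 / r)"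
      by (rule powr_mult)
    finally show ?thesis .
  qed
  show A1: "A 1 = (r * b powr (1 / q)) powr (1 / r)" using pw[of 1] by simp
  have "1 / r > 1" using N_function_power_exponent[OF A pw] r b by simp
  then show "r < 1" using r by (simp add: field_simps)
  have "A (- t) = A t" "A 0 = 0" using A by (simp_all add: N_function_def)
  then have "A t = A \<bar>t\<bar>" by (simp add: abs_if)
  show "A t = A 1 * \<bar>t\<bar> powr (1 / r)"
  proof (cases "t = 0")
    case True
    then show ?thesis by (simp add: \<open>A 0 = 0\<close>)
  next
    case False
    then show ?thesis unfolding \<open>A t = A \<bar>t\<bar>\<close> A1 by (intro pw) simp
  qed
qed

lemma star_op_eq_1_imp:
  assumes "star_defined n C" "hat_op (star_op n C) T = 1" "T \<ge> 1"
  shows "C T = 1"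
proof -
  have bij: "bij_betw C {0..} {0..}" "bij_betw (star_inv n C) {0..} {0..}"
    using assms by (auto simp: star_defined_def)
  have "star_op n C (1 / T) = 1" using assms by (auto simp: hat_op_def split: if_splits)
  moreover have "1 / T \<in> star_inv n C ` {0..}" using bij(2) assms(3) by (auto simp: bij_betw_def)
  ultimately have "star_inv n C 1 = 1 / T"
    unfolding star_op_def inv_nonneg_def by (metis f_inv_into_f)
  then have "inv_nonneg C 1 = T" by (simp add: star_inv_def)
  moreover have "1 \<in> C ` {0..}" using bij(1) by (auto simp: bij_betw_def)
  ultimately show ?thesis unfolding inv_nonneg_def by (metis f_inv_into_f)
qed

proposition power_structure:
  fixes \<Omega> :: "(real ^ 'n) set"
  assumes \<Omega>: "bounded \<Omega>" "\<Omega> \<noteq> {}" "cone_property \<Omega>" "open \<Omega>"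
    and i: "assumption_i \<Omega> A" and star: "is_A_star \<Omega> A As" and ii: "N_class \<Omega> As"
    and iii: "assumption_iii \<Omega> As" and v: "assumption_v \<Omega> As CA"
    and control: "star_defined CARD('n) (CA \<Omega>)"
    and T0: "\<exists>T0\<ge>1. hat_op (control_function \<Omega> CA) T0 = 1"
  obtains p m M where "1 < p" "0 < m"
    "AE x in lebesgue_on \<Omega>. m \<le> A x 1 \<and> A x 1 \<le> M \<and> (\<forall>t. A x t = A x 1 * \<bar>t\<bar> powr p)"
proof -
  let ?n = "real CARD('n)"
  define C where "C = CA \<Omega>"
  obtain M0 M1 M2 where v': "\<forall>\<Omega>0. \<Omega>0 \<subseteq> \<Omega> \<and> cone_property \<Omega>0 \<longrightarrow>
           (\<forall>\<alpha>\<ge>0. 0 \<le> CA \<Omega>0 \<alpha>) \<and>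
           strict_mono_on {0..} (CA \<Omega>0) \<and>
           CA \<Omega>0 differentiable_on {0..} \<and>
           nabla_with M0 M1 M2 (CA \<Omega>0) \<and>
           (\<forall>\<alpha>\<ge>0. \<forall>t. \<forall>x\<in>\<Omega>0. As x (\<alpha> * t) \<le> CA \<Omega>0 \<alpha> * As x t) \<and>
           (\<forall>\<alpha>>0. real CARD('n) * CA \<Omega>0 \<alpha> > \<alpha> * deriv (CA \<Omega>0) \<alpha>)"
    using v unfolding assumption_v_def by (elim exE conjE)
  note v'' = v'[rule_format, OF conjI[OF order_refl \<Omega>(3)], folded C_def]
  have C: "strict_mono_on {0..} C" "C differentiable_on {0..}"
    using v'' by blast+
  have ctrl: "As x (\<alpha> * t) \<le> C \<alpha> * As x t" if "\<alpha> \<ge> 0" "x \<in> \<Omega>" for \<alpha> t x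
    using v'' that by blast
  have Cn: "?n * C \<alpha> > \<alpha> * deriv C \<alpha>" if "\<alpha> > 0" for \<alpha>
    using v'' that by blast
  obtain T where T: "T \<ge> 1" "C T = 1"
    using T0 star_op_eq_1_imp[OF control] by (auto simp: control_function_def C_def)
  have pos: "As x t > 0" if "x \<in> closure \<Omega>" "t > 0" for x t
    using iii that by (auto simp: assumption_iii_def)
  obtain x0 where "x0 \<in> \<Omega>" using \<Omega> by auto
  then have "As x0 1 \<le> C 1 * As x0 1" "As x0 1 > 0"
    using ctrl[of 1 x0 1] pos[OF subsetD[OF closure_subset]] by simp_all
  then have "1 \<le> C 1" by simp
  moreover have "C 1 \<le> C T" using strict_mono_on_leD[OF C(1), of 1 T] T by simp
  ultimately have C1: "C 1 = 1" using T by simp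
  have "C differentiable (at 1)"
  proof -
    have "C differentiable (at 1 within {0<..})"
    proof (rule differentiable_within_subset)
      show "C differentiable (at 1 within {0..})" using C(2) by (simp add: differentiable_on_def)
      show "{0<..} \<subseteq> {0::real..}" by auto
    qed
    then show ?thesis by (simp add: at_within_open[of _ "{0<..}"])
  qed
  then obtain q where q: "(C has_real_derivative q) (at 1)" by (auto simp: real_differentiable_def)
  then have qn: "q < ?n" using Cn[of 1] C1 by (simp add: DERIV_imp_deriv)
  have As: "As x t = As x 1 * t powr q" if "x \<in> \<Omega>" "t > 0" for x t
  proof (rule power_if_control_tangent[OF _ _ C1 q that(2)])
    show "As x t > 0" if "t > 0" for t
      using \<open>x \<in> \<Omega>\<close> that closure_subset by (blast intro: pos)
    show "As x (\<alpha> * t) \<le> C \<alpha> * As x t" if "\<alpha> \<ge> 0" for \<alpha> t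
      by (rule ctrl[OF that \<open>x \<in> \<Omega>\<close>])
  qed
  have As': "\<forall>t>0. As x t = As x 1 * t powr q" if "x \<in> \<Omega>" for x
    using As[OF that] by blast
  define r where "r = 1 / q - 1 / ?n"
  have AEp: "AE x in lebesgue_on \<Omega>. q > 0 \<and> 0 < r \<and> r < 1 \<and>
      A x 1 = (r * As x 1 powr (1 / q)) powr (1 / r) \<and> (\<forall>t. A x t = A x 1 * \<bar>t\<bar> powr (1 / r))"
  proof -
    have "AE x in lebesgue_on \<Omega>. x \<in> \<Omega>" using AE_space[of "lebesgue_on \<Omega>"] by simp
    moreover have "AE x in lebesgue_on \<Omega>. N_function (A x)"
      using i unfolding assumption_i_def N_class_def by (elim conjE)
    moreover have "AE x in lebesgue_on \<Omega>. N_function (As x)"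
      using ii unfolding N_class_def by (elim conjE)
    moreover have "AE x in lebesgue_on \<Omega>. (\<lambda>t. A x t powr (- 1 / ?n)) differentiable_on {0<..}"
      using conjunct2[OF i[unfolded assumption_i_def]] by (rule eventually_mono) (rule conjunct2)
    moreover note star[unfolded is_A_star_def]
    ultimately show ?thesis
    proof eventually_elim
      case (elim x)
      have Asx: "As x 1 > 0" by (rule pos[OF subsetD[OF closure_subset elim(1)] zero_less_one])
      have "q > 1"
      proof (rule N_function_power_exponent[OF elim(3) _ Asx])
        show "As x t = As x 1 * t powr q" if "t > 0" for t
          by (rule As'[OF elim(1), rule_format, OF that])
      qed
      then have q0: "q > 0" by linarith
      have st: "inv_nonneg (As x) s = s powr ((?n + 1) / ?n) * deriv (inv_nonneg (A x)) s" if "s > 0" for s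
        using conjunct2[OF conjunct2[OF elim(5)]] that by (elim allE impE)
      have 0: "As x 0 = 0" by (rule conjunct1[OF conjunct2[OF elim(5)]])
      have n0: "?n > 0" by simp
      note * = sobolev_conjugate_power[where A="A x" and B="As x" and n="?n" and q=q and b="As x 1",
          OF elim(2) n0 elim(4) st As'[OF elim(1), rule_format] 0 Asx q0 qn, folded r_def]
      show ?case
        by (intro conjI allI) (rule q0 * | assumption)+
    qed
  qed
  have "\<not> (AE x in lebesgue_on \<Omega>. False)"
  proof
    assume "AE x in lebesgue_on \<Omega>. False"
    then have "negligible \<Omega>"
      using AE_restrict_space_iff[of \<Omega> lebesgue "\<lambda>_. False"] AE_iff_null_sets[of \<Omega> lebesgue] \<Omega>(4)
      by (simp add: negligible_iff_null_sets)
    then show False using open_not_negligible \<Omega> by blast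
  qed
  moreover have "AE x in lebesgue_on \<Omega>. False" if "\<not> (q > 0 \<and> 0 < r \<and> r < 1)"
    using AEp by eventually_elim (use that in auto)
  ultimately have qr: "q > 0" "0 < r" "r < 1" by blast+
  have cmp: "compact (closure \<Omega>)" "closure \<Omega> \<noteq> {}" using \<Omega> by auto
  have "continuous_on (closure \<Omega>) ((\<lambda>(x, t). As x t) \<circ> (\<lambda>x. (x, 1)))"
    using iii by (intro continuous_on_compose continuous_intros)
      (auto simp: assumption_iii_def intro: continuous_on_subset)
  then have cont: "continuous_on (closure \<Omega>) (\<lambda>x. As x 1)" by (simp add: o_def)
  obtain y z where yz: "y \<in> closure \<Omega>" "\<And>x. x \<in> closure \<Omega> \<Longrightarrow> As y 1 \<le> As x 1"
    "z \<in> closure \<Omega>" "\<And>x. x \<in> closure \<Omega> \<Longrightarrow> As x 1 \<le> As z 1"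
    using continuous_attains_inf[OF cmp cont] continuous_attains_sup[OF cmp cont] by metis
  define F where "F a = (r * a powr (1 / q)) powr (1 / r)" for a
  show ?thesis
  proof (rule that[of "1 / r" "F (As y 1)" "F (As z 1)"])
    show "1 < 1 / r" using qr by simp
    have y1: "As y 1 > 0" using pos yz by simp
    then show "0 < F (As y 1)" using qr by (simp add: F_def)
    have mono: "F a \<le> F b" if "0 < a" "a \<le> b" for a b
      using that qr by (auto simp: F_def intro!: powr_mono2)
    have "AE x in lebesgue_on \<Omega>. x \<in> \<Omega>" using AE_space[of "lebesgue_on \<Omega>"] by simp
    with AEp show "AE x in lebesgue_on \<Omega>. F (As y 1) \<le> A x 1 \<and> A x 1 \<le> F (As z 1) \<and>
        (\<forall>t. A x t = A x 1 * \<bar>t\<bar> powr (1 / r))"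
    proof eventually_elim
      case (elim x)
      have x: "x \<in> closure \<Omega>" using elim(2) closure_subset by blast
      have Ax: "A x 1 = F (As x 1)" using elim(1) unfolding F_def by blast
      have "F (As y 1) \<le> A x 1" "A x 1 \<le> F (As z 1)"
        unfolding Ax using mono[OF y1 yz(2)[OF x]] mono[OF pos[OF x zero_less_one] yz(4)[OF x]] by auto
      then show ?case using elim(1) by blast
    qed
  qed
qed

subsection \<open>Smooth functions\<close>

primrec D1 :: "nat \<Rightarrow> (real \<Rightarrow> real) \<Rightarrow> bool" where
  "D1 0 h = True"
| "D1 (Suc k) h = (\<exists>h'. (\<forall>x. (h has_real_derivative h' x) (at x)) \<and> D1 k h')"

lemma D1_SucI: "(\<And>x. (h has_real_derivative h' x) (at x)) \<Longrightarrow> D1 k h' \<Longrightarrow> D1 (Suc k) h"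
  by auto

lemma D1_Suc: "D1 (Suc k) h \<Longrightarrow> D1 k h"
proof (induction k arbitrary: h)
  case (Suc k)
  then obtain h' where "\<forall>x. (h has_real_derivative h' x) (at x)" "D1 (Suc k) h'" by auto
  then show ?case using Suc.IH[of h'] unfolding D1.simps(2)[of k h] by blast
qed simp

lemma D1_const: "D1 k (\<lambda>_. c)"
proof (induction k arbitrary: c)
  case (Suc k)
  then show ?case by (auto intro!: exI[of _ "\<lambda>_. 0"])
qed simp

lemma D1_add: "D1 k f \<Longrightarrow> D1 k g \<Longrightarrow> D1 k (\<lambda>x. f x + g x)"
proof (induction k arbitrary: f g)
  case (Suc k)
  then obtain f' g' where "\<forall>x. (f has_real_derivative f' x) (at x)" "\<forall>x. (g has_real_derivative g' x) (at x)"
    and "D1 k f'" "D1 k g'" by auto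
  then show ?case using Suc.IH[of f' g']
    unfolding D1.simps by (intro exI[of _ "\<lambda>x. f' x + g' x"] conjI allI DERIV_add) auto
qed simp

lemma D1_mult: "D1 k f \<Longrightarrow> D1 k g \<Longrightarrow> D1 k (\<lambda>x. f x * g x)"
proof (induction k arbitrary: f g)
  case (Suc k)
  then obtain f' g' where d: "\<forall>x. (f has_real_derivative f' x) (at x)" "\<forall>x. (g has_real_derivative g' x) (at x)"
    and D: "D1 k f'" "D1 k g'" by auto
  have "D1 k (\<lambda>x. f' x * g x + g' x * f x)"
    using D Suc.prems[THEN D1_Suc] by (intro D1_add Suc.IH)
  moreover have "((\<lambda>x. f x * g x) has_real_derivative f' x * g x + g' x * f x) (at x)" for x
    using d by (intro DERIV_mult) auto
  ultimately show ?case by (rule D1_SucI[rotated])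
qed simp

lemma D1_compose: "D1 k f \<Longrightarrow> D1 k g \<Longrightarrow> D1 k (\<lambda>x. f (g x))"
proof (induction k arbitrary: f)
  case (Suc k)
  then obtain f' g' where d: "\<forall>x. (f has_real_derivative f' x) (at x)" "\<forall>x. (g has_real_derivative g' x) (at x)"
    and D: "D1 k f'" "D1 k g'" by auto
  have "D1 k (\<lambda>x. f' (g x) * g' x)"
    by (rule D1_mult[OF Suc.IH[OF D(1) Suc.prems(2)[THEN D1_Suc]] D(2)])
  moreover have "((\<lambda>x. f (g x)) has_real_derivative f' (g x) * g' x) (at x)" for x
    by (rule DERIV_chain2[of f, OF d(1)[rule_format] d(2)[rule_format]])
  ultimately show ?case by (rule D1_SucI[rotated])
qed simp

lemma D1_ident: "D1 k (\<lambda>x. x)"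
proof (cases k)
  case (Suc j)
  then show ?thesis using D1_const[of j 1] by (auto intro!: exI[of _ "\<lambda>_. 1"])
qed simp

lemma poly_exp_minus_tendsto_0: "((\<lambda>y::real. poly P y * exp (- y)) \<longlongrightarrow> 0) at_top"
proof -
  have "((\<lambda>y. \<Sum>i\<le>degree P. coeff P i * (y ^ i / exp y)) \<longlongrightarrow> (\<Sum>i\<le>degree P. coeff P i * 0)) at_top"
    by (intro tendsto_intros tendsto_power_div_exp_0)
  then show ?thesis by (simp add: poly_altdef exp_minus sum_divide_distrib divide_inverse sum_distrib_right mult.assoc)
qed

definition flat :: "real poly \<Rightarrow> real \<Rightarrow> real" where
  "flat P x = (if x \<le> 0 then 0 else poly P (1 / x) * exp (- (1 / x)))"

lemma DERIV_flat: "(flat P has_real_derivative flat ([:0, 0, 1:] * (P - pderiv P)) x) (at x)"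
proof (cases x "0::real" rule: linorder_cases)
  case less
  have ev: "\<forall>\<^sub>F y in nhds x. flat P y = 0"
    using eventually_nhds_in_open[of "{..<0}" x] less
    by (auto elim!: eventually_mono simp: flat_def)
  have "((\<lambda>_. 0) has_real_derivative 0) (at x)" by simp
  then have "(flat P has_real_derivative 0) (at x)"
    using DERIV_cong_ev[OF refl ev refl] by blast
  then show ?thesis using less by (simp add: flat_def)
next
  case greater
  let ?f = "\<lambda>y. poly P (1 / y) * exp (- (1 / y))"
  have ev: "\<forall>\<^sub>F y in nhds x. flat P y = ?f y"
    using eventually_nhds_in_open[of "{0<..}" x] greater
    by (auto elim!: eventually_mono simp: flat_def)
  have d: "((\<lambda>y. 1 / y) has_real_derivative - 1 / x^2) (at x)"
    using greater by (auto intro!: derivative_eq_intros simp: power2_eq_square)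
  have "(?f has_real_derivative (poly (pderiv P) (1 / x) * (- 1 / x^2)) * exp (- (1 / x))
      + (exp (- (1 / x)) * (- (- 1 / x^2))) * poly P (1 / x)) (at x)"
    by (intro DERIV_mult DERIV_chain2[OF poly_DERIV d] DERIV_fun_exp DERIV_minus d)
  then have "(?f has_real_derivative flat ([:0, 0, 1:] * (P - pderiv P)) x) (at x)"
    by (rule DERIV_cong) (use greater in \<open>simp add: flat_def field_simps power2_eq_square\<close>)
  then show ?thesis using DERIV_cong_ev[OF refl ev refl] by blast
next
  case equal
  have "((\<lambda>h. flat P h / h) \<longlongrightarrow> 0) (at 0)"
  proof (rule filterlim_split_at_real)
    have "\<forall>\<^sub>F h in at_left 0. 0 = flat P h / h"
      by (auto simp: eventually_at_left_field flat_def intro!: exI[of _ "-1"])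
    then show "((\<lambda>h. flat P h / h) \<longlongrightarrow> 0) (at_left 0)"
      by (rule Lim_transform_eventually[OF tendsto_const])
    have "((\<lambda>h::real. poly (pCons 0 P) (inverse h) * exp (- inverse h)) \<longlongrightarrow> 0) (at_right 0)"
      by (rule filterlim_compose[OF poly_exp_minus_tendsto_0 filterlim_inverse_at_top_right])
    moreover have "\<forall>\<^sub>F h in at_right 0. poly (pCons 0 P) (inverse h) * exp (- inverse h) = flat P h / h"
      by (auto simp: eventually_at_right_field flat_def inverse_eq_divide intro!: exI[of _ 1])
    ultimately show "((\<lambda>h. flat P h / h) \<longlongrightarrow> 0) (at_right 0)" by (rule Lim_transform_eventually)
  qed
  then show ?thesis unfolding equal by (simp add: DERIV_def flat_def)
qed

lemma D1_flat: "D1 k (flat P)"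
proof (induction k arbitrary: P)
  case (Suc k)
  then show ?case unfolding D1.simps using DERIV_flat by blast
qed simp

lemma smooth_step_exists:
  obtains H L where "\<And>k. D1 k H" "\<And>y. 0 \<le> H y \<and> H y \<le> 1" "\<And>y. y \<le> 0 \<Longrightarrow> H y = 0" "\<And>y. y \<ge> 1 \<Longrightarrow> H y = 1"
    "\<And>y D. (H has_real_derivative D) (at y) \<Longrightarrow> \<bar>D\<bar> \<le> L" "L > 0"
proof -
  define g where "g = flat 1"
  have g: "g y = (if y \<le> 0 then 0 else exp (- (1 / y)))" for y by (simp add: g_def flat_def)
  have g01: "0 \<le> g y" for y by (simp add: g)
  have gmono: "g y \<le> g z" if "y \<le> z" for y z using that by (auto simp: g frac_le)
  define H where "H y = exp 1 * g (1 + (- exp 1) * g (1 + (-1) * y))" for y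
  have D: "D1 k H" for k unfolding H_def[abs_def] g_def
    by (intro D1_mult D1_add D1_const D1_ident D1_flat
        D1_compose[OF D1_flat, where g="\<lambda>y. 1 + (- exp 1) * flat 1 (1 + (-1) * y)"]
        D1_compose[OF D1_flat, where g="\<lambda>y. 1 + (-1) * y"])
  have e1: "exp 1 * g 1 = 1" by (simp add: g exp_minus)
  have rng: "0 \<le> H y \<and> H y \<le> 1" for y
  proof
    show "0 \<le> H y" by (simp add: H_def g01)
    have "g (1 + (- exp 1) * g (1 + (-1) * y)) \<le> g 1" by (rule gmono) (simp add: g01)
    then have "H y \<le> exp 1 * g 1" by (simp add: H_def)
    then show "H y \<le> 1" using e1 by simp
  qed
  have H0: "H y = 0" if "y \<le> 0" for y
  proof -
    have "exp 1 * g 1 \<le> exp 1 * g (1 - y)" using gmono[of 1 "1 - y"] that by simp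
    then have "1 + (- exp 1) * g (1 + (-1) * y) \<le> 0" using e1 by simp
    then show ?thesis unfolding H_def g[of "1 + (- exp 1) * g (1 + (-1) * y)"] by simp
  qed
  have H1: "H y = 1" if "y \<ge> 1" for y
  proof -
    have "g (1 + (-1) * y) = 0" using that by (simp add: g)
    then show ?thesis using e1 by (simp add: H_def)
  qed
  obtain H' where H': "\<And>y. (H has_real_derivative H' y) (at y)" "D1 1 H'"
    using D[of 2] by (auto simp: numeral_2_eq_2)
  have "continuous_on {0..1} H'"
    using H'(2) by (force intro: continuous_at_imp_continuous_on DERIV_isCont)
  then have "bounded (H' ` {0..1})" by (intro compact_imp_bounded compact_continuous_image) auto
  then obtain L where L: "L > 0" "\<And>y. y \<in> {0..1} \<Longrightarrow> \<bar>H' y\<bar> \<le> L"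
    by (auto simp: bounded_pos)
  have "H' y = 0" if "y \<notin> {0..1}" for y
  proof -
    have ev: "\<forall>\<^sub>F z in nhds y. H z = (if y < 0 then 0 else 1)"
    proof (cases "y < 0")
      case True
      then show ?thesis using eventually_nhds_in_open[of "{..<0}" y] H0
        by (auto elim!: eventually_mono)
    next
      case False
      then show ?thesis using eventually_nhds_in_open[of "{1<..}" y] H1 that
        by (auto elim!: eventually_mono)
    qed
    have "((\<lambda>_. if y < 0 then 0 else 1) has_real_derivative 0) (at y)" by simp
    then have "(H has_real_derivative 0) (at y)" using DERIV_cong_ev[OF refl ev refl] by blast
    then show ?thesis using H'(1) DERIV_unique by blast
  qed
  then have "\<bar>H' y\<bar> \<le> L" for y using L by (cases "y \<in> {0..1}") auto
  then have "\<bar>D\<bar> \<le> L" if "(H has_real_derivative D) (at y)" for y D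
    using DERIV_unique[OF that H'(1)[of y]] by simp
  then show ?thesis using that[of H L] D rng H0 H1 L(1) by blast
qed

definition smooth :: "(real ^ 'n \<Rightarrow> real) \<Rightarrow> bool" where
  "smooth \<phi> \<longleftrightarrow> (\<forall>k. Ck k \<phi>)"

lemma Ck_Suc: "Ck (Suc k) \<phi> \<Longrightarrow> Ck k \<phi>"
proof (induction k arbitrary: \<phi>)
  case 0
  then show ?case
    by (auto intro!: continuous_at_imp_continuous_on differentiable_imp_continuous_within)
next
  case (Suc k)
  then have "Ck k (partial_deriv i \<phi>)" for i by auto
  then show ?case using Suc by auto
qed

lemma smooth_partial: "smooth \<phi> \<Longrightarrow> smooth (partial_deriv i \<phi>)"
  unfolding smooth_def by (meson Ck.simps(2))

lemma smooth_differentiable: "smooth \<phi> \<Longrightarrow> \<phi> differentiable (at x)"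
  unfolding smooth_def by (meson Ck.simps(2))

lemma smooth_continuous: "smooth \<phi> \<Longrightarrow> continuous_on S \<phi>"
  unfolding smooth_def by (metis Ck.simps(1) continuous_on_subset subset_UNIV)

lemma smooth_coinduct:
  assumes "P \<phi>" and step: "\<And>\<phi> x. P \<phi> \<Longrightarrow> \<phi> differentiable (at x)" "\<And>\<phi> i. P \<phi> \<Longrightarrow> P (partial_deriv i \<phi>)"
  shows "smooth \<phi>"
proof -
  have "P \<phi> \<Longrightarrow> Ck k \<phi>" for k \<phi>
  proof (induction k arbitrary: \<phi>)
    case 0
    then show ?case using step(1)
      by (auto intro!: continuous_at_imp_continuous_on differentiable_imp_continuous_within)
  next
    case (Suc k)
    then show ?case using step by auto
  qed
  then show ?thesis using assms(1) by (auto simp: smooth_def)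
qed

lemma partial_deriv_eqI: "(\<phi> has_derivative D) (at x) \<Longrightarrow> partial_deriv i \<phi> x = D (axis i 1)"
  unfolding partial_deriv_def by (metis frechet_derivative_at)

lemma has_derivative_partial:
  fixes \<phi> :: "real ^ 'n \<Rightarrow> real"
  assumes "\<phi> differentiable (at x)"
  shows "(\<phi> has_derivative (\<lambda>h. \<Sum>i\<in>UNIV. partial_deriv i \<phi> x * h $ i)) (at x)"
proof -
  have d: "(\<phi> has_derivative frechet_derivative \<phi> (at x)) (at x)"
    using assms by (simp add: frechet_derivative_works)
  then have lin: "linear (frechet_derivative \<phi> (at x))" by (rule has_derivative_linear)
  have "frechet_derivative \<phi> (at x) h = (\<Sum>i\<in>UNIV. partial_deriv i \<phi> x * h $ i)" for h
  proof -
    have "h = (\<Sum>i\<in>UNIV. h $ i *\<^sub>R axis i 1)"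
      by (simp add: vec_eq_iff axis_def if_distrib cong: if_cong)
    then have "frechet_derivative \<phi> (at x) h = (\<Sum>i\<in>UNIV. frechet_derivative \<phi> (at x) (h $ i *\<^sub>R axis i 1))"
      using lin by (metis (no_types, lifting) linear_sum sum.cong)
    also have "\<dots> = (\<Sum>i\<in>UNIV. partial_deriv i \<phi> x * h $ i)"
      using lin by (simp add: linear_cmul partial_deriv_def mult.commute)
    finally show ?thesis .
  qed
  then have "frechet_derivative \<phi> (at x) = (\<lambda>h. \<Sum>i\<in>UNIV. partial_deriv i \<phi> x * h $ i)" by (rule ext)
  then show ?thesis using d by simp
qed

lemma DERIV_line:
  fixes \<phi> :: "real ^ 'n \<Rightarrow> real"
  assumes "\<phi> differentiable (at (x + r *\<^sub>R h))"
  shows "((\<lambda>r. \<phi> (x + r *\<^sub>R h)) has_real_derivative (\<Sum>i\<in>UNIV. partial_deriv i \<phi> (x + r *\<^sub>R h) * h $ i)) (at r)"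
proof -
  have "((\<lambda>r. x + r *\<^sub>R h) has_derivative (\<lambda>r. r *\<^sub>R h)) (at r)"
    by (auto intro!: derivative_eq_intros)
  then have "((\<lambda>r. \<phi> (x + r *\<^sub>R h)) has_derivative
      (\<lambda>s. \<Sum>i\<in>UNIV. partial_deriv i \<phi> (x + r *\<^sub>R h) * (s *\<^sub>R h) $ i)) (at r)"
    by (rule has_derivative_compose[where f="\<lambda>r. x + r *\<^sub>R h" and g=\<phi>, OF _ has_derivative_partial[OF assms]])
  then show ?thesis
    by (rule has_derivative_imp_has_field_derivative) (simp add: sum_distrib_left sum_distrib_right mult_ac)
qed

lemma DERIV_axis:
  fixes \<phi> :: "real ^ 'n \<Rightarrow> real"
  assumes "\<phi> differentiable (at (x + r *\<^sub>R axis k 1))"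
  shows "((\<lambda>r. \<phi> (x + r *\<^sub>R axis k 1)) has_real_derivative partial_deriv k \<phi> (x + r *\<^sub>R axis k 1)) (at r)"
  using DERIV_line[OF assms] by (simp add: axis_def if_distrib cong: if_cong)

lemma Ck_const: "Ck k (\<lambda>_. c)"
proof (induction k arbitrary: c)
  case (Suc k)
  have "partial_deriv i (\<lambda>_. c) = (\<lambda>_. 0)" for i :: 'a
    by (rule ext) (simp add: partial_deriv_eqI[OF has_derivative_const])
  then show ?case using Suc by simp
qed simp

lemma partial_deriv_add:
  assumes "f differentiable (at x)" "g differentiable (at x)"
  shows "partial_deriv i (\<lambda>x. f x + g x) x = partial_deriv i f x + partial_deriv i g x"
  using assms by (intro partial_deriv_eqI[THEN trans, OF has_derivative_add])
    (auto simp: partial_deriv_def frechet_derivative_works)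

lemma partial_deriv_mult:
  assumes "f differentiable (at x)" "g differentiable (at x)"
  shows "partial_deriv i (\<lambda>x. f x * g x) x = f x * partial_deriv i g x + partial_deriv i f x * g x"
  using assms by (intro partial_deriv_eqI[THEN trans, OF has_derivative_mult])
    (auto simp: partial_deriv_def frechet_derivative_works)

lemma Ck_add: "Ck k f \<Longrightarrow> Ck k g \<Longrightarrow> Ck k (\<lambda>x. f x + g x)"
proof (induction k arbitrary: f g)
  case 0
  then show ?case by (auto intro: continuous_on_add)
next
  case (Suc k)
  then have "partial_deriv i (\<lambda>x. f x + g x) = (\<lambda>x. partial_deriv i f x + partial_deriv i g x)" for i
    by (intro ext partial_deriv_add) auto
  then show ?case using Suc by (auto intro: differentiable_add)
qed

lemma Ck_mult: "Ck k f \<Longrightarrow> Ck k g \<Longrightarrow> Ck k (\<lambda>x. f x * g x)"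
proof (induction k arbitrary: f g)
  case 0
  then show ?case by (auto intro: continuous_on_mult)
next
  case (Suc k)
  have eq: "partial_deriv i (\<lambda>x. f x * g x) = (\<lambda>x. f x * partial_deriv i g x + partial_deriv i f x * g x)" for i
    using Suc.prems by (intro ext partial_deriv_mult) auto
  have "Ck k (\<lambda>x. f x * partial_deriv i g x + partial_deriv i f x * g x)" for i
    using Suc.prems Suc.prems[THEN Ck_Suc] by (intro Ck_add Suc.IH) auto
  then show ?case unfolding Ck.simps eq using Suc.prems by (auto intro: differentiable_mult)
qed

lemma smooth_const: "smooth (\<lambda>_. c)" by (simp add: smooth_def Ck_const)
lemma smooth_mult: "smooth f \<Longrightarrow> smooth g \<Longrightarrow> smooth (\<lambda>x. f x * g x)" by (simp add: smooth_def Ck_mult)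

lemma smooth_prod: "finite I \<Longrightarrow> (\<And>i. i \<in> I \<Longrightarrow> smooth (f i)) \<Longrightarrow> smooth (\<lambda>x. \<Prod>i\<in>I. f i x)"
  by (induction I rule: finite_induct) (auto intro: smooth_const smooth_mult)

lemma Ck_coordinate: "D1 (Suc k) h \<Longrightarrow> Ck k (\<lambda>x::real^'n. h (a * x $ i + b))"
proof (induction k arbitrary: h)
  case 0
  then have "continuous_on UNIV h" by (force intro: continuous_at_imp_continuous_on DERIV_isCont)
  then show ?case by (auto intro!: continuous_intros continuous_on_compose2[of UNIV h])
next
  case (Suc k)
  then obtain h' where h': "\<And>x. (h has_real_derivative h' x) (at x)" "D1 (Suc k) h'" by auto
  have d: "((\<lambda>x::real^'n. h (a * x $ i + b)) has_derivative (\<lambda>v. h' (a * x $ i + b) * (a * v $ i))) (at x)" for x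
  proof -
    have "((\<lambda>x::real^'n. a * x $ i + b) has_derivative (\<lambda>v. a * v $ i)) (at x)"
      by (auto intro!: derivative_eq_intros bounded_linear.has_derivative[OF bounded_linear_vec_nth])
    from has_derivative_compose[OF this, of h "(*) (h' (a * x $ i + b))"] h'(1)
    show ?thesis by (simp add: has_field_derivative_def)
  qed
  have eq: "partial_deriv j (\<lambda>x::real^'n. h (a * x $ i + b)) = (\<lambda>x. h' (a * x $ i + b) * (if i = j then a else 0))" for j
    by (rule ext, subst partial_deriv_eqI[OF d]) (simp add: axis_def)
  show ?case unfolding Ck.simps eq using d Suc.IH[OF h'(2)]
    by (auto simp: differentiable_def intro!: Ck_mult Ck_const)
qed

lemma smooth_coordinate: "(\<And>k. D1 k h) \<Longrightarrow> smooth (\<lambda>x::real^'n. h (a * x $ i + b))"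
  by (simp add: smooth_def Ck_coordinate)

lemma partial_deriv_extremum_0:
  fixes f :: "real ^ 'n \<Rightarrow> real"
  assumes "f differentiable (at x)" "(\<forall>y. f y \<le> f x) \<or> (\<forall>y. f x \<le> f y)"
  shows "partial_deriv i f x = 0"
proof -
  have d: "(f has_derivative frechet_derivative f (at x)) (at x)"
    using assms by (simp add: frechet_derivative_works)
  have "frechet_derivative f (at x) = (\<lambda>v. 0)"
    by (rule differential_zero_maxmin[of x UNIV f]) (use assms d in auto)
  then show ?thesis by (simp add: partial_deriv_def)
qed

proposition cutoff_exists:
  obtains L :: real where "L > 0"
    "\<And>(x0 :: real ^ 'n) s t. s < t \<Longrightarrow> \<exists>\<eta>. smooth \<eta> \<and> (\<forall>x. 0 \<le> \<eta> x \<and> \<eta> x \<le> 1) \<and>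
       (\<forall>x\<in>cube x0 s. \<eta> x = 1) \<and> (\<forall>x. x \<notin> cube x0 t \<longrightarrow> \<eta> x = 0) \<and>
       (\<forall>x i. \<bar>partial_deriv i \<eta> x\<bar> \<le> L / (t - s))"
proof -
  obtain H L where H: "\<And>k. D1 k H" "\<And>y. 0 \<le> H y \<and> H y \<le> 1" "\<And>y. y \<le> 0 \<Longrightarrow> H y = 0" "\<And>y. y \<ge> 1 \<Longrightarrow> H y = 1"
    "\<And>y D. (H has_real_derivative D) (at y) \<Longrightarrow> \<bar>D\<bar> \<le> L" "L > 0"
    using smooth_step_exists by metis
  obtain H' where H': "\<And>y. (H has_real_derivative H' y) (at y)" using H(1)[of 1] by auto
  show ?thesis
  proof (rule that[of "2 * L"])
    show "2 * L > 0" using H by simp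
  next
    fix x0 :: "real ^ 'n" and s t :: real
    assume st: "s < t"
    define a where "a = 1 / (t - s)"
    have a: "a > 0" using st by (simp add: a_def)
    define c d where "c i = a * (t + x0 $ i)" and "d i = a * (t - x0 $ i)" for i
    define h where "h i y = H (- a * y + c i) * H (a * y + d i)" for i y
    define \<eta> where "\<eta> x = (\<Prod>i\<in>UNIV. h i (x $ i))" for x :: "real ^ 'n"
    have h01: "0 \<le> h i y \<and> h i y \<le> 1" for i y
      using H(2) by (auto simp: h_def intro: mult_le_one)
    have sm: "smooth \<eta>" unfolding \<eta>_def[abs_def] h_def
      by (intro smooth_prod smooth_mult smooth_coordinate H) auto
    have rng: "0 \<le> \<eta> x \<and> \<eta> x \<le> 1" for x
      using h01 by (auto simp: \<eta>_def intro!: prod_nonneg prod_le_1)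
    have arg: "- a * y + c i = (t - (y - x0 $ i)) / (t - s)" "a * y + d i = (t + (y - x0 $ i)) / (t - s)" for y i
      by (simp_all add: a_def c_def d_def add_divide_distrib diff_divide_distrib algebra_simps)
    have one: "\<eta> x = 1" if "x \<in> cube x0 s" for x
    proof -
      have "h i (x $ i) = 1" for i
      proof -
        have "\<bar>x $ i - x0 $ i\<bar> \<le> s" using that by (simp add: cube_def)
        then have "1 \<le> (t - (x $ i - x0 $ i)) / (t - s)" "1 \<le> (t + (x $ i - x0 $ i)) / (t - s)"
          using st by (auto simp: field_simps)
        then show ?thesis unfolding h_def arg by (simp add: H(4))
      qed
      then show ?thesis by (simp add: \<eta>_def)
    qed
    have zero: "\<eta> x = 0" if "x \<notin> cube x0 t" for x
    proof -
      from that obtain i where "\<bar>x $ i - x0 $ i\<bar> > t" by (auto simp: cube_def not_le)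
      then have "(t - (x $ i - x0 $ i)) / (t - s) \<le> 0 \<or> (t + (x $ i - x0 $ i)) / (t - s) \<le> 0"
        using st by (auto simp: divide_le_0_iff)
      then have "h i (x $ i) = 0" unfolding h_def arg using H(3) by auto
      then show ?thesis by (auto simp: \<eta>_def)
    qed
    have bd: "\<bar>partial_deriv k \<eta> x\<bar> \<le> 2 * L / (t - s)" for x k
    proof -
      define P where "P = (\<Prod>i\<in>UNIV - {k}. h i (x $ i))"
      have P: "0 \<le> P \<and> P \<le> 1" using h01 by (auto simp: P_def intro!: prod_nonneg prod_le_1)
      have line: "\<eta> (x + r *\<^sub>R axis k 1) = h k (x $ k + r) * P" for r
      proof -
        have "\<eta> (x + r *\<^sub>R axis k 1) = h k (x $ k + r) * (\<Prod>i\<in>UNIV - {k}. h i ((x + r *\<^sub>R axis k 1) $ i))"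
          unfolding \<eta>_def by (subst prod.remove[of _ k]) (auto simp: axis_def)
        also have "(\<Prod>i\<in>UNIV - {k}. h i ((x + r *\<^sub>R axis k 1) $ i)) = P"
          unfolding P_def by (intro prod.cong) (auto simp: axis_def)
        finally show ?thesis .
      qed
      let ?u = "- a * (x $ k + 0) + c k" and ?v = "a * (x $ k + 0) + d k"
      have d1: "((\<lambda>r. H (- a * (x $ k + r) + c k)) has_real_derivative H' ?u * (- a)) (at 0)"
        by (rule DERIV_chain2[OF H']) (auto intro!: derivative_eq_intros)
      have d2: "((\<lambda>r. H (a * (x $ k + r) + d k)) has_real_derivative H' ?v * a) (at 0)"
        by (rule DERIV_chain2[OF H']) (auto intro!: derivative_eq_intros)
      have "((\<lambda>r. h k (x $ k + r) * P) has_real_derivative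
          (H' ?u * (- a) * H ?v + H' ?v * a * H ?u) * P) (at 0)"
        unfolding h_def by (intro DERIV_cmult_right DERIV_mult d1 d2)
      moreover have "((\<lambda>r. \<eta> (x + r *\<^sub>R axis k 1)) has_real_derivative partial_deriv k \<eta> x) (at 0)"
        using DERIV_axis[OF smooth_differentiable[OF sm], where x=x and r=0 and k=k] by simp
      ultimately have "partial_deriv k \<eta> x = (H' ?u * (- a) * H ?v + H' ?v * a * H ?u) * P"
        unfolding line using DERIV_unique by blast
      also have "\<bar>\<dots>\<bar> = \<bar>H' ?u * (- a) * H ?v + H' ?v * a * H ?u\<bar> * P" using P by (simp add: abs_mult)
      also have "\<dots> \<le> \<bar>H' ?u * (- a) * H ?v + H' ?v * a * H ?u\<bar> * 1"
        using P by (intro mult_left_mono) auto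
      also have "\<dots> \<le> \<bar>H' ?u * (- a) * H ?v\<bar> + \<bar>H' ?v * a * H ?u\<bar>" by simp
      also have "\<dots> = \<bar>H' ?u\<bar> * a * \<bar>H ?v\<bar> + \<bar>H' ?v\<bar> * a * \<bar>H ?u\<bar>" using a by (simp add: abs_mult)
      also have "\<dots> \<le> L * a * 1 + L * a * 1"
        using H(2) H(5)[OF H'] a H(6) by (intro add_mono mult_mono) (auto simp: abs_le_iff)
      finally show ?thesis by (simp add: a_def)
    qed
    show "\<exists>\<eta>. smooth \<eta> \<and> (\<forall>x. 0 \<le> \<eta> x \<and> \<eta> x \<le> 1) \<and>
       (\<forall>x\<in>cube x0 s. \<eta> x = 1) \<and> (\<forall>x. x \<notin> cube x0 t \<longrightarrow> \<eta> x = 0) \<and>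
       (\<forall>x i. \<bar>partial_deriv i \<eta> x\<bar> \<le> 2 * L / (t - s))"
      using sm rng one zero bd by blast
  qed
qed

subsection \<open>Cubes and test functions\<close>

lemma cube_eq_cbox: "cube x R = cbox (x - (\<chi> i. R)) (x + (\<chi> i. R))"
proof (rule set_eqI)
  fix y
  have "\<bar>y $ i - x $ i\<bar> \<le> R \<longleftrightarrow> x $ i - R \<le> y $ i \<and> y $ i \<le> x $ i + R" for i by auto
  then show "y \<in> cube x R \<longleftrightarrow> y \<in> cbox (x - (\<chi> i. R)) (x + (\<chi> i. R))"
    by (simp add: cube_def mem_box_cart)
qed

lemma compact_cube [simp]: "compact (cube x R)" and closed_cube [simp]: "closed (cube x R)"
  and cube_lebesgue [simp]: "cube x R \<in> sets lebesgue"
  and cube_borel [measurable, simp]: "cube x R \<in> sets borel"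
  by (simp_all add: cube_eq_cbox compact_imp_closed)

lemma cube_mono: "r \<le> s \<Longrightarrow> cube x r \<subseteq> cube x s"
  by (auto simp: cube_def intro: order_trans)

lemma cube_subset_ball: "cube (x :: real ^ 'n) r \<subseteq> cball x (real CARD('n) * r)"
proof
  fix y assume "y \<in> cube x r"
  then have "\<bar>(x - y) $ i\<bar> \<le> r" for i by (simp add: cube_def abs_minus_commute)
  then have "(\<Sum>i\<in>UNIV. \<bar>(x - y) $ i\<bar>) \<le> (\<Sum>i\<in>(UNIV::'n set). r)" by (intro sum_mono)
  then show "y \<in> cball x (real CARD('n) * r)" using norm_le_l1_cart[of "x - y"] by (simp add: dist_norm)
qed

lemma cube_in_open:
  fixes x :: "real ^ 'n"
  assumes "open U" "x \<in> U"
  obtains r where "r > 0" "cube x r \<subseteq> U"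
proof -
  obtain e where e: "e > 0" "cball x e \<subseteq> U" using assms open_contains_cball by blast
  show ?thesis
  proof (rule that[of "e / CARD('n)"])
    show "cube x (e / CARD('n)) \<subseteq> U" using cube_subset_ball[of x "e / CARD('n)"] e by auto
  qed (use e in auto)
qed

lemma measure_cube: "R \<ge> 0 \<Longrightarrow> measure lebesgue (cube (x :: real ^ 'n) R) = (2 * R) ^ CARD('n)"
proof -
  assume "R \<ge> 0"
  then have "cube x R \<noteq> {}" by (auto simp: cube_def intro!: exI[of _ x])
  then show ?thesis unfolding cube_eq_cbox by (simp add: content_cbox_cart)
qed

lemma emeasure_cube: "emeasure lebesgue (cube x R) = ennreal (measure lebesgue (cube x R))"
  by (simp add: cube_eq_cbox emeasure_eq_ennreal_measure emeasure_lborel_cbox_eq)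

lemma test_functions_iff:
  "\<phi> \<in> test_functions U \<longleftrightarrow> smooth \<phi> \<and> compact (supp UNIV \<phi>) \<and> supp UNIV \<phi> \<subseteq> U"
  by (simp add: test_functions_def smooth_def)

lemma supp_zero: "x \<notin> supp UNIV \<phi> \<Longrightarrow> \<phi> x = 0"
  using closure_subset[of "{x. \<phi> x \<noteq> 0}"] by (auto simp: supp_def)

lemma test_smooth: "\<phi> \<in> test_functions U \<Longrightarrow> smooth \<phi>"
  by (simp add: test_functions_iff)

lemma test_zero: "\<phi> \<in> test_functions U \<Longrightarrow> x \<notin> U \<Longrightarrow> \<phi> x = 0"
  by (auto simp: test_functions_iff intro: supp_zero)

lemma supp_subset_closed: "closed K \<Longrightarrow> (\<And>x. x \<notin> K \<Longrightarrow> \<phi> x = 0) \<Longrightarrow> supp UNIV \<phi> \<subseteq> K"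
  unfolding supp_def by (rule closure_minimal) auto

lemma test_functionI:
  assumes "smooth \<phi>" "compact K" "K \<subseteq> U" "\<And>x. x \<notin> K \<Longrightarrow> \<phi> x = 0"
  shows "\<phi> \<in> test_functions U"
proof -
  have s: "supp UNIV \<phi> \<subseteq> K" using assms by (intro supp_subset_closed) (auto intro: compact_imp_closed)
  have "compact (K \<inter> supp UNIV \<phi>)" using assms by (intro compact_Int_closed) (auto simp: supp_def)
  then show ?thesis using s assms by (auto simp: test_functions_iff Int_absorb1)
qed

lemma test_mono: "\<phi> \<in> test_functions U \<Longrightarrow> U \<subseteq> V \<Longrightarrow> \<phi> \<in> test_functions V"
  by (auto simp: test_functions_iff)

lemma test_mult: "\<eta> \<in> test_functions U \<Longrightarrow> smooth \<psi> \<Longrightarrow> (\<lambda>x. \<eta> x * \<psi> x) \<in> test_functions U"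
  by (rule test_functionI[of _ "supp UNIV \<eta>"]) (simp_all add: test_functions_iff supp_zero smooth_mult)

lemma partial_deriv_zero_off_supp:
  assumes "x \<notin> supp UNIV \<phi>"
  shows "partial_deriv i \<phi> x = 0"
proof -
  have "((\<lambda>_. 0) has_derivative (\<lambda>_. 0)) (at x)" by simp
  then have "(\<phi> has_derivative (\<lambda>_. 0)) (at x)"
  proof (rule has_derivative_transform_within_open)
    show "open (- supp UNIV \<phi>)" unfolding supp_def by (simp add: open_Compl)
    show "x \<in> - supp UNIV \<phi>" using assms by simp
    show "0 = \<phi> y" if "y \<in> - supp UNIV \<phi>" for y using that supp_zero[of y \<phi>] by simp
  qed
  then show ?thesis by (rule partial_deriv_eqI)
qed

lemma test_partial: "\<phi> \<in> test_functions U \<Longrightarrow> partial_deriv i \<phi> \<in> test_functions U"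
  by (rule test_functionI[of _ "supp UNIV \<phi>"])
    (simp_all add: test_functions_iff partial_deriv_zero_off_supp smooth_partial)

lemma test_bounded:
  assumes "\<phi> \<in> test_functions U"
  obtains B where "B > 0" "\<And>x. \<bar>\<phi> x\<bar> \<le> B"
proof -
  let ?K = "supp UNIV \<phi>"
  have "compact (\<phi> ` ?K)"
    using assms by (intro compact_continuous_image) (auto simp: test_functions_iff intro: smooth_continuous)
  then obtain B where B: "B > 0" "\<And>x. x \<in> ?K \<Longrightarrow> \<bar>\<phi> x\<bar> \<le> B"
    using compact_imp_bounded bounded_pos by (metis image_eqI real_norm_def)
  show ?thesis
    by (rule that[of B]) (use B supp_zero[of _ \<phi>] in \<open>force+\<close>)
qed

lemma test_measurable: "\<phi> \<in> test_functions U \<Longrightarrow> \<phi> \<in> borel_measurable borel"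
  by (intro borel_measurable_continuous_onI) (auto simp: test_functions_iff intro: smooth_continuous)

lemma smooth_measurable: "smooth \<phi> \<Longrightarrow> \<phi> \<in> borel_measurable borel"
  by (intro borel_measurable_continuous_onI) (auto intro: smooth_continuous)

lemma smooth_lebesgue: "smooth \<phi> \<Longrightarrow> \<phi> \<in> borel_measurable lebesgue"
  by (rule measurable_completion) (simp add: smooth_measurable)

lemma test_integrable_lborel: "\<phi> \<in> test_functions U \<Longrightarrow> integrable lborel \<phi>"
proof -
  assume \<phi>: "\<phi> \<in> test_functions U"
  have "integrable lborel (\<lambda>x. indicator (supp UNIV \<phi>) x *\<^sub>R \<phi> x)"
    using \<phi> by (intro borel_integrable_compact) (auto simp: test_functions_iff intro: smooth_continuous)
  moreover have "(\<lambda>x. indicator (supp UNIV \<phi>) x *\<^sub>R \<phi> x) = \<phi>"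
    by (auto simp: fun_eq_iff indicator_def supp_zero)
  ultimately show ?thesis by simp
qed

lemma test_diff_bound:
  assumes \<phi>: "\<phi> \<in> test_functions U"
  obtains B where "B > 0" "\<And>x h. \<bar>\<phi> (x + h) - \<phi> x\<bar> \<le> B * norm h"
proof -
  have "\<exists>B>0. \<forall>x. \<bar>partial_deriv i \<phi> x\<bar> \<le> B" for i
    using test_bounded[OF test_partial[OF \<phi>, of i]] by metis
  then obtain B where B: "\<And>i. B i > 0" "\<And>i x. \<bar>partial_deriv i \<phi> x\<bar> \<le> B i" by metis
  show ?thesis
  proof (rule that)
    show "(\<Sum>i\<in>UNIV. B i) > 0" using B by (intro sum_pos) auto
  next
    fix x h
    have "\<exists>z. 0 < z \<and> z < 1 \<and> \<phi> (x + 1 *\<^sub>R h) - \<phi> (x + 0 *\<^sub>R h) =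
       (1 - 0) * (\<Sum>i\<in>UNIV. partial_deriv i \<phi> (x + z *\<^sub>R h) * h $ i)"
      using DERIV_line[OF smooth_differentiable[OF test_smooth[OF \<phi>]]]
      by (intro MVT2[where f="\<lambda>r. \<phi> (x + r *\<^sub>R h)"]) auto
    then obtain z where z: "\<phi> (x + h) - \<phi> x = (\<Sum>i\<in>UNIV. partial_deriv i \<phi> (x + z *\<^sub>R h) * h $ i)"
      by auto
    have "\<bar>\<phi> (x + h) - \<phi> x\<bar> \<le> (\<Sum>i\<in>UNIV. \<bar>partial_deriv i \<phi> (x + z *\<^sub>R h)\<bar> * \<bar>h $ i\<bar>)"
      unfolding z by (rule order_trans[OF sum_abs]) (simp add: abs_mult)
    also have "\<dots> \<le> (\<Sum>i\<in>UNIV. B i * norm h)"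
      using B by (intro sum_mono mult_mono component_le_norm_cart) (auto simp: less_imp_le)
    finally show "\<bar>\<phi> (x + h) - \<phi> x\<bar> \<le> (\<Sum>i\<in>UNIV. B i) * norm h" by (simp add: sum_distrib_right)
  qed
qed

lemma lborel_integral_shift:
  fixes f :: "real ^ 'n \<Rightarrow> real"
  assumes [measurable]: "f \<in> borel_measurable borel"
  shows "(LINT x|lborel. f (x + c)) = (LINT x|lborel. f x)"
proof -
  have "(LINT x|lborel. f x) = (LINT x|distr lborel borel ((+) c). f x)" by (simp only: lborel_distr_plus)
  also have "\<dots> = (LINT x|lborel. f (c + x))" by (intro integral_distr) auto
  finally show ?thesis by (simp add: add.commute)
qed

lemma lborel_integrable_shift:
  fixes f :: "real ^ 'n \<Rightarrow> real"
  assumes "integrable lborel f"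
  shows "integrable lborel (\<lambda>x. f (x + c))"
proof -
  have [measurable]: "f \<in> borel_measurable borel" using assms by simp
  have "integrable (distr lborel borel ((+) c)) f" using assms by (simp only: lborel_distr_plus)
  then show ?thesis by (subst (asm) integrable_distr_eq) (auto simp: add.commute)
qed

lemma integral_partial_deriv_test:
  fixes \<phi> :: "real ^ 'n \<Rightarrow> real"
  assumes \<phi>: "\<phi> \<in> test_functions U"
  shows "(LINT x|lborel. partial_deriv i \<phi> x) = 0"
proof -
  let ?e = "axis i 1 :: real ^ 'n"
  obtain B where B: "B > 0" "\<And>x h. \<bar>\<phi> (x + h) - \<phi> x\<bar> \<le> B * norm h" using test_diff_bound[OF \<phi>] by blast
  have [measurable]: "\<phi> \<in> borel_measurable borel" "partial_deriv i \<phi> \<in> borel_measurable borel"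
    using \<phi> test_measurable test_partial by blast+
  define K where "K = (\<lambda>(x, y). x + y) ` (supp UNIV \<phi> \<times> cball 0 1)"
  have "compact (supp UNIV \<phi> \<times> cball (0::real^'n) 1)" using \<phi> by (auto simp: test_functions_iff intro: compact_Times)
  then have K: "compact K" unfolding K_def
    by (intro compact_continuous_image) (auto simp: case_prod_unfold intro!: continuous_intros)
  define d where "d k x = real (Suc k) * (\<phi> (x + (1 / real (Suc k)) *\<^sub>R ?e) - \<phi> x)" for k x
  have Kd: "x \<in> K" if "d k x \<noteq> 0" for k x
  proof -
    from that have "\<phi> (x + (1 / real (Suc k)) *\<^sub>R ?e) \<noteq> 0 \<or> \<phi> x \<noteq> 0" by (auto simp: d_def)
    then have "x + (1 / real (Suc k)) *\<^sub>R ?e \<in> supp UNIV \<phi> \<or> x \<in> supp UNIV \<phi>" using supp_zero by blast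
    then show ?thesis
    proof
      assume "x + (1 / real (Suc k)) *\<^sub>R ?e \<in> supp UNIV \<phi>"
      then show ?thesis unfolding K_def
        by (intro image_eqI[of _ _ "(x + (1 / real (Suc k)) *\<^sub>R ?e, - (1 / real (Suc k)) *\<^sub>R ?e)"]) auto
    next
      assume "x \<in> supp UNIV \<phi>"
      then show ?thesis unfolding K_def by (intro image_eqI[of _ _ "(x, 0)"]) auto
    qed
  qed
  have "(\<lambda>k. LINT x|lborel. d k x) \<longlonglongrightarrow> (LINT x|lborel. partial_deriv i \<phi> x)"
  proof (rule integral_dominated_convergence[where w="\<lambda>x. B * indicator K x"])
    show "integrable lborel (\<lambda>x. B * indicator K x)"
      using K by (intro integrable_mult_right integrable_real_indicator
          emeasure_bounded_finite compact_imp_bounded) (auto simp: compact_imp_closed)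
    show "AE x in lborel. (\<lambda>k. d k x) \<longlonglongrightarrow> partial_deriv i \<phi> x"
    proof (rule AE_I2)
      fix x
      have "((\<lambda>r. \<phi> (x + r *\<^sub>R ?e)) has_real_derivative partial_deriv i \<phi> x) (at 0)"
        using DERIV_axis[OF smooth_differentiable[OF test_smooth[OF \<phi>]], where x=x and r=0 and k=i] by simp
      then have "((\<lambda>h. (\<phi> (x + h *\<^sub>R ?e) - \<phi> x) / h) \<longlongrightarrow> partial_deriv i \<phi> x) (at 0)"
        by (simp add: DERIV_def)
      moreover have "(\<lambda>k. 1 / real (Suc k)) \<longlonglongrightarrow> 0" by (rule LIMSEQ_Suc[OF lim_1_over_n])
      then have "filterlim (\<lambda>k. 1 / real (Suc k)) (at 0) sequentially"
        by (simp add: filterlim_at del: of_nat_Suc)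
      ultimately have "(\<lambda>k. (\<phi> (x + (1 / real (Suc k)) *\<^sub>R ?e) - \<phi> x) / (1 / real (Suc k))) \<longlonglongrightarrow> partial_deriv i \<phi> x"
        by (rule filterlim_compose)
      then show "(\<lambda>k. d k x) \<longlonglongrightarrow> partial_deriv i \<phi> x" by (simp add: d_def mult.commute)
    qed
    show "AE x in lborel. norm (d k x) \<le> B * indicator K x" for k
    proof (rule AE_I2)
      fix x
      have "\<bar>d k x\<bar> \<le> real (Suc k) * (B * (1 / real (Suc k)))"
        using B(2)[of x "(1 / real (Suc k)) *\<^sub>R ?e"] unfolding d_def abs_mult
        by (intro mult_mono) (auto simp del: of_nat_Suc)
      then have "\<bar>d k x\<bar> \<le> B" by (simp del: of_nat_Suc)
      then show "norm (d k x) \<le> B * indicator K x" using Kd[of k x] B(1) by (cases "d k x = 0") auto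
    qed
  qed (auto simp: d_def)
  moreover have "(LINT x|lborel. d k x) = 0" for k
    unfolding d_def using test_integrable_lborel[OF \<phi>]
    by (subst integral_mult_right_zero, subst Bochner_Integration.integral_diff)
      (auto intro: lborel_integrable_shift simp: lborel_integral_shift)
  ultimately show ?thesis by (simp add: LIMSEQ_const_iff)
qed

subsection \<open>Weak gradients\<close>

lemma integrable_lebesgue_AE:
  fixes f g :: "real ^ 'n \<Rightarrow> 'b::euclidean_space"
  assumes "integrable lebesgue f" "AE x in lebesgue. f x = g x"
  shows "integrable lebesgue g" "(LINT x|lebesgue. f x) = (LINT x|lebesgue. g x)"
proof -
  have "g \<in> borel_measurable lebesgue"
    by (rule borel_measurable_AE[OF borel_measurable_integrable[OF assms(1)] assms(2)])
  then show "integrable lebesgue g" "(LINT x|lebesgue. f x) = (LINT x|lebesgue. g x)"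
    using assms integrable_cong_AE[of f lebesgue g] integral_cong_AE[of f lebesgue g] by simp_all
qed

lemma locally_integrable_iff:
  "locally_integrable U g \<longleftrightarrow> (\<forall>K. compact K \<and> K \<subseteq> U \<longrightarrow> integrable lebesgue (\<lambda>x. indicator K x *\<^sub>R g x))"
proof -
  have "integrable (lebesgue_on K) g \<longleftrightarrow> integrable lebesgue (\<lambda>x. indicator K x *\<^sub>R g x)" if "compact K" for K
    using that by (intro integrable_restrict_space) (use fmeasurableD[OF lmeasurable_compact[OF that]] in simp)
  then show ?thesis unfolding locally_integrable_def by blast
qed

lemma locally_integrableD:
  "locally_integrable U g \<Longrightarrow> compact K \<Longrightarrow> K \<subseteq> U \<Longrightarrow> integrable lebesgue (\<lambda>x. indicator K x *\<^sub>R g x)"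
  by (simp add: locally_integrable_iff)

lemma locally_integrable_test:
  fixes g :: "real ^ 'n \<Rightarrow> real"
  assumes g: "locally_integrable U g" and \<phi>: "\<phi> \<in> test_functions U"
  shows "integrable lebesgue (\<lambda>x. g x * \<phi> x)"
proof -
  let ?K = "supp UNIV \<phi>"
  obtain B where B: "B > 0" "\<And>x. \<bar>\<phi> x\<bar> \<le> B" using test_bounded[OF \<phi>] by blast
  have int: "integrable lebesgue (\<lambda>x. indicator ?K x *\<^sub>R g x)"
    using \<phi> by (intro locally_integrableD[OF g]) (auto simp: test_functions_iff)
  have eq: "(\<lambda>x. g x * \<phi> x) = (\<lambda>x. (indicator ?K x *\<^sub>R g x) * \<phi> x)"
    by (auto simp: fun_eq_iff indicator_def supp_zero)
  show ?thesis unfolding eq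
  proof (rule Bochner_Integration.integrable_bound[where f="\<lambda>x. B * (indicator ?K x *\<^sub>R g x)"])
    show "integrable lebesgue (\<lambda>x. B * (indicator ?K x *\<^sub>R g x))" using int by simp
    show "(\<lambda>x. (indicator ?K x *\<^sub>R g x) * \<phi> x) \<in> borel_measurable lebesgue"
      using int smooth_lebesgue[OF test_smooth[OF \<phi>]] by (intro borel_measurable_times) auto
    show "AE x in lebesgue. norm (indicator ?K x *\<^sub>R g x * \<phi> x) \<le> norm (B * (indicator ?K x *\<^sub>R g x))"
    proof (rule AE_I2)
      fix x
      have "\<bar>indicator ?K x *\<^sub>R g x\<bar> * \<bar>\<phi> x\<bar> \<le> \<bar>indicator ?K x *\<^sub>R g x\<bar> * B"
        using B by (intro mult_left_mono) auto
      then show "norm (indicator ?K x *\<^sub>R g x * \<phi> x) \<le> norm (B * (indicator ?K x *\<^sub>R g x))"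
        using B(1) by (simp add: abs_mult mult_ac)
    qed
  qed
qed

lemma integral_test_lebesgue_on:
  assumes "U \<in> sets lebesgue" "\<phi> \<in> test_functions U"
  shows "(LINT x|lebesgue_on U. g x * \<phi> x) = (LINT x|lebesgue. g x * \<phi> x)"
  using assms test_zero[OF assms(2)]
  by (subst integral_restrict_space) (auto intro!: Bochner_Integration.integral_cong simp: indicator_def)

lemma is_weak_gradient_iff:
  assumes "open U"
  shows "is_weak_gradient U u g \<longleftrightarrow> locally_integrable U u \<and> locally_integrable U g \<and>
     (\<forall>\<phi>\<in>test_functions U. \<forall>i.
        (LINT x|lebesgue. u x * partial_deriv i \<phi> x) = - (LINT x|lebesgue. g x $ i * \<phi> x))"
  using assms unfolding is_weak_gradient_def
  by (intro conj_cong refl ball_cong all_cong1) (simp add: integral_test_lebesgue_on test_partial)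

lemma locally_integrable_component:
  "locally_integrable U g \<Longrightarrow> locally_integrable U (\<lambda>x. g x $ i)"
  unfolding locally_integrable_def using integrable_bounded_linear[OF bounded_linear_vec_nth] by blast

lemma locally_integrable_vec:
  assumes "\<And>i. locally_integrable U (\<lambda>x. g x $ i)"
  shows "locally_integrable U (g :: real ^ 'n \<Rightarrow> real ^ 'n)"
proof -
  have "integrable (lebesgue_on K) g" if "compact K \<and> K \<subseteq> U" for K
  proof -
    have "integrable (lebesgue_on K) (\<lambda>x. \<Sum>i\<in>UNIV. g x $ i *\<^sub>R axis i 1)"
      using assms that by (intro Bochner_Integration.integrable_sum integrable_scaleR_left) (auto simp: locally_integrable_def)
    also have "(\<lambda>x. \<Sum>i\<in>UNIV. g x $ i *\<^sub>R axis i 1) = g"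
      by (rule ext) (simp add: vec_eq_iff axis_def if_distrib cong: if_cong)
    finally show ?thesis .
  qed
  then show ?thesis by (simp add: locally_integrable_def)
qed

lemma locally_integrable_subset: "locally_integrable U g \<Longrightarrow> W \<subseteq> U \<Longrightarrow> locally_integrable W g"
  unfolding locally_integrable_def by blast

lemma locally_integrable_AE:
  fixes g h :: "real ^ 'n \<Rightarrow> 'b::euclidean_space"
  assumes g: "locally_integrable U g" and ae: "AE x in lebesgue. x \<in> U \<longrightarrow> g x = h x"
  shows "locally_integrable U h"
  unfolding locally_integrable_iff
proof (intro allI impI)
  fix K assume K: "compact K \<and> K \<subseteq> U"
  then have "integrable lebesgue (\<lambda>x. indicator K x *\<^sub>R g x)" using locally_integrableD[OF g] by blast
  moreover have "AE x in lebesgue. indicator K x *\<^sub>R g x = indicator K x *\<^sub>R h x"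
    using ae by eventually_elim (use K in \<open>auto simp: indicator_def\<close>)
  ultimately show "integrable lebesgue (\<lambda>x. indicator K x *\<^sub>R h x)" by (rule integrable_lebesgue_AE)
qed

lemma cutoff_bare:
  fixes c :: "real ^ 'n"
  assumes "s < t"
  shows "\<exists>\<eta>. smooth \<eta> \<and> (\<forall>x. 0 \<le> \<eta> x \<and> \<eta> x \<le> 1) \<and>
       (\<forall>x\<in>cube c s. \<eta> x = 1) \<and> (\<forall>x. x \<notin> cube c t \<longrightarrow> \<eta> x = 0)"
proof -
  obtain L :: real where "L > 0" and L: "\<And>(x0 :: real ^ 'n) s t. s < t \<Longrightarrow>
      \<exists>\<eta>. smooth \<eta> \<and> (\<forall>x. 0 \<le> \<eta> x \<and> \<eta> x \<le> 1) \<and>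
       (\<forall>x\<in>cube x0 s. \<eta> x = 1) \<and> (\<forall>x. x \<notin> cube x0 t \<longrightarrow> \<eta> x = 0) \<and>
       (\<forall>x i. \<bar>partial_deriv i \<eta> x\<bar> \<le> L / (t - s))"
    by (rule cutoff_exists) (rule that)
  from L[OF assms, of c] show ?thesis by (elim exE conjE) (intro exI conjI)
qed

lemma integral_cube_zero:
  fixes g :: "real ^ 'n \<Rightarrow> real"
  assumes g: "locally_integrable U g" and zero: "\<And>\<phi>. \<phi> \<in> test_functions U \<Longrightarrow> (LINT x|lebesgue. g x * \<phi> x) = 0"
    and r: "r < s" "cube c s \<subseteq> U"
  shows "(LINT x|lebesgue. indicator (cube c r) x *\<^sub>R g x) = 0"
proof -
  define t where "t k = r + (s - r) / real (Suc k)" for k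
  have t: "r < t k" "t k \<le> s" for k
  proof -
    have "(s - r) / real (Suc k) > 0" using r by simp
    then show "r < t k" by (simp add: t_def)
    have "(s - r) / real (Suc k) \<le> (s - r) / 1" using r by (intro divide_left_mono) auto
    then show "t k \<le> s" by (simp add: t_def)
  qed
  have "\<exists>\<eta>. smooth \<eta> \<and> (\<forall>x. 0 \<le> \<eta> x \<and> \<eta> x \<le> 1) \<and>
       (\<forall>x\<in>cube c r. \<eta> x = 1) \<and> (\<forall>x. x \<notin> cube c (t k) \<longrightarrow> \<eta> x = 0)" for k
    by (rule cutoff_bare[OF t(1)])
  then obtain \<eta> where \<eta>: "\<And>k. smooth (\<eta> k)" "\<And>k x. 0 \<le> \<eta> k x \<and> \<eta> k x \<le> 1"
    "\<And>k x. x \<in> cube c r \<Longrightarrow> \<eta> k x = 1" "\<And>k x. x \<notin> cube c (t k) \<Longrightarrow> \<eta> k x = 0" by metis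
  have test: "\<eta> k \<in> test_functions U" for k
    by (rule test_functionI[OF \<eta>(1) compact_cube _ \<eta>(4)]) (use cube_mono[OF t(2)[of k]] r in auto)
  have lim: "(\<lambda>k. \<eta> k x) \<longlonglongrightarrow> indicator (cube c r) x" for x
  proof (cases "x \<in> cube c r")
    case True
    then show ?thesis by (simp add: \<eta>(3))
  next
    case False
    then obtain i where i: "\<bar>x $ i - c $ i\<bar> > r" by (auto simp: cube_def not_le)
    have "t \<longlonglongrightarrow> r + 0" unfolding t_def[abs_def]
      by (intro tendsto_intros) (rule LIMSEQ_Suc[OF lim_const_over_n])
    then have "\<forall>\<^sub>F k in sequentially. t k < \<bar>x $ i - c $ i\<bar>" using i order_tendstoD(2) by force
    then have "\<forall>\<^sub>F k in sequentially. 0 = \<eta> k x"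
      by eventually_elim (rule \<eta>(4)[symmetric], auto simp: cube_def not_le)
    then show ?thesis using False by (auto intro: Lim_transform_eventually[OF tendsto_const])
  qed
  have int: "integrable lebesgue (\<lambda>x. indicator (cube c s) x *\<^sub>R g x)"
    by (rule locally_integrableD[OF g compact_cube r(2)])
  have ind: "\<bar>\<eta> k x\<bar> \<le> indicator (cube c s) x" for k x
  proof (cases "x \<in> cube c s")
    case True
    then show ?thesis using \<eta>(2)[of k x] by simp
  next
    case False
    then have "x \<notin> cube c (t k)" using cube_mono[OF t(2)[of k], of c] by blast
    then show ?thesis using \<eta>(4) by simp
  qed
  have "(\<lambda>k. LINT x|lebesgue. g x * \<eta> k x) \<longlonglongrightarrow> (LINT x|lebesgue. indicator (cube c r) x *\<^sub>R g x)"
  proof (rule integral_dominated_convergence[where w="\<lambda>x. \<bar>indicator (cube c s) x *\<^sub>R g x\<bar>"])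
    show "integrable lebesgue (\<lambda>x. \<bar>indicator (cube c s) x *\<^sub>R g x\<bar>)" using int by simp
    have "integrable lebesgue (\<lambda>x. indicator (cube c r) x *\<^sub>R g x)"
      using r cube_mono[of r s c] by (intro locally_integrableD[OF g compact_cube]) auto
    then show "(\<lambda>x. indicator (cube c r) x *\<^sub>R g x) \<in> borel_measurable lebesgue" by blast
    show "(\<lambda>x. g x * \<eta> k x) \<in> borel_measurable lebesgue" for k
      using locally_integrable_test[OF g test] by blast
    show "AE x in lebesgue. (\<lambda>k. g x * \<eta> k x) \<longlonglongrightarrow> indicator (cube c r) x *\<^sub>R g x"
      using tendsto_mult_left[OF lim] by (intro AE_I2) (simp add: mult.commute)
    show "AE x in lebesgue. norm (g x * \<eta> k x) \<le> \<bar>indicator (cube c s) x *\<^sub>R g x\<bar>" for k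
    proof (rule AE_I2)
      fix x
      have "\<bar>\<eta> k x\<bar> * \<bar>g x\<bar> \<le> indicator (cube c s) x * \<bar>g x\<bar>" using ind by (intro mult_right_mono) auto
      then show "norm (g x * \<eta> k x) \<le> \<bar>indicator (cube c s) x *\<^sub>R g x\<bar>" by (simp add: abs_mult mult.commute)
    qed
  qed
  then show ?thesis using zero[OF test] by (simp add: LIMSEQ_const_iff)
qed

lemma test_orthogonal_imp_AE_zero:
  fixes g :: "real ^ 'n \<Rightarrow> real"
  assumes U: "open U" and g: "locally_integrable U g"
    and zero: "\<And>\<phi>. \<phi> \<in> test_functions U \<Longrightarrow> (LINT x|lebesgue. g x * \<phi> x) = 0"
  shows "AE x in lebesgue. x \<in> U \<longrightarrow> g x = 0"
proof -
  let ?S = "{x \<in> U. g x \<noteq> 0}"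
  have "\<exists>V. openin (top_of_set ?S) V \<and> x0 \<in> V \<and> negligible V" if x0: "x0 \<in> ?S" for x0
  proof -
    obtain \<delta> where \<delta>: "\<delta> > 0" "cube x0 \<delta> \<subseteq> U" by (rule cube_in_open[OF U, of x0]) (use x0 in auto)
    define f where "f x = indicator (cube x0 \<delta>) x *\<^sub>R g x" for x
    have int: "integrable lebesgue f"
      unfolding f_def[abs_def] by (rule locally_integrableD[OF g compact_cube \<delta>(2)])
    then have "f absolutely_integrable_on UNIV" by (simp add: set_integrable_def)
    then have fi: "f integrable_on cbox a b" for a b
      by (meson absolutely_integrable_on_def integrable_on_subcbox subset_UNIV)
    obtain N where N: "negligible N" "\<And>x e. \<lbrakk>x \<notin> N; 0 < e\<rbrakk> \<Longrightarrow>
          \<exists>d>0. \<forall>h. 0 < h \<and> h < d \<longrightarrow>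
                norm (integral (cbox x (x + h *\<^sub>R One)) f /\<^sub>R h ^ DIM(real ^ 'n) - f x) < e"
      using integrable_ccontinuous_explicit[of f] fi by blast
    have "f x = 0" if x: "x \<in> box (x0 - (\<chi> i. \<delta>)) (x0 + (\<chi> i. \<delta>))" "x \<notin> N" for x
    proof (rule ccontr)
      assume "f x \<noteq> 0"
      obtain d where d: "d > 0" "\<And>h. 0 < h \<Longrightarrow> h < d \<Longrightarrow>
           norm (integral (cbox x (x + h *\<^sub>R One)) f /\<^sub>R h ^ DIM(real ^ 'n) - f x) < norm (f x)"
        using N(2)[OF x(2), of "norm (f x)"] \<open>f x \<noteq> 0\<close> by auto
      obtain e where e: "e > 0" "cube x e \<subseteq> box (x0 - (\<chi> i. \<delta>)) (x0 + (\<chi> i. \<delta>))"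
        using cube_in_open[OF open_box x(1)] by blast
      define h where "h = min (d / 2) (e / 2)"
      have h: "0 < h" "h < d" "h < e" using d e by (auto simp: h_def)
      have One: "(One :: real ^ 'n) $ i = 1" for i
      proof -
        have "(One :: real ^ 'n) $ i = (\<Sum>b\<in>Basis. 1 *\<^sub>R b) \<bullet> (axis i 1 :: real ^ 'n)" by (simp only: cart_eq_inner_axis scaleR_one)
        also have "\<dots> = 1" by (rule inner_sum_left_Basis) simp
        finally show ?thesis .
      qed
      define c where "c = x + (h / 2) *\<^sub>R (One :: real ^ 'n)"
      have box: "cbox x (x + h *\<^sub>R One) = cube c (h / 2)"
        unfolding cube_eq_cbox c_def
        by (intro arg_cong2[where f=cbox]) (auto simp: vec_eq_iff One[unfolded sum_component])
      have sub: "cube c (e - h / 2) \<subseteq> cube x0 \<delta>"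
      proof -
        have "cube c (e - h / 2) \<subseteq> cube x e"
        proof
          fix y assume "y \<in> cube c (e - h / 2)"
          then have "\<bar>y $ i - c $ i\<bar> \<le> e - h / 2" for i by (simp add: cube_def)
          moreover have "c $ i = x $ i + h / 2" for i by (simp add: c_def One[unfolded sum_component])
          ultimately have "\<bar>y $ i - x $ i\<bar> \<le> e" for i using h by (smt (verit) field_sum_of_halves)
          then show "y \<in> cube x e" by (simp add: cube_def)
        qed
        then show ?thesis using e(2) box_subset_cbox unfolding cube_eq_cbox[of x0] by blast
      qed
      have "integral (cube c (h / 2)) f = (LINT x|lebesgue. indicator (cube c (h / 2)) x *\<^sub>R f x)"
      proof -
        have "set_integrable lebesgue (cube c (h / 2)) f"
          unfolding set_integrable_def by (rule integrable_mult_indicator[OF cube_lebesgue int])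
        from set_lebesgue_integral_eq_integral(2)[OF this]
        show ?thesis by (simp add: set_lebesgue_integral_def)
      qed
      also have "\<dots> = (LINT x|lebesgue. indicator (cube c (h / 2)) x *\<^sub>R g x)"
        using sub cube_mono[of "h / 2" "e - h / 2" c] h unfolding f_def
        by (intro Bochner_Integration.integral_cong) (auto simp: indicator_def)
      also have "\<dots> = 0"
        using h sub \<delta> by (intro integral_cube_zero[OF g zero, of "h / 2" "e - h / 2"]) auto
      finally show False using d(2)[OF h(1,2)] unfolding box by simp
    qed
    then have "?S \<inter> box (x0 - (\<chi> i. \<delta>)) (x0 + (\<chi> i. \<delta>)) \<subseteq> N"
      using box_subset_cbox[of "x0 - (\<chi> i. \<delta>)" "x0 + (\<chi> i. \<delta>)"]
      unfolding f_def cube_eq_cbox by (force simp: indicator_def)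
    then have "negligible (?S \<inter> box (x0 - (\<chi> i. \<delta>)) (x0 + (\<chi> i. \<delta>)))"
      using N(1) negligible_subset by blast
    moreover have "x0 \<in> box (x0 - (\<chi> i. \<delta>)) (x0 + (\<chi> i. \<delta>))" using \<delta> by (auto simp: mem_box_cart)
    ultimately show ?thesis using x0
      by (intro exI[of _ "?S \<inter> box (x0 - (\<chi> i. \<delta>)) (x0 + (\<chi> i. \<delta>))"]) (auto intro: openin_open_Int)
  qed
  then have "negligible ?S" using locally_negligible_alt by blast
  then have "?S \<in> null_sets lebesgue" by (simp add: negligible_iff_null_sets)
  then have "AE x in lebesgue. x \<notin> ?S" by (rule AE_not_in)
  then show ?thesis by eventually_elim auto
qed


definition grad :: "(real ^ 'n \<Rightarrow> real) \<Rightarrow> real ^ 'n \<Rightarrow> real ^ 'n" where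
  "grad \<phi> x = (\<chi> i. partial_deriv i \<phi> x)"

lemma grad_nth [simp]: "grad \<phi> x $ i = partial_deriv i \<phi> x"
  by (simp add: grad_def)

lemma AE_vec_eq:
  fixes g h :: "real ^ 'n \<Rightarrow> real ^ 'm"
  assumes "\<And>i. AE x in M. P x \<longrightarrow> g x $ i = h x $ i"
  shows "AE x in M. P x \<longrightarrow> g x = h x"
proof -
  have "AE x in M. \<forall>i\<in>UNIV. P x \<longrightarrow> g x $ i = h x $ i"
    using assms by (intro AE_finite_allI) auto
  then show ?thesis by eventually_elim (auto simp: vec_eq_iff)
qed

lemma integral_test_AE:
  assumes u: "locally_integrable W u" and \<phi>: "\<phi> \<in> test_functions W"
    and ae: "AE x in lebesgue. x \<in> W \<longrightarrow> u x = v x"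
  shows "(LINT x|lebesgue. u x * \<phi> x) = (LINT x|lebesgue. v x * \<phi> x)"
proof (rule integrable_lebesgue_AE(2)[OF locally_integrable_test[OF u \<phi>]])
  show "AE x in lebesgue. u x * \<phi> x = v x * \<phi> x"
    using ae by eventually_elim (use test_zero[OF \<phi>] in force)
qed

lemma weak_gradient_unique:
  assumes U: "is_weak_gradient U u g" "open U" and V: "is_weak_gradient V v h" "open V"
    and W: "open W" "W \<subseteq> U" "W \<subseteq> V" and ae: "AE x in lebesgue. x \<in> W \<longrightarrow> u x = v x"
  shows "AE x in lebesgue. x \<in> W \<longrightarrow> g x = h x"
proof (rule AE_vec_eq)
  fix i
  have li: "locally_integrable W u" "locally_integrable W (\<lambda>x. g x $ i)" "locally_integrable W (\<lambda>x. h x $ i)"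
    using U V W by (auto simp: is_weak_gradient_def intro: locally_integrable_subset locally_integrable_component)
  have "AE x in lebesgue. x \<in> W \<longrightarrow> g x $ i - h x $ i = 0"
  proof (rule test_orthogonal_imp_AE_zero[OF W(1)])
    show "locally_integrable W (\<lambda>x. g x $ i - h x $ i)"
      unfolding locally_integrable_def
      by (intro allI impI Bochner_Integration.integrable_diff) (use li in \<open>simp_all add: locally_integrable_def\<close>)
  next
    fix \<phi> assume \<phi>: "\<phi> \<in> test_functions W"
    have "(LINT x|lebesgue. g x $ i * \<phi> x) = - (LINT x|lebesgue. u x * partial_deriv i \<phi> x)"
      using U \<phi> W test_mono[OF \<phi>] by (simp add: is_weak_gradient_iff)
    also have "(LINT x|lebesgue. u x * partial_deriv i \<phi> x) = (LINT x|lebesgue. v x * partial_deriv i \<phi> x)"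
      by (rule integral_test_AE[OF li(1) test_partial[OF \<phi>] ae])
    also have "- (LINT x|lebesgue. v x * partial_deriv i \<phi> x) = (LINT x|lebesgue. h x $ i * \<phi> x)"
      using V \<phi> W test_mono[OF \<phi>] by (simp add: is_weak_gradient_iff)
    finally show "(LINT x|lebesgue. (g x $ i - h x $ i) * \<phi> x) = 0"
      using li \<phi> by (simp add: left_diff_distrib locally_integrable_test)
  qed
  then show "AE x in lebesgue. x \<in> W \<longrightarrow> g x $ i = h x $ i" by simp
qed

lemma is_weak_gradient_AE:
  assumes U: "is_weak_gradient U u g" "open U"
    and ae: "AE x in lebesgue. x \<in> U \<longrightarrow> u x = v x" "AE x in lebesgue. x \<in> U \<longrightarrow> g x = h x"
  shows "is_weak_gradient U v h"
proof -
  have li: "locally_integrable U u" "locally_integrable U g" using U by (auto simp: is_weak_gradient_def)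
  have "(LINT x|lebesgue. v x * partial_deriv i \<phi> x) = - (LINT x|lebesgue. h x $ i * \<phi> x)"
    if \<phi>: "\<phi> \<in> test_functions U" for \<phi> i
  proof -
    have "AE x in lebesgue. x \<in> U \<longrightarrow> g x $ i = h x $ i" using ae(2) by eventually_elim auto
    then have "(LINT x|lebesgue. g x $ i * \<phi> x) = (LINT x|lebesgue. h x $ i * \<phi> x)"
      by (rule integral_test_AE[OF locally_integrable_component[OF li(2)] \<phi>])
    moreover have "(LINT x|lebesgue. u x * partial_deriv i \<phi> x) = (LINT x|lebesgue. v x * partial_deriv i \<phi> x)"
      by (rule integral_test_AE[OF li(1) test_partial[OF \<phi>] ae(1)])
    ultimately show ?thesis using U \<phi> by (simp add: is_weak_gradient_iff)
  qed
  then show ?thesis using U(2) locally_integrable_AE[OF li(1) ae(1)] locally_integrable_AE[OF li(2) ae(2)]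
    by (simp add: is_weak_gradient_iff)
qed

lemma is_weak_gradient_subset:
  assumes "is_weak_gradient U u g" "open U" "open W" "W \<subseteq> U"
  shows "is_weak_gradient W u g"
  unfolding is_weak_gradient_iff[OF assms(3)]
  using assms(1)[unfolded is_weak_gradient_iff[OF assms(2)]] assms(4)
  by (blast intro: locally_integrable_subset test_mono)

lemma locally_integrable_lincomb:
  assumes "locally_integrable U u" "locally_integrable U v"
  shows "locally_integrable U (\<lambda>x. u x + c *\<^sub>R v x)"
  unfolding locally_integrable_def
  by (intro allI impI Bochner_Integration.integrable_add integrable_scaleR_right)
    (use assms in \<open>simp_all add: locally_integrable_def\<close>)

lemma is_weak_gradient_lincomb:
  assumes u: "is_weak_gradient U u g" and v: "is_weak_gradient U v h" and U: "open U"
  shows "is_weak_gradient U (\<lambda>x. u x + c * v x) (\<lambda>x. g x + c *\<^sub>R h x)"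
proof -
  have li: "locally_integrable U u" "locally_integrable U g" "locally_integrable U v" "locally_integrable U h"
    using u v by (auto simp: is_weak_gradient_def)
  have split: "(LINT x|lebesgue. (a x + c * b x) * \<phi> x) = (LINT x|lebesgue. a x * \<phi> x) + c * (LINT x|lebesgue. b x * \<phi> x)"
    if "locally_integrable U a" "locally_integrable U b" "\<phi> \<in> test_functions U" for a b :: "real ^ 'a \<Rightarrow> real" and \<phi>
    using locally_integrable_test[OF that(1,3)] locally_integrable_test[OF that(2,3)]
    by (simp add: distrib_right mult.assoc)
  show ?thesis unfolding is_weak_gradient_iff[OF U]
  proof (intro conjI ballI allI)
    show "locally_integrable U (\<lambda>x. u x + c * v x)" "locally_integrable U (\<lambda>x. g x + c *\<^sub>R h x)"
      using locally_integrable_lincomb[OF li(1,3), of c] locally_integrable_lincomb[OF li(2,4), of c] by simp_all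
  next
    fix \<phi> i assume \<phi>: "\<phi> \<in> test_functions U"
    have "(LINT x|lebesgue. (g x + c *\<^sub>R h x) $ i * \<phi> x) = (LINT x|lebesgue. (g x $ i + c * h x $ i) * \<phi> x)"
      by simp
    then show "(LINT x|lebesgue. (u x + c * v x) * partial_deriv i \<phi> x)
        = - (LINT x|lebesgue. (g x + c *\<^sub>R h x) $ i * \<phi> x)"
      using u v \<phi> U split[OF li(1,3) test_partial[OF \<phi>, of i]]
        split[OF locally_integrable_component[OF li(2)] locally_integrable_component[OF li(4)] \<phi>, of i i]
      by (simp add: is_weak_gradient_iff)
  qed
qed

lemma locally_integrable_smooth:
  fixes \<phi> :: "real ^ 'n \<Rightarrow> real"
  assumes "smooth \<phi>" shows "locally_integrable U \<phi>"
  unfolding locally_integrable_iff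
proof (intro allI impI)
  fix K assume "compact K \<and> K \<subseteq> U"
  then have "integrable lborel (\<lambda>x. indicator K x *\<^sub>R \<phi> x)"
    using assms by (intro borel_integrable_compact smooth_continuous) auto
  then show "integrable lebesgue (\<lambda>x. indicator K x *\<^sub>R \<phi> x)" 
    by (intro integrable_completion[THEN iffD2]) auto
qed

lemma is_weak_gradient_smooth:
  fixes \<phi> :: "real ^ 'n \<Rightarrow> real"
  assumes \<phi>: "smooth \<phi>" and U: "open U"
  shows "is_weak_gradient U \<phi> (grad \<phi>)"
  unfolding is_weak_gradient_iff[OF U]
proof (intro conjI ballI allI)
  show li: "locally_integrable U \<phi>" by (rule locally_integrable_smooth[OF \<phi>])
  show li': "locally_integrable U (grad \<phi>)"
    by (rule locally_integrable_vec) (simp add: locally_integrable_smooth smooth_partial \<phi>)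
  fix \<psi> i assume \<psi>: "\<psi> \<in> test_functions U"
  have "(LINT x|lborel. partial_deriv i (\<lambda>x. \<psi> x * \<phi> x) x) = 0"
    by (rule integral_partial_deriv_test[OF test_mult[OF \<psi> \<phi>]])
  also have "partial_deriv i (\<lambda>x. \<psi> x * \<phi> x) = (\<lambda>x. \<phi> x * partial_deriv i \<psi> x + partial_deriv i \<phi> x * \<psi> x)"
    using smooth_differentiable \<phi> test_smooth[OF \<psi>]
    by (intro ext, subst partial_deriv_mult) (auto simp: mult.commute)
  also have "(LINT x|lborel. \<phi> x * partial_deriv i \<psi> x + partial_deriv i \<phi> x * \<psi> x)
     = (LINT x|lebesgue. \<phi> x * partial_deriv i \<psi> x + partial_deriv i \<phi> x * \<psi> x)"
    using smooth_measurable[OF \<phi>] smooth_measurable[OF smooth_partial[OF \<phi>, of i]]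
      smooth_measurable[OF test_smooth[OF \<psi>]] smooth_measurable[OF test_smooth[OF test_partial[OF \<psi>, of i]]]
    by (intro integral_completion[symmetric]) auto
  also have "\<dots> = (LINT x|lebesgue. \<phi> x * partial_deriv i \<psi> x) + (LINT x|lebesgue. partial_deriv i \<phi> x * \<psi> x)"
    using locally_integrable_test[OF li test_partial[OF \<psi>, of i]]
      locally_integrable_test[OF locally_integrable_smooth[OF smooth_partial[OF \<phi>]] \<psi>, of i]
    by (rule Bochner_Integration.integral_add)
  finally show "(LINT x|lebesgue. \<phi> x * partial_deriv i \<psi> x) = - (LINT x|lebesgue. grad \<phi> x $ i * \<psi> x)"
    by simp
qed

lemma is_weak_gradient_const: "open U \<Longrightarrow> is_weak_gradient U (\<lambda>_::real^'n. a) (\<lambda>_. 0)"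
proof -
  assume U: "open U"
  have "grad (\<lambda>_. a) = (\<lambda>_::real^'n. 0)"
    by (rule ext) (simp add: vec_eq_iff partial_deriv_eqI[OF has_derivative_const])
  then show ?thesis using is_weak_gradient_smooth[OF smooth_const U, of a] by simp
qed

lemma locally_integrable_test_mult:
  assumes u: "locally_integrable U u" and \<eta>: "\<eta> \<in> test_functions U"
  shows "locally_integrable V (\<lambda>x. \<eta> x * u x)"
proof -
  have int: "integrable lebesgue (\<lambda>x. \<eta> x * u x)"
    using locally_integrable_test[OF u \<eta>] by (simp add: mult.commute)
  then show ?thesis unfolding locally_integrable_iff
    by (auto intro!: integrable_mult_indicator simp: fmeasurableD lmeasurable_compact simp del: real_scaleR_def)
qed

lemma is_weak_gradient_cutoff:
  assumes u: "is_weak_gradient U u g" and U: "open U" and \<eta>: "\<eta> \<in> test_functions U"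
  shows "is_weak_gradient UNIV (\<lambda>x. \<eta> x * u x) (\<lambda>x. \<eta> x *\<^sub>R g x + u x *\<^sub>R grad \<eta> x)"
  unfolding is_weak_gradient_iff[OF open_UNIV]
proof (intro conjI ballI allI)
  have li: "locally_integrable U u" "locally_integrable U (\<lambda>x. g x $ i)" for i
    using u by (auto simp: is_weak_gradient_def intro: locally_integrable_component)
  show "locally_integrable UNIV (\<lambda>x. \<eta> x * u x)" by (rule locally_integrable_test_mult[OF li(1) \<eta>])
  show "locally_integrable UNIV (\<lambda>x. \<eta> x *\<^sub>R g x + u x *\<^sub>R grad \<eta> x)"
  proof (rule locally_integrable_vec)
    fix i
    show "locally_integrable UNIV (\<lambda>x. (\<eta> x *\<^sub>R g x + u x *\<^sub>R grad \<eta> x) $ i)"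
      using locally_integrable_lincomb[OF locally_integrable_test_mult[OF li(2)[of i] \<eta>]
          locally_integrable_test_mult[OF li(1) test_partial[OF \<eta>, of i]], of UNIV 1]
      by (simp add: mult.commute)
  qed
  fix \<psi> i assume \<psi>: "\<psi> \<in> test_functions (UNIV :: (real ^ 'a) set)"
  have pd: "partial_deriv i (\<lambda>x. \<eta> x * \<psi> x) x = \<eta> x * partial_deriv i \<psi> x + partial_deriv i \<eta> x * \<psi> x" for x
    using smooth_differentiable test_smooth[OF \<eta>] test_smooth[OF \<psi>] by (intro partial_deriv_mult) auto
  have t1: "(\<lambda>x. \<eta> x * partial_deriv i \<psi> x) \<in> test_functions U" "(\<lambda>x. partial_deriv i \<eta> x * \<psi> x) \<in> test_functions U"
    "(\<lambda>x. \<eta> x * \<psi> x) \<in> test_functions U"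
    using \<eta> \<psi> by (auto intro!: test_mult test_partial smooth_partial dest: test_smooth)
  have "(LINT x|lebesgue. u x * partial_deriv i (\<lambda>x. \<eta> x * \<psi> x) x) = - (LINT x|lebesgue. g x $ i * (\<eta> x * \<psi> x))"
    using u U t1(3) by (simp add: is_weak_gradient_iff)
  moreover have "(LINT x|lebesgue. u x * partial_deriv i (\<lambda>x. \<eta> x * \<psi> x) x)
     = (LINT x|lebesgue. u x * (\<eta> x * partial_deriv i \<psi> x)) + (LINT x|lebesgue. u x * (partial_deriv i \<eta> x * \<psi> x))"
    unfolding pd distrib_left
    by (rule Bochner_Integration.integral_add[OF locally_integrable_test[OF li(1) t1(1)] locally_integrable_test[OF li(1) t1(2)]])
  moreover have "(LINT x|lebesgue. (\<eta> x *\<^sub>R g x + u x *\<^sub>R grad \<eta> x) $ i * \<psi> x)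
     = (LINT x|lebesgue. g x $ i * (\<eta> x * \<psi> x)) + (LINT x|lebesgue. u x * (partial_deriv i \<eta> x * \<psi> x))"
    using Bochner_Integration.integral_add[OF locally_integrable_test[OF li(2) t1(3)] locally_integrable_test[OF li(1) t1(2)]]
    by (simp add: algebra_simps)
  ultimately show "(LINT x|lebesgue. \<eta> x * u x * partial_deriv i \<psi> x)
      = - (LINT x|lebesgue. (\<eta> x *\<^sub>R g x + u x *\<^sub>R grad \<eta> x) $ i * \<psi> x)"
    by (simp add: mult_ac)
qed

lemma weak_gradient_glue:
  assumes \<Omega>: "open \<Omega>"
    and loc: "\<And>W. open W \<Longrightarrow> compact (closure W) \<Longrightarrow> closure W \<subseteq> \<Omega> \<Longrightarrow> \<exists>g. is_weak_gradient W u g"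
  shows "\<exists>g. is_weak_gradient \<Omega> u g"
proof -
  obtain C :: "nat \<Rightarrow> (real ^ 'a) set" where C: "\<And>n. compact (C n)" "\<And>n. C n \<subseteq> \<Omega>" "\<And>n. C n \<subseteq> interior (C (Suc n))"
    "\<Union>(range C) = \<Omega>" "\<And>K. \<lbrakk>compact K; K \<subseteq> \<Omega>\<rbrakk> \<Longrightarrow> \<exists>N. \<forall>n\<ge>N. K \<subseteq> C n"
    by (rule open_Union_compact_subsets[OF \<Omega>]) (rule that)
  define W where "W n = interior (C n)" for n
  have W: "open (W n)" "closure (W n) \<subseteq> C n" for n
    unfolding W_def
    by (rule open_interior, rule closure_minimal[OF interior_subset compact_imp_closed[OF C(1)]])
  have "compact (closure (W n))" for n
    using compact_Int_closed[OF C(1)[of n] closed_closure, of "W n"] W(2)[of n] by (simp add: Int_absorb1)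
  then have "\<exists>g. is_weak_gradient (W n) u g" for n
    by (intro loc W(1) order_trans[OF W(2) C(2)])
  then obtain G where G: "\<And>n. is_weak_gradient (W n) u (G n)" by metis
  have cov: "\<exists>n. K \<subseteq> W n" if "compact K" "K \<subseteq> \<Omega>" for K
    using C(5)[OF that] C(3) by (force simp: W_def)
  have W\<Omega>: "W n \<subseteq> \<Omega>" for n using C(2)[of n] interior_subset by (force simp: W_def)
  define g where "g x = G (LEAST n. x \<in> W n) x" for x
  have "AE x in lebesgue. x \<in> W m \<inter> W n \<longrightarrow> G m x = G n x" for m n
    by (rule weak_gradient_unique[OF G W(1) G W(1)]) (auto intro: W)
  then have "AE x in lebesgue. \<forall>m n. x \<in> W m \<inter> W n \<longrightarrow> G m x = G n x" by (simp add: AE_all_countable)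
  then have ae: "AE x in lebesgue. x \<in> W n \<longrightarrow> G n x = g x" for n
  proof eventually_elim
    case (elim x)
    show ?case
    proof
      assume x: "x \<in> W n"
      then have "x \<in> W (LEAST n. x \<in> W n)" by (rule LeastI)
      then show "G n x = g x" unfolding g_def using elim x by blast
    qed
  qed
  have wg: "is_weak_gradient (W n) u g" for n
    by (rule is_weak_gradient_AE[OF G W(1) _ ae]) simp
  show ?thesis
  proof (rule exI[of _ g], unfold is_weak_gradient_iff[OF \<Omega>], intro conjI ballI allI)
    have "integrable (lebesgue_on K) u \<and> integrable (lebesgue_on K) g" if "compact K \<and> K \<subseteq> \<Omega>" for K
      using cov[of K] that wg by (auto simp: is_weak_gradient_def locally_integrable_def)
    then show "locally_integrable \<Omega> u" "locally_integrable \<Omega> g" by (auto simp: locally_integrable_def)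
    fix \<phi> i assume \<phi>: "\<phi> \<in> test_functions \<Omega>"
    then obtain n where "supp UNIV \<phi> \<subseteq> W n" using cov[of "supp UNIV \<phi>"] by (auto simp: test_functions_iff)
    then have "\<phi> \<in> test_functions (W n)" using \<phi> by (simp add: test_functions_iff)
    then show "(LINT x|lebesgue. u x * partial_deriv i \<phi> x) = - (LINT x|lebesgue. g x $ i * \<phi> x)"
      using wg[of n] by (simp add: is_weak_gradient_iff W(1))
  qed
qed

subsection \<open>Approximation in \<open>L\<^sup>p\<close>\<close>

lemma powr_add_le:
  fixes a b p :: real
  assumes "a \<ge> 0" "b \<ge> 0" "p > 0"
  shows "(a + b) powr p \<le> 2 powr p * (a powr p + b powr p)"
proof -
  have "(a + b) powr p \<le> (2 * max a b) powr p" using assms by (intro powr_mono2) auto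
  also have "\<dots> = 2 powr p * max a b powr p" by (rule powr_mult)
  also have "max a b powr p \<le> a powr p + b powr p" by (simp add: max_def)
  finally show ?thesis by (simp add: mult_left_mono)
qed

lemma powr_add3_le:
  fixes a b c p :: real
  assumes "a \<ge> 0" "b \<ge> 0" "c \<ge> 0" "p > 0"
  shows "(a + b + c) powr p \<le> 3 powr p * (a powr p + b powr p + c powr p)"
proof -
  let ?m = "max a (max b c)"
  have "(a + b + c) powr p \<le> (3 * ?m) powr p" using assms by (intro powr_mono2) auto
  also have "\<dots> = 3 powr p * ?m powr p" by (rule powr_mult)
  also have "?m powr p \<le> a powr p + b powr p + c powr p" by (auto simp: max_def)
  finally show ?thesis by (simp add: mult_left_mono)
qed

lemma norm_powr_le:
  fixes z :: "real ^ 'n"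
  assumes p: "p > 0"
  shows "norm z powr p \<le> real CARD('n) powr p * (\<Sum>i\<in>UNIV. \<bar>z $ i\<bar> powr p)"
proof -
  let ?m = "Max (range (\<lambda>i. \<bar>z $ i\<bar>))"
  have fin: "finite (range (\<lambda>i. \<bar>z $ i\<bar>))" by simp
  then have "?m \<in> range (\<lambda>i. \<bar>z $ i\<bar>)" by (intro Max_in) auto
  then obtain j where j: "?m = \<bar>z $ j\<bar>" by (rule rangeE)
  have "norm z \<le> (\<Sum>i\<in>UNIV. \<bar>z $ i\<bar>)" by (rule norm_le_l1_cart)
  also have "\<dots> \<le> (\<Sum>i\<in>(UNIV :: 'n set). \<bar>z $ j\<bar>)"
    using Max_ge[OF fin] unfolding j by (intro sum_mono) auto
  finally have "norm z powr p \<le> (real CARD('n) * \<bar>z $ j\<bar>) powr p"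
    using p by (intro powr_mono2) auto
  also have "\<dots> = real CARD('n) powr p * \<bar>z $ j\<bar> powr p" by (rule powr_mult)
  also have "\<bar>z $ j\<bar> powr p \<le> (\<Sum>i\<in>UNIV. \<bar>z $ i\<bar> powr p)"
    by (rule member_le_sum) auto
  finally show ?thesis by (simp add: mult_left_mono)
qed

lemma powr_ge_tangent:
  fixes c s p :: real
  assumes "c > 0" "s \<ge> 0" "p > 1"
  shows "s powr p \<ge> c powr p + p * c powr (p - 1) * (s - c)"
proof (cases "s = 0")
  case True
  have "c powr (p - 1) * c = c powr p" using assms by (simp add: powr_diff)
  then have "c powr p + p * c powr (p - 1) * (s - c) = c powr p * (1 - p)"
    using True by (simp add: algebra_simps)
  also have "\<dots> \<le> 0" using assms by (simp add: mult_nonneg_nonpos)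
  finally show ?thesis using True assms by simp
next
  case False
  have "s powr p - c powr p \<ge> p * c powr (p - 1) * (s - c)"
    using assms False
    by (intro convex_on_imp_above_tangent[of "{0<..}" "\<lambda>x. x powr p"] powr_convex)
      (auto simp: interior_open intro!: derivative_eq_intros)
  then show ?thesis by simp
qed

lemma jensen_powr:
  fixes h \<kappa> :: "'a \<Rightarrow> real"
  assumes p: "p > 1" and [measurable]: "h \<in> borel_measurable M" "\<kappa> \<in> borel_measurable M"
    and \<kappa>: "\<And>z. \<kappa> z \<ge> 0" "integrable M \<kappa>" "(LINT z|M. \<kappa> z) = 1" and int: "integrable M (\<lambda>z. \<kappa> z * h z)"
  shows "ennreal (\<bar>LINT z|M. \<kappa> z * h z\<bar> powr p) \<le> (\<integral>\<^sup>+z. ennreal (\<kappa> z * \<bar>h z\<bar> powr p) \<partial>M)"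
proof (cases "(\<integral>\<^sup>+z. ennreal (\<kappa> z * \<bar>h z\<bar> powr p) \<partial>M) = \<infinity>")
  case False
  then have intp: "integrable M (\<lambda>z. \<kappa> z * \<bar>h z\<bar> powr p)"
    by (intro integrableI_nonneg) (auto simp: \<kappa> less_top)
  define c where "c = \<bar>LINT z|M. \<kappa> z * h z\<bar>"
  show ?thesis
  proof (cases "c = 0")
    case True
    then show ?thesis by (simp add: c_def)
  next
    case False
    then have c: "c > 0" by (simp add: c_def)
    have inta: "integrable M (\<lambda>z. \<kappa> z * \<bar>h z\<bar>)"
      using integrable_abs[OF int] by (simp add: abs_mult \<kappa>)
    have "c \<le> (LINT z|M. \<kappa> z * \<bar>h z\<bar>)"
      using integral_abs_bound[of M "\<lambda>z. \<kappa> z * h z"] by (simp add: abs_mult \<kappa> c_def)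
    then have "c powr p + p * c powr (p - 1) * (c - c) \<le> c powr p + p * c powr (p - 1) * ((LINT z|M. \<kappa> z * \<bar>h z\<bar>) - c)"
      using p c by (intro add_left_mono mult_left_mono) auto
    also have "\<dots> = (c powr p - p * c powr (p - 1) * c) * (LINT z|M. \<kappa> z) + p * c powr (p - 1) * (LINT z|M. \<kappa> z * \<bar>h z\<bar>)"
      using \<kappa>(3) by (simp add: algebra_simps)
    also have "\<dots> = (LINT z|M. (c powr p - p * c powr (p - 1) * c) * \<kappa> z + p * c powr (p - 1) * (\<kappa> z * \<bar>h z\<bar>))"
      using \<kappa>(2) inta by (subst Bochner_Integration.integral_add) (auto simp del: right_diff_distrib left_diff_distrib)
    also have "\<dots> \<le> (LINT z|M. \<kappa> z * \<bar>h z\<bar> powr p)"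
    proof (rule integral_mono)
      fix z
      have "\<kappa> z * (c powr p + p * c powr (p - 1) * (\<bar>h z\<bar> - c)) \<le> \<kappa> z * \<bar>h z\<bar> powr p"
        using powr_ge_tangent[OF c _ p, of "\<bar>h z\<bar>"] \<kappa> by (intro mult_left_mono) auto
      then show "(c powr p - p * c powr (p - 1) * c) * \<kappa> z + p * c powr (p - 1) * (\<kappa> z * \<bar>h z\<bar>) \<le> \<kappa> z * \<bar>h z\<bar> powr p"
        by (simp add: algebra_simps)
    qed (use \<kappa> inta intp in auto)
    finally have "ennreal (c powr p) \<le> ennreal (LINT z|M. \<kappa> z * \<bar>h z\<bar> powr p)"
      by (intro ennreal_leI) simp
    also have "\<dots> = (\<integral>\<^sup>+z. ennreal (\<kappa> z * \<bar>h z\<bar> powr p) \<partial>M)"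
      using intp \<kappa> by (intro nn_integral_eq_integral[symmetric]) auto
    finally show ?thesis by (simp add: c_def)
  qed
qed simp

lemma ennreal_le_two_cmult:
  assumes "X \<le> ennreal K * (A + B)" "A \<le> ennreal (\<delta> / (2 * K))" "B \<le> ennreal (\<delta> / (2 * K))" "K > 0" "\<delta> \<ge> 0"
  shows "X \<le> ennreal \<delta>"
proof -
  have "X \<le> ennreal K * (ennreal (\<delta> / (2 * K)) + ennreal (\<delta> / (2 * K)))"
    using assms by (meson add_mono mult_left_mono order_trans zero_le)
  also have "\<dots> = ennreal (K * (\<delta> / (2 * K) + \<delta> / (2 * K)))"
  proof -
    have "0 \<le> \<delta> / (2 * K)" using assms by simp
    then show ?thesis using assms(4)
      by (simp add: ennreal_plus[symmetric] ennreal_mult[symmetric] del: ennreal_plus)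
  qed
  also have "K * (\<delta> / (2 * K) + \<delta> / (2 * K)) = \<delta>" using assms by (simp add: field_simps)
  finally show ?thesis .
qed

lemma continuous_approx_powr:
  fixes f :: "real ^ 'n \<Rightarrow> real"
  assumes p: "p > 1" and f[measurable]: "f \<in> borel_measurable borel"
    and fin: "(\<integral>\<^sup>+x. ennreal (\<bar>f x\<bar> powr p) \<partial>lborel) < \<infinity>"
    and S[measurable]: "S \<in> sets borel" "emeasure lborel S < \<infinity>" and \<delta>: "\<delta> > 0"
  shows "\<exists>c. continuous_on UNIV c \<and> (\<integral>\<^sup>+x. ennreal (\<bar>f x - c x\<bar> powr p) * indicator S x \<partial>lborel) \<le> ennreal \<delta>"
proof -
  define T where "T N s = max (- real N) (min (real N) s)" for N :: nat and s :: real
  have T: "\<bar>T N s\<bar> \<le> real N" "\<bar>s - T N s\<bar> \<le> \<bar>s\<bar>" "\<bar>s\<bar> \<le> real N \<Longrightarrow> T N s = s" for N s by (auto simp: T_def)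
  have Tc: "continuous_on UNIV (T N)" for N unfolding T_def by (intro continuous_intros)
  have [measurable]: "T N \<in> borel_measurable borel" for N
    by (rule borel_measurable_continuous_onI[OF Tc])
  define d where "d = \<delta> / (2 * 2 powr p)"
  have d: "d > 0" using \<delta> by (simp add: d_def)
  have "(\<lambda>N. \<integral>\<^sup>+x. ennreal (\<bar>f x - T N (f x)\<bar> powr p) \<partial>lborel) \<longlonglongrightarrow> (\<integral>\<^sup>+x. 0 \<partial>(lborel :: (real ^ 'n) measure))"
  proof (rule nn_integral_dominated_convergence[where u'="\<lambda>_. 0" and w="\<lambda>x. ennreal (\<bar>f x\<bar> powr p)"])
    show "AE x in lborel. ennreal (\<bar>f x - T N (f x)\<bar> powr p) \<le> ennreal (\<bar>f x\<bar> powr p)" for N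
      using p T(2) by (intro AE_I2 ennreal_leI powr_mono2) auto
    show "AE x in lborel. (\<lambda>N. ennreal (\<bar>f x - T N (f x)\<bar> powr p)) \<longlonglongrightarrow> 0"
    proof (rule AE_I2)
      fix x
      obtain N0 where N0: "\<bar>f x\<bar> \<le> real N0" using real_arch_simple by blast
      have "\<forall>\<^sub>F N in sequentially. 0 = ennreal (\<bar>f x - T N (f x)\<bar> powr p)"
        using eventually_ge_at_top[of N0] by eventually_elim (use N0 T(3)[of "f x"] in auto)
      then show "(\<lambda>N. ennreal (\<bar>f x - T N (f x)\<bar> powr p)) \<longlonglongrightarrow> 0"
        by (rule Lim_transform_eventually[OF tendsto_const])
    qed
  qed (use fin in auto)
  then have "\<forall>\<^sub>F N in sequentially. (\<integral>\<^sup>+x. ennreal (\<bar>f x - T N (f x)\<bar> powr p) \<partial>lborel) < ennreal d"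
    using d by (intro order_tendstoD(2)) auto
  then obtain N where N: "(\<integral>\<^sup>+x. ennreal (\<bar>f x - T N (f x)\<bar> powr p) \<partial>lborel) \<le> ennreal d"
    by (auto simp: eventually_sequentially intro: less_imp_le)
  have "f \<in> borel_measurable (lebesgue_on UNIV)" using f by (simp add: lebesgue_on_UNIV_eq measurable_completion)
  then have "f measurable_on UNIV" by (simp add: measurable_on_iff_borel_measurable)
  then obtain Z g where Z: "negligible Z" "\<And>n. continuous_on UNIV (g n)" "\<And>x. x \<notin> Z \<Longrightarrow> (\<lambda>n. g n x) \<longlonglongrightarrow> f x"
    by (auto simp: measurable_on_def)
  have [measurable]: "g n \<in> borel_measurable borel" for n by (rule borel_measurable_continuous_onI[OF Z(2)])
  have "AE x in lebesgue. x \<notin> Z" using Z(1) by (intro AE_not_in) (simp add: negligible_iff_null_sets)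
  moreover have "{x. (\<lambda>n. g n x) \<longlonglongrightarrow> f x} \<in> sets borel" by measurable
  ultimately have lim: "AE x in lborel. (\<lambda>n. g n x) \<longlonglongrightarrow> f x"
    using Z(3) by (subst AE_completion_iff[symmetric]) (auto elim: eventually_mono)
  have "(\<lambda>n. \<integral>\<^sup>+x. ennreal (\<bar>T N (f x) - T N (g n x)\<bar> powr p) * indicator S x \<partial>lborel) \<longlonglongrightarrow> (\<integral>\<^sup>+x. 0 \<partial>(lborel :: (real ^ 'n) measure))"
  proof (rule nn_integral_dominated_convergence[where u'="\<lambda>_. 0" and w="\<lambda>x. ennreal ((2 * real N) powr p) * indicator S x"])
    have "\<bar>T N s - T N t\<bar> \<le> 2 * real N" for s t using T(1)[of N s] T(1)[of N t] by linarith
    then show "AE x in lborel. ennreal (\<bar>T N (f x) - T N (g n x)\<bar> powr p) * indicator S x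
        \<le> ennreal ((2 * real N) powr p) * indicator S x" for n
      using p by (intro AE_I2 mult_right_mono ennreal_leI powr_mono2) auto
    show "(\<integral>\<^sup>+x. ennreal ((2 * real N) powr p) * indicator S x \<partial>lborel) < \<infinity>"
      using S by (subst nn_integral_cmult_indicator) (auto simp: ennreal_mult_less_top)
    show "AE x in lborel. (\<lambda>n. ennreal (\<bar>T N (f x) - T N (g n x)\<bar> powr p) * indicator S x) \<longlonglongrightarrow> 0"
      using lim
    proof eventually_elim
      case (elim x)
      have "(\<lambda>n. T N (g n x)) \<longlonglongrightarrow> T N (f x)"
        using Tc elim by (rule continuous_on_tendsto_compose) auto
      then have "(\<lambda>n. \<bar>T N (f x) - T N (g n x)\<bar>) \<longlonglongrightarrow> \<bar>T N (f x) - T N (f x)\<bar>"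
        by (intro tendsto_intros)
      then have "(\<lambda>n. \<bar>T N (f x) - T N (g n x)\<bar> powr p) \<longlonglongrightarrow> \<bar>T N (f x) - T N (f x)\<bar> powr p"
        using p by (intro tendsto_powr2) auto
      then have "(\<lambda>n. ennreal (\<bar>T N (f x) - T N (g n x)\<bar> powr p)) \<longlonglongrightarrow> ennreal 0"
        by (intro tendsto_ennrealI) simp
      then show ?case by (cases "x \<in> S") auto
    qed
  qed auto
  then have "\<forall>\<^sub>F n in sequentially. (\<integral>\<^sup>+x. ennreal (\<bar>T N (f x) - T N (g n x)\<bar> powr p) * indicator S x \<partial>lborel) < ennreal d"
    using d by (intro order_tendstoD(2)) auto
  then obtain n where n: "(\<integral>\<^sup>+x. ennreal (\<bar>T N (f x) - T N (g n x)\<bar> powr p) * indicator S x \<partial>lborel) \<le> ennreal d"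
    by (auto simp: eventually_sequentially intro: less_imp_le)
  define c where "c x = T N (g n x)" for x
  have "continuous_on UNIV c" unfolding c_def
    using continuous_on_compose2[OF Tc Z(2)] by auto
  have [measurable]: "c \<in> borel_measurable borel" unfolding c_def by measurable
  have "(\<integral>\<^sup>+x. ennreal (\<bar>f x - c x\<bar> powr p) * indicator S x \<partial>lborel)
     \<le> (\<integral>\<^sup>+x. ennreal (2 powr p) * (ennreal (\<bar>f x - T N (f x)\<bar> powr p)
          + ennreal (\<bar>T N (f x) - T N (g n x)\<bar> powr p) * indicator S x) \<partial>lborel)"
  proof (rule nn_integral_mono)
    fix x
    have "\<bar>f x - c x\<bar> powr p \<le> (\<bar>f x - T N (f x)\<bar> + \<bar>T N (f x) - T N (g n x)\<bar>) powr p"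
      using p unfolding c_def by (intro powr_mono2) auto
    also have "\<dots> \<le> 2 powr p * (\<bar>f x - T N (f x)\<bar> powr p + \<bar>T N (f x) - T N (g n x)\<bar> powr p)"
      using p by (intro powr_add_le) auto
    finally have "ennreal (\<bar>f x - c x\<bar> powr p) \<le> ennreal (2 powr p) * (ennreal (\<bar>f x - T N (f x)\<bar> powr p)
          + ennreal (\<bar>T N (f x) - T N (g n x)\<bar> powr p))"
      using ennreal_leI by (fastforce simp: ennreal_mult)
    then show "ennreal (\<bar>f x - c x\<bar> powr p) * indicator S x \<le> ennreal (2 powr p) * (ennreal (\<bar>f x - T N (f x)\<bar> powr p)
          + ennreal (\<bar>T N (f x) - T N (g n x)\<bar> powr p) * indicator S x)"
      by (cases "x \<in> S") auto
  qed
  also have "\<dots> = ennreal (2 powr p) * ((\<integral>\<^sup>+x. ennreal (\<bar>f x - T N (f x)\<bar> powr p) \<partial>lborel)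
      + (\<integral>\<^sup>+x. ennreal (\<bar>T N (f x) - T N (g n x)\<bar> powr p) * indicator S x \<partial>lborel))"
    by (subst nn_integral_cmult) (auto simp: nn_integral_add)
  finally have "(\<integral>\<^sup>+x. ennreal (\<bar>f x - c x\<bar> powr p) * indicator S x \<partial>lborel) \<le> ennreal \<delta>"
    by (rule ennreal_le_two_cmult) (use N n \<delta> in \<open>auto simp: d_def\<close>)
  then show ?thesis using \<open>continuous_on UNIV c\<close> by blast
qed

lemma nn_integral_lborel_shift:
  fixes f :: "real ^ 'n \<Rightarrow> ennreal"
  assumes [measurable]: "f \<in> borel_measurable borel"
  shows "(\<integral>\<^sup>+x. f (x + c) \<partial>lborel) = (\<integral>\<^sup>+x. f x \<partial>lborel)"
proof -
  have "(\<integral>\<^sup>+x. f x \<partial>lborel) = (\<integral>\<^sup>+x. f x \<partial>distr lborel borel ((+) c))" by (simp only: lborel_distr_plus)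
  also have "\<dots> = (\<integral>\<^sup>+x. f (c + x) \<partial>lborel)" by (intro nn_integral_distr) auto
  finally show ?thesis by (simp add: add.commute)
qed

lemma translation_continuous_powr:
  fixes f :: "real ^ 'n \<Rightarrow> real"
  assumes p: "p > 1" and f[measurable]: "f \<in> borel_measurable borel"
    and fin: "(\<integral>\<^sup>+x. ennreal (\<bar>f x\<bar> powr p) \<partial>lborel) < \<infinity>"
    and \<rho>: "\<And>x. x \<notin> cube 0 \<rho> \<Longrightarrow> f x = 0" and \<delta>: "\<delta> > 0"
  obtains \<epsilon> where "\<epsilon> > 0"
    "\<And>y. y \<in> cube 0 \<epsilon> \<Longrightarrow> (\<integral>\<^sup>+x. ennreal (\<bar>f (x - y) - f x\<bar> powr p) \<partial>lborel) \<le> ennreal \<delta>"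
proof -
  let ?S = "cube (0 :: real ^ 'n) (\<rho> + 1)" and ?S2 = "cube (0 :: real ^ 'n) (\<rho> + 2)"
  define K where "K = 2 * 3 powr p"
  define d where "d = \<delta> / (2 * K)"
  have K: "K > 0" and d: "d > 0" using \<delta> by (auto simp: K_def d_def)
  have S2: "emeasure lborel ?S2 < \<infinity>" "emeasure lborel ?S < \<infinity>"
    by (intro emeasure_bounded_finite compact_imp_bounded compact_cube)+
  obtain c where c: "continuous_on UNIV c"
    "(\<integral>\<^sup>+x. ennreal (\<bar>f x - c x\<bar> powr p) * indicator ?S2 x \<partial>lborel) \<le> ennreal d"
    using continuous_approx_powr[OF p f fin _ S2(1) d] by auto
  have [measurable]: "c \<in> borel_measurable borel" by (rule borel_measurable_continuous_onI[OF c(1)])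
  define m where "m = measure lborel ?S"
  have m: "emeasure lborel ?S = ennreal m" "m \<ge> 0" using S2 by (auto simp: m_def emeasure_eq_ennreal_measure)
  define \<eta> where "\<eta> = (d / (m + 1)) powr (1 / p)"
  have \<eta>: "\<eta> > 0" "\<eta> powr p = d / (m + 1)" using d m p by (auto simp: \<eta>_def powr_powr)
  have "uniformly_continuous_on ?S2 c"
    using c(1) by (intro compact_uniformly_continuous) (auto intro: continuous_on_subset)
  then obtain e where e: "e > 0" "\<And>x x'. x \<in> ?S2 \<Longrightarrow> x' \<in> ?S2 \<Longrightarrow> dist x' x < e \<Longrightarrow> dist (c x') (c x) < \<eta>"
    using \<eta>(1) by (rule uniformly_continuous_onE) (rule that)
  define \<epsilon> where "\<epsilon> = min 1 (e / (2 * real CARD('n)))"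
  show ?thesis
  proof (rule that[of \<epsilon>])
    show "\<epsilon> > 0" using e by (simp add: \<epsilon>_def)
  next
    fix y :: "real ^ 'n" assume y: "y \<in> cube 0 \<epsilon>"
    have y1: "\<bar>y $ i\<bar> \<le> 1" for i using y by (auto simp: cube_def \<epsilon>_def)
    have "norm y \<le> real CARD('n) * \<epsilon>" using cube_subset_ball[of 0 \<epsilon>] y by auto
    also have "\<dots> \<le> real CARD('n) * (e / (2 * real CARD('n)))" by (intro mult_left_mono) (auto simp: \<epsilon>_def)
    also have "\<dots> < e" using e by simp
    finally have ny: "norm y < e" .
    have inS2: "x \<in> ?S2" "x - y \<in> ?S2" if "x \<in> ?S" for x
    proof -
      have x: "\<bar>x $ i\<bar> \<le> \<rho> + 1" for i using that by (simp add: cube_def)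
      have "\<bar>x $ i\<bar> \<le> \<rho> + 2" for i using x[of i] by linarith
      then show "x \<in> ?S2" by (simp add: cube_def)
      have "\<bar>x $ i - y $ i\<bar> \<le> \<rho> + 2" for i using x[of i] y1[of i] by linarith
      then show "x - y \<in> ?S2" by (simp add: cube_def)
    qed
    have off: "f (x - y) - f x = 0" if "x \<notin> ?S" for x
    proof -
      from that obtain i where i: "\<bar>x $ i\<bar> > \<rho> + 1" by (auto simp: cube_def not_le)
      then have "\<bar>(x - y) $ i\<bar> > \<rho>" "\<bar>x $ i\<bar> > \<rho>" using y1[of i] by auto
      then have "x - y \<notin> cube 0 \<rho>" "x \<notin> cube 0 \<rho>" unfolding cube_def by (auto simp: not_le)
      then show ?thesis by (simp add: \<rho>)
    qed
    let ?a = "\<lambda>x. ennreal (\<bar>f x - c x\<bar> powr p) * indicator ?S2 x"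
    let ?b = "\<lambda>x. ennreal (\<eta> powr p) * indicator ?S x"
    have pt: "ennreal (\<bar>f (x - y) - f x\<bar> powr p) \<le> ennreal (3 powr p) * (?a (x - y) + ?b x + ?a x)" for x
    proof (cases "x \<in> ?S")
      case False
      then show ?thesis using off p by simp
    next
      case True
      have "dist (c (x - y)) (c x) < \<eta>" by (rule e(2)) (use inS2[OF True] ny in \<open>auto simp: dist_norm\<close>)
      then have cc: "\<bar>c (x - y) - c x\<bar> \<le> \<eta>" by (simp add: dist_real_def)
      have "\<bar>f (x - y) - f x\<bar> powr p \<le> (\<bar>f (x - y) - c (x - y)\<bar> + \<bar>c (x - y) - c x\<bar> + \<bar>f x - c x\<bar>) powr p"
        using p by (intro powr_mono2) auto
      also have "\<dots> \<le> 3 powr p * (\<bar>f (x - y) - c (x - y)\<bar> powr p + \<bar>c (x - y) - c x\<bar> powr p + \<bar>f x - c x\<bar> powr p)"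
        using p by (intro powr_add3_le) auto
      also have "\<dots> \<le> 3 powr p * (\<bar>f (x - y) - c (x - y)\<bar> powr p + \<eta> powr p + \<bar>f x - c x\<bar> powr p)"
        using p cc by (intro mult_left_mono add_mono powr_mono2) auto
      finally have "ennreal (\<bar>f (x - y) - f x\<bar> powr p) \<le>
          ennreal (3 powr p * (\<bar>f (x - y) - c (x - y)\<bar> powr p + \<eta> powr p + \<bar>f x - c x\<bar> powr p))"
        by (rule ennreal_leI)
      also have "\<dots> = ennreal (3 powr p) * (?a (x - y) + ?b x + ?a x)"
        using True inS2[OF True] by (simp add: ennreal_mult)
      finally show ?thesis .
    qed
    have "(\<integral>\<^sup>+x. ennreal (\<bar>f (x - y) - f x\<bar> powr p) \<partial>lborel)
        \<le> (\<integral>\<^sup>+x. ennreal (3 powr p) * (?a (x - y) + ?b x + ?a x) \<partial>lborel)"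
      by (intro nn_integral_mono pt)
    also have "\<dots> = ennreal (3 powr p) * ((\<integral>\<^sup>+x. ?a (x - y) \<partial>lborel) + (\<integral>\<^sup>+x. ?b x \<partial>lborel) + (\<integral>\<^sup>+x. ?a x \<partial>lborel))"
    proof -
      have [measurable]: "?a \<in> borel_measurable lborel" "(\<lambda>x. ?a (x - y)) \<in> borel_measurable lborel" "?b \<in> borel_measurable lborel"
        by measurable
      show ?thesis by (simp add: nn_integral_cmult nn_integral_add)
    qed
    also have "(\<integral>\<^sup>+x. ?a (x - y) \<partial>lborel) = (\<integral>\<^sup>+x. ?a x \<partial>lborel)"
      using nn_integral_lborel_shift[of ?a "- y"] by simp
    also have "(\<integral>\<^sup>+x. ?b x \<partial>lborel) = ennreal (d / (m + 1)) * ennreal m"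
      by (subst nn_integral_cmult_indicator) (auto simp: m \<eta>)
    also have "\<dots> \<le> ennreal d"
      using m d by (subst ennreal_mult[symmetric]) (auto intro!: ennreal_leI simp: field_simps)
    finally have "(\<integral>\<^sup>+x. ennreal (\<bar>f (x - y) - f x\<bar> powr p) \<partial>lborel) \<le> ennreal (3 powr p) * (ennreal d + ennreal d + ennreal d)"
      using c(2) by (meson add_mono mult_left_mono order_refl order_trans zero_le)
    also have "ennreal d + ennreal d + ennreal d = ennreal (d + d + d)"
      using d by (simp add: ennreal_plus[symmetric] del: ennreal_plus)
    also have "ennreal (3 powr p) * ennreal (d + d + d) = ennreal (3 powr p * (d + d + d))"
      using d by (intro ennreal_mult[symmetric]) auto
    also have "\<dots> \<le> ennreal \<delta>"
      using \<delta> by (intro ennreal_leI) (simp add: d_def K_def)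
    finally show "(\<integral>\<^sup>+x. ennreal (\<bar>f (x - y) - f x\<bar> powr p) \<partial>lborel) \<le> ennreal \<delta>" .
  qed
qed

subsection \<open>Mollification\<close>

definition conv :: "(real ^ 'n \<Rightarrow> real) \<Rightarrow> (real ^ 'n \<Rightarrow> real) \<Rightarrow> real ^ 'n \<Rightarrow> real" where
  "conv \<kappa> f x = (LINT y|lebesgue. \<kappa> (x - y) * f y)"

lemma conv_integrable:
  assumes \<kappa>: "\<kappa> \<in> test_functions UNIV" and f: "integrable lebesgue f"
  shows "integrable lebesgue (\<lambda>y. \<kappa> (x - y) * f y)"
proof -
  obtain B where B: "B > 0" "\<And>x. \<bar>\<kappa> x\<bar> \<le> B" using test_bounded[OF \<kappa>] by blast
  have [measurable]: "\<kappa> \<in> borel_measurable borel" by (rule test_measurable[OF \<kappa>])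
  have "(\<lambda>y. \<kappa> (x - y)) \<in> borel_measurable lebesgue" by (rule measurable_completion) measurable
  show ?thesis
  proof (rule Bochner_Integration.integrable_bound[where f="\<lambda>y. B * f y"])
    show "(\<lambda>y. \<kappa> (x - y) * f y) \<in> borel_measurable lebesgue"
      using \<open>(\<lambda>y. \<kappa> (x - y)) \<in> borel_measurable lebesgue\<close> f by (intro borel_measurable_times) auto
    show "AE y in lebesgue. norm (\<kappa> (x - y) * f y) \<le> norm (B * f y)"
      using B by (intro AE_I2) (simp add: abs_mult mult_right_mono)
  qed (use f in simp)
qed

lemma conv_has_derivative:
  fixes f :: "real ^ 'n \<Rightarrow> real"
  assumes \<kappa>: "\<kappa> \<in> test_functions UNIV" and f: "integrable lebesgue f"
  shows "(conv \<kappa> f has_derivative (\<lambda>h. \<Sum>i\<in>UNIV. conv (partial_deriv i \<kappa>) f x * h $ i)) (at x)"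
proof -
  let ?D = "\<lambda>z h. \<Sum>i\<in>UNIV. partial_deriv i \<kappa> z * h $ i"
  have test_pd: "partial_deriv i \<kappa> \<in> test_functions UNIV" for i by (rule test_partial[OF \<kappa>])
  have "\<exists>B>0. \<forall>x. \<bar>partial_deriv i \<kappa> x\<bar> \<le> B" for i
    using test_bounded[OF test_pd, of i] by metis
  then obtain B where B: "\<And>i. B i > 0" "\<And>i x. \<bar>partial_deriv i \<kappa> x\<bar> \<le> B i" by metis
  obtain B0 where B0: "B0 > 0" "\<And>x h. \<bar>\<kappa> (x + h) - \<kappa> x\<bar> \<le> B0 * norm h" using test_diff_bound[OF \<kappa>] by blast
  define C where "C = B0 + (\<Sum>i\<in>UNIV. B i)"
  have Dbd: "\<bar>?D z h\<bar> \<le> (\<Sum>i\<in>UNIV. B i) * norm h" for z h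
  proof -
    have "\<bar>?D z h\<bar> \<le> (\<Sum>i\<in>UNIV. \<bar>partial_deriv i \<kappa> z\<bar> * \<bar>h $ i\<bar>)"
      by (rule order_trans[OF sum_abs]) (simp add: abs_mult)
    also have "\<dots> \<le> (\<Sum>i\<in>UNIV. B i * norm h)"
      using B by (intro sum_mono mult_mono component_le_norm_cart) (auto simp: less_imp_le)
    finally show ?thesis by (simp add: sum_distrib_right)
  qed
  define E where "E h y = (\<kappa> (x - y + h) - \<kappa> (x - y) - ?D (x - y) h) / norm h" for h y
  have Ebd: "\<bar>E h y\<bar> \<le> C" for h y
  proof (cases "h = 0")
    case True
    moreover have "(\<Sum>i\<in>UNIV. B i) \<ge> 0" using B(1) by (intro sum_nonneg) (simp add: less_imp_le)
    ultimately show ?thesis using B0(1) by (simp add: E_def C_def)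
  next
    case False
    have "\<bar>\<kappa> (x - y + h) - \<kappa> (x - y) - ?D (x - y) h\<bar> \<le> C * norm h"
      using B0(2)[of "x - y" h] Dbd[of "x - y" h] by (simp add: C_def distrib_right)
    then show ?thesis using False by (simp add: E_def abs_div divide_le_eq)
  qed
  have Elim: "((\<lambda>h. E h y) \<longlongrightarrow> 0) (at 0)" for y
  proof -
    have "(\<kappa> has_derivative ?D (x - y)) (at (x - y))"
      by (rule has_derivative_partial[OF smooth_differentiable[OF test_smooth[OF \<kappa>]]])
    then have "((\<lambda>h. \<bar>E h y\<bar>) \<longlongrightarrow> 0) (at 0)" by (simp add: has_derivative_at E_def abs_div)
    then show ?thesis by (rule tendsto_rabs_zero_cancel)
  qed
  have Eint: "integrable lebesgue (\<lambda>y. E h y * f y)" "(LINT y|lebesgue. E h y * f y)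
     = (conv \<kappa> f (x + h) - conv \<kappa> f x - (\<Sum>i\<in>UNIV. conv (partial_deriv i \<kappa>) f x * h $ i)) / norm h" for h
  proof -
    have eq: "E h y * f y = (\<kappa> (x + h - y) * f y - \<kappa> (x - y) * f y - (\<Sum>i\<in>UNIV. h $ i * (partial_deriv i \<kappa> (x - y) * f y))) / norm h" for y
      by (simp add: E_def algebra_simps sum_distrib_left sum_distrib_right)
    show "integrable lebesgue (\<lambda>y. E h y * f y)"
      unfolding eq using conv_integrable[OF \<kappa> f] conv_integrable[OF test_pd f]
      by (intro Bochner_Integration.integrable_divide Bochner_Integration.integrable_diff
          Bochner_Integration.integrable_sum integrable_mult_right)
    show "(LINT y|lebesgue. E h y * f y)
       = (conv \<kappa> f (x + h) - conv \<kappa> f x - (\<Sum>i\<in>UNIV. conv (partial_deriv i \<kappa>) f x * h $ i)) / norm h"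
      unfolding eq conv_def using conv_integrable[OF \<kappa> f] conv_integrable[OF test_pd f]
      by (simp add: mult.commute)
  qed
  have "((\<lambda>h. LINT y|lebesgue. E h y * f y) \<longlongrightarrow> 0) (at 0)"
    unfolding tendsto_at_iff_sequentially
  proof (intro allI impI)
    fix X :: "nat \<Rightarrow> real ^ 'n" assume X: "\<forall>i. X i \<in> UNIV - {0}" "X \<longlonglongrightarrow> 0"
    have "(\<lambda>k. LINT y|lebesgue. E (X k) y * f y) \<longlonglongrightarrow> (LINT y|(lebesgue :: (real ^ 'n) measure). 0)"
    proof (rule integral_dominated_convergence[where f="\<lambda>_. 0" and w="\<lambda>y. C * \<bar>f y\<bar>"])
      show "integrable lebesgue (\<lambda>y. C * \<bar>f y\<bar>)" using f by simp
      show "(\<lambda>y. E (X k) y * f y) \<in> borel_measurable lebesgue" for k using Eint(1) by blast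
      show "AE y in lebesgue. (\<lambda>k. E (X k) y * f y) \<longlonglongrightarrow> 0"
      proof (rule AE_I2)
        fix y
        have "(\<lambda>k. E (X k) y) \<longlonglongrightarrow> 0"
          using Elim[of y] X unfolding tendsto_at_iff_sequentially by (auto simp: o_def)
        then show "(\<lambda>k. E (X k) y * f y) \<longlonglongrightarrow> 0" by (rule tendsto_mult_left_zero)
      qed
      show "AE y in lebesgue. norm (E (X k) y * f y) \<le> C * \<bar>f y\<bar>" for k
        using Ebd by (intro AE_I2) (simp add: abs_mult mult_right_mono)
    qed simp
    then show "((\<lambda>h. LINT y|lebesgue. E h y * f y) \<circ> X) \<longlonglongrightarrow> 0" by (simp add: o_def)
  qed
  then have lim: "((\<lambda>h. \<bar>(conv \<kappa> f (x + h) - conv \<kappa> f x - (\<Sum>i\<in>UNIV. conv (partial_deriv i \<kappa>) f x * h $ i)) / norm h\<bar>) \<longlongrightarrow> 0) (at 0)"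
    unfolding Eint(2) by (rule tendsto_rabs_zero)
  moreover have "bounded_linear (\<lambda>h. \<Sum>i\<in>UNIV. conv (partial_deriv i \<kappa>) f x * h $ i)"
    by (intro bounded_linear_sum bounded_linear_const_mult bounded_linear_vec_nth)
  ultimately show ?thesis by (simp add: has_derivative_at abs_div)
qed

lemma conv_partial_deriv:
  assumes "\<kappa> \<in> test_functions UNIV" "integrable lebesgue f"
  shows "partial_deriv i (conv \<kappa> f) x = conv (partial_deriv i \<kappa>) f x"
  by (subst partial_deriv_eqI[OF conv_has_derivative[OF assms]]) (simp add: axis_def if_distrib cong: if_cong)

lemma smooth_conv:
  assumes "\<kappa> \<in> test_functions UNIV" "integrable lebesgue f"
  shows "smooth (conv \<kappa> f)"
proof (rule smooth_coinduct[where P="\<lambda>\<phi>. \<exists>\<kappa>\<in>test_functions UNIV. \<phi> = conv \<kappa> f"])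
  show "\<phi> differentiable at x" if "\<exists>\<kappa>\<in>test_functions UNIV. \<phi> = conv \<kappa> f" for \<phi> x
  proof -
    from that obtain \<kappa> where \<kappa>: "\<kappa> \<in> test_functions UNIV" "\<phi> = conv \<kappa> f" by blast
    show ?thesis unfolding \<kappa>(2) differentiable_def
      by (rule exI) (rule conv_has_derivative[OF \<kappa>(1) assms(2)])
  qed
  show "\<exists>\<kappa>\<in>test_functions UNIV. partial_deriv i \<phi> = conv \<kappa> f" if "\<exists>\<kappa>\<in>test_functions UNIV. \<phi> = conv \<kappa> f" for \<phi> i
  proof -
    from that obtain \<kappa> where \<kappa>: "\<kappa> \<in> test_functions UNIV" "\<phi> = conv \<kappa> f" by blast
    have "partial_deriv i \<phi> = conv (partial_deriv i \<kappa>) f"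
      unfolding \<kappa>(2) by (rule ext) (rule conv_partial_deriv[OF \<kappa>(1) assms(2)])
    then show ?thesis using test_partial[OF \<kappa>(1)] by blast
  qed
qed (use assms(1) in blast)


lemma lborel_distr_reflect: "distr lborel borel (\<lambda>z. x - z) = (lborel :: (real ^ 'n) measure)"
  using lborel_affine[of "-1" x] by (simp add: density_1)

lemma lborel_integral_reflect:
  fixes f :: "real ^ 'n \<Rightarrow> real"
  assumes [measurable]: "f \<in> borel_measurable borel"
  shows "(LINT z|lborel. f (x - z)) = (LINT y|lborel. f y)"
    "integrable lborel (\<lambda>z. f (x - z)) \<longleftrightarrow> integrable lborel f"
proof -
  have "(LINT y|lborel. f y) = (LINT y|distr lborel borel (\<lambda>z. x - z). f y)" by (simp only: lborel_distr_reflect)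
  also have "\<dots> = (LINT z|lborel. f (x - z))" by (intro integral_distr) auto
  finally show "(LINT z|lborel. f (x - z)) = (LINT y|lborel. f y)" ..
  have "integrable lborel f \<longleftrightarrow> integrable (distr lborel borel (\<lambda>z. x - z)) f" by (simp only: lborel_distr_reflect)
  also have "\<dots> \<longleftrightarrow> integrable lborel (\<lambda>z. f (x - z))" by (intro integrable_distr_eq) auto
  finally show "integrable lborel (\<lambda>z. f (x - z)) \<longleftrightarrow> integrable lborel f" ..
qed

text \<open>By Jensen's inequality the error is at most the average, with weight \<open>\<kappa>\<close>, of the translation errors.\<close>

lemma conv_approx:
  fixes f :: "real ^ 'n \<Rightarrow> real"
  assumes p: "p > 1" and f: "integrable lebesgue f"
    and fin: "(\<integral>\<^sup>+x. ennreal (\<bar>f x\<bar> powr p) \<partial>lebesgue) < \<infinity>"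
    and \<rho>: "\<And>x. x \<notin> cube 0 \<rho> \<Longrightarrow> f x = 0" and \<delta>: "\<delta> > 0"
  obtains \<epsilon> where "\<epsilon> > 0"
    "\<forall>\<kappa>\<in>test_functions UNIV. (\<forall>x. \<kappa> x \<ge> 0) \<and> (LINT x|lborel. \<kappa> x) = 1 \<and> (\<forall>x. x \<notin> cube 0 \<epsilon> \<longrightarrow> \<kappa> x = 0)
      \<longrightarrow> (\<integral>\<^sup>+x. ennreal (\<bar>f x - conv \<kappa> f x\<bar> powr p) \<partial>lebesgue) \<le> ennreal \<delta>"
proof -
  obtain f1 where f1[measurable]: "f1 \<in> borel_measurable lborel" and f1eq: "AE x in lborel. f x = f1 x"
    using completion_ex_borel_measurable_real[OF borel_measurable_integrable[OF f]] by blast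
  define f0 where "f0 x = indicator (cube 0 \<rho>) x * f1 x" for x
  have f0[measurable]: "f0 \<in> borel_measurable borel" using f1 unfolding f0_def by measurable
  have ae: "AE x in lborel. f x = f0 x"
    using f1eq by eventually_elim (use \<rho> in \<open>auto simp: f0_def indicator_def\<close>)
  have ae': "AE x in lebesgue. f x = f0 x" by (rule AE_completion[OF ae])
  have off: "f0 x = 0" if "x \<notin> cube 0 \<rho>" for x using that by (simp add: f0_def)
  have nn0: "(\<integral>\<^sup>+x. ennreal (\<bar>f0 x\<bar> powr p) \<partial>lborel) = (\<integral>\<^sup>+x. ennreal (\<bar>f x\<bar> powr p) \<partial>lebesgue)"
  proof -
    have "(\<integral>\<^sup>+x. ennreal (\<bar>f0 x\<bar> powr p) \<partial>lborel) = (\<integral>\<^sup>+x. ennreal (\<bar>f0 x\<bar> powr p) \<partial>lebesgue)"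
      by (subst nn_integral_completion) auto
    also have "\<dots> = (\<integral>\<^sup>+x. ennreal (\<bar>f x\<bar> powr p) \<partial>lebesgue)"
      using ae' by (intro nn_integral_cong_AE) auto
    finally show ?thesis .
  qed
  have int0: "integrable lborel f0"
    using integrable_lebesgue_AE(1)[OF f ae'] by (simp add: integrable_completion)
  obtain \<epsilon> where \<epsilon>: "\<epsilon> > 0"
    "\<And>y. y \<in> cube 0 \<epsilon> \<Longrightarrow> (\<integral>\<^sup>+x. ennreal (\<bar>f0 (x - y) - f0 x\<bar> powr p) \<partial>lborel) \<le> ennreal \<delta>"
    by (rule translation_continuous_powr[OF p f0 _ off \<delta>]) (use fin nn0 in auto)
  show ?thesis
  proof (rule that[OF \<epsilon>(1)], intro ballI impI, elim conjE)
    fix \<kappa> :: "real ^ 'n \<Rightarrow> real"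
    assume \<kappa>1: "\<kappa> \<in> test_functions UNIV" "\<forall>x. \<kappa> x \<ge> 0" "(LINT x|lborel. \<kappa> x) = 1" "\<forall>x. x \<notin> cube 0 \<epsilon> \<longrightarrow> \<kappa> x = 0"
    note \<kappa> = \<kappa>1(1) \<kappa>1(2)[rule_format] \<kappa>1(3) \<kappa>1(4)[rule_format]
    have \<kappa>m[measurable]: "\<kappa> \<in> borel_measurable borel" by (rule test_measurable[OF \<kappa>(1)])
    have \<kappa>i: "integrable lborel \<kappa>" by (rule test_integrable_lborel[OF \<kappa>(1)])
    have cv: "conv \<kappa> f x = (LINT z|lborel. \<kappa> z * f0 (x - z))" "integrable lborel (\<lambda>z. \<kappa> z * f0 (x - z))" for x
    proof -
      have i0: "integrable lebesgue (\<lambda>y. \<kappa> (x - y) * f0 y)"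
        by (rule conv_integrable[OF \<kappa>(1) integrable_lebesgue_AE(1)[OF f ae']])
      have "conv \<kappa> f x = (LINT y|lebesgue. \<kappa> (x - y) * f0 y)" unfolding conv_def
      proof (rule integrable_lebesgue_AE(2)[OF conv_integrable[OF \<kappa>(1) f]])
        show "AE y in lebesgue. \<kappa> (x - y) * f y = \<kappa> (x - y) * f0 y" using ae' by eventually_elim simp
      qed
      also have "\<dots> = (LINT y|lborel. \<kappa> (x - y) * f0 y)" by (rule integral_completion) measurable
      also have "\<dots> = (LINT z|lborel. \<kappa> (x - (x - z)) * f0 (x - z))"
        by (rule lborel_integral_reflect(1)[symmetric]) measurable
      finally show "conv \<kappa> f x = (LINT z|lborel. \<kappa> z * f0 (x - z))" by simp
      have "integrable lborel (\<lambda>y. \<kappa> (x - y) * f0 y)" using i0 by (subst (asm) integrable_completion) auto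
      then have "integrable lborel (\<lambda>z. \<kappa> (x - (x - z)) * f0 (x - z))"
        by (subst lborel_integral_reflect(2)) auto
      then show "integrable lborel (\<lambda>z. \<kappa> z * f0 (x - z))" by simp
    qed
    have pt: "ennreal (\<bar>f0 x - conv \<kappa> f x\<bar> powr p) \<le> (\<integral>\<^sup>+z. ennreal (\<kappa> z * \<bar>f0 (x - z) - f0 x\<bar> powr p) \<partial>lborel)" for x
    proof -
      have i1: "integrable lborel (\<lambda>z. \<kappa> z * (f0 (x - z) - f0 x))"
        using cv(2)[of x] \<kappa>i by (simp add: right_diff_distrib)
      have "(LINT z|lborel. \<kappa> z * (f0 (x - z) - f0 x)) = conv \<kappa> f x - f0 x"
        using cv[of x] \<kappa>i \<kappa>(3) by (simp add: right_diff_distrib)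
      moreover have "ennreal (\<bar>LINT z|lborel. \<kappa> z * (f0 (x - z) - f0 x)\<bar> powr p)
          \<le> (\<integral>\<^sup>+z. ennreal (\<kappa> z * \<bar>f0 (x - z) - f0 x\<bar> powr p) \<partial>lborel)"
        by (rule jensen_powr[OF p _ _ \<kappa>(2) \<kappa>i \<kappa>(3) i1]) measurable
      ultimately show ?thesis by (simp add: abs_minus_commute)
    qed
    have "(\<integral>\<^sup>+x. ennreal (\<bar>f x - conv \<kappa> f x\<bar> powr p) \<partial>lebesgue) = (\<integral>\<^sup>+x. ennreal (\<bar>f0 x - conv \<kappa> f x\<bar> powr p) \<partial>lebesgue)"
      using ae' by (intro nn_integral_cong_AE) auto
    also have "\<dots> = (\<integral>\<^sup>+x. ennreal (\<bar>f0 x - conv \<kappa> f x\<bar> powr p) \<partial>lborel)"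
      using smooth_measurable[OF smooth_conv[OF \<kappa>(1) f]] by (subst nn_integral_completion) auto
    also have "\<dots> \<le> (\<integral>\<^sup>+x. (\<integral>\<^sup>+z. ennreal (\<kappa> z * \<bar>f0 (x - z) - f0 x\<bar> powr p) \<partial>lborel) \<partial>lborel)"
      by (intro nn_integral_mono pt)
    also have "\<dots> = (\<integral>\<^sup>+z. (\<integral>\<^sup>+x. ennreal (\<kappa> z * \<bar>f0 (x - z) - f0 x\<bar> powr p) \<partial>lborel) \<partial>lborel)"
      by (rule lborel_pair.Fubini'[symmetric]) measurable
    also have "\<dots> = (\<integral>\<^sup>+z. ennreal (\<kappa> z) * (\<integral>\<^sup>+x. ennreal (\<bar>f0 (x - z) - f0 x\<bar> powr p) \<partial>lborel) \<partial>lborel)"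
      using \<kappa>(2) by (simp add: ennreal_mult nn_integral_cmult)
    also have "\<dots> \<le> (\<integral>\<^sup>+z. ennreal (\<kappa> z) * ennreal \<delta> \<partial>lborel)"
    proof (rule nn_integral_mono)
      fix z
      show "ennreal (\<kappa> z) * (\<integral>\<^sup>+x. ennreal (\<bar>f0 (x - z) - f0 x\<bar> powr p) \<partial>lborel) \<le> ennreal (\<kappa> z) * ennreal \<delta>"
        using \<epsilon>(2)[of z] \<kappa>(4)[of z] by (cases "z \<in> cube 0 \<epsilon>") (auto intro: mult_left_mono)
    qed
    also have "\<dots> = (\<integral>\<^sup>+z. ennreal (\<kappa> z) \<partial>lborel) * ennreal \<delta>" by (rule nn_integral_multc) measurable
    also have "(\<integral>\<^sup>+z. ennreal (\<kappa> z) \<partial>lborel) = 1"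
      using \<kappa>i \<kappa>(2,3) by (subst nn_integral_eq_integral) auto
    finally show "(\<integral>\<^sup>+x. ennreal (\<bar>f x - conv \<kappa> f x\<bar> powr p) \<partial>lebesgue) \<le> ennreal \<delta>" by simp
  qed
qed

lemma mollifier_exists:
  assumes "\<epsilon> > 0"
  obtains \<kappa> :: "real ^ 'n \<Rightarrow> real" where "\<kappa> \<in> test_functions UNIV" "\<And>x. \<kappa> x \<ge> 0" "(LINT x|lborel. \<kappa> x) = 1"
    "\<And>x. x \<notin> cube 0 \<epsilon> \<Longrightarrow> \<kappa> x = 0"
proof -
  obtain \<eta> :: "real ^ 'n \<Rightarrow> real" where \<eta>: "smooth \<eta>" "\<And>x. 0 \<le> \<eta> x \<and> \<eta> x \<le> 1"
    "\<And>x. x \<in> cube 0 (\<epsilon> / 2) \<Longrightarrow> \<eta> x = 1" "\<And>x. x \<notin> cube 0 \<epsilon> \<Longrightarrow> \<eta> x = 0"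
    using cutoff_bare[of "\<epsilon> / 2" \<epsilon> "0 :: real ^ 'n"] assms by auto
  have test: "\<eta> \<in> test_functions UNIV" by (rule test_functionI[OF \<eta>(1) compact_cube _ \<eta>(4)]) auto
  have int: "integrable lborel \<eta>" by (rule test_integrable_lborel[OF test])
  have fm: "emeasure lborel (cube (0 :: real ^ 'n) (\<epsilon> / 2)) < \<infinity>"
    by (intro emeasure_bounded_finite compact_imp_bounded compact_cube)
  have "0 < (2 * (\<epsilon> / 2)) ^ CARD('n)" using assms by simp
  also have "\<dots> = measure lebesgue (cube (0 :: real ^ 'n) (\<epsilon> / 2))"
    using assms by (intro measure_cube[symmetric]) simp
  also have "\<dots> = (LINT x|lborel. indicator (cube (0 :: real ^ 'n) (\<epsilon> / 2)) x)"
    by (simp add: measure_completion)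
  also have "\<dots> \<le> (LINT x|lborel. \<eta> x)"
    using fm \<eta>(2,3) by (intro integral_mono int integrable_real_indicator) (auto simp: indicator_def)
  finally have pos: "(LINT x|lborel. \<eta> x) > 0" .
  show ?thesis
  proof (rule that[of "\<lambda>x. \<eta> x * (1 / (LINT x|lborel. \<eta> x))"])
    show "(\<lambda>x. \<eta> x * (1 / (LINT x|lborel. \<eta> x))) \<in> test_functions UNIV"
      by (rule test_mult[OF test smooth_const])
    show "(LINT x|lborel. \<eta> x * (1 / (LINT x|lborel. \<eta> x))) = 1" using pos by simp
  qed (use \<eta> pos in auto)
qed

lemma test_reflect:
  fixes \<kappa> :: "real ^ 'n \<Rightarrow> real"
  assumes \<kappa>: "\<kappa> \<in> test_functions UNIV"
  shows "(\<lambda>y. \<kappa> (x - y)) \<in> test_functions UNIV" "partial_deriv i (\<lambda>y. \<kappa> (x - y)) y = - partial_deriv i \<kappa> (x - y)"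
proof -
  have der: "((\<lambda>y. c * \<kappa> (x - y)) has_derivative (\<lambda>h. c * (\<Sum>i\<in>UNIV. partial_deriv i \<kappa> (x - y) * (- h) $ i))) (at y)"
    if "smooth \<kappa>" for \<kappa> :: "real ^ 'n \<Rightarrow> real" and y c
  proof -
    have "((\<lambda>y. x - y) has_derivative (\<lambda>h. - h)) (at y)" by (auto intro!: derivative_eq_intros)
    from has_derivative_compose[where g=\<kappa>, OF this has_derivative_partial[OF smooth_differentiable[OF that]]]
    show ?thesis by (rule has_derivative_mult_right)
  qed
  have pd: "partial_deriv i (\<lambda>y. c * \<kappa> (x - y)) = (\<lambda>y. (- c) * partial_deriv i \<kappa> (x - y))"
    if "smooth \<kappa>" for \<kappa> :: "real ^ 'n \<Rightarrow> real" and c i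
    by (rule ext, subst partial_deriv_eqI[OF der[OF that]])
      (simp add: axis_def if_distrib sum_negf cong: if_cong)
  show "partial_deriv i (\<lambda>y. \<kappa> (x - y)) y = - partial_deriv i \<kappa> (x - y)"
    using fun_cong[OF pd[OF test_smooth[OF \<kappa>], of i 1], of y] by simp
  have "smooth (\<lambda>y. 1 * \<kappa> (x - y))"
  proof (rule smooth_coinduct[where P="\<lambda>\<phi>. \<exists>\<kappa> c. smooth \<kappa> \<and> \<phi> = (\<lambda>y. c * \<kappa> (x - y))"])
    show "\<exists>\<kappa>' c. smooth \<kappa>' \<and> (\<lambda>y. 1 * \<kappa> (x - y)) = (\<lambda>y. c * \<kappa>' (x - y))"
      using test_smooth[OF \<kappa>] by blast
    show "\<phi> differentiable at y" if "\<exists>\<kappa> c. smooth \<kappa> \<and> \<phi> = (\<lambda>y. c * \<kappa> (x - y))" for \<phi> y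
    proof -
      from that obtain \<kappa> c where *: "smooth \<kappa>" "\<phi> = (\<lambda>y. c * \<kappa> (x - y))" by blast
      show ?thesis unfolding *(2) differentiable_def by (rule exI) (rule der[OF *(1)])
    qed
    show "\<exists>\<kappa> c. smooth \<kappa> \<and> partial_deriv i \<phi> = (\<lambda>y. c * \<kappa> (x - y))"
      if "\<exists>\<kappa> c. smooth \<kappa> \<and> \<phi> = (\<lambda>y. c * \<kappa> (x - y))" for \<phi> i
    proof -
      from that obtain \<kappa> c where *: "smooth \<kappa>" "\<phi> = (\<lambda>y. c * \<kappa> (x - y))" by blast
      show ?thesis unfolding *(2) pd[OF *(1)] using smooth_partial[OF *(1)] by blast
    qed
  qed
  then have sm: "smooth (\<lambda>y. \<kappa> (x - y))" by simp
  show "(\<lambda>y. \<kappa> (x - y)) \<in> test_functions UNIV"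
  proof (rule test_functionI[OF sm, of "(\<lambda>z. x - z) ` supp UNIV \<kappa>"])
    show "compact ((\<lambda>z. x - z) ` supp UNIV \<kappa>)"
      using \<kappa> by (intro compact_continuous_image) (auto simp: test_functions_iff intro!: continuous_intros)
    show "\<kappa> (x - y) = 0" if "y \<notin> (\<lambda>z. x - z) ` supp UNIV \<kappa>" for y
    proof (rule supp_zero, rule notI)
      assume "x - y \<in> supp UNIV \<kappa>"
      then have "y \<in> (\<lambda>z. x - z) ` supp UNIV \<kappa>" by (intro image_eqI[of _ _ "x - y"]) auto
      with that show False by simp
    qed
  qed simp
qed

lemma grad_conv:
  assumes wg: "is_weak_gradient UNIV v G" and v: "integrable lebesgue v" and \<kappa>: "\<kappa> \<in> test_functions UNIV"
  shows "grad (conv \<kappa> v) x $ i = conv \<kappa> (\<lambda>y. G y $ i) x"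
proof -
  have "(LINT y|lebesgue. v y * partial_deriv i (\<lambda>y. \<kappa> (x - y)) y) = - (LINT y|lebesgue. G y $ i * \<kappa> (x - y))"
    using wg test_reflect(1)[OF \<kappa>, of x] by (simp add: is_weak_gradient_iff)
  then have "(LINT y|lebesgue. v y * partial_deriv i \<kappa> (x - y)) = (LINT y|lebesgue. G y $ i * \<kappa> (x - y))"
    by (simp add: test_reflect(2)[OF \<kappa>])
  then show ?thesis by (simp add: conv_partial_deriv[OF \<kappa> v] conv_def mult.commute)
qed

proposition test_functions_dense:
  fixes v :: "real ^ 'n \<Rightarrow> real" and G :: "real ^ 'n \<Rightarrow> real ^ 'n"
  assumes p: "p > 1" and wg: "is_weak_gradient UNIV v G" and K: "compact K" "K \<subseteq> U" and U: "open U"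
    and off: "\<And>x. x \<notin> K \<Longrightarrow> v x = 0" "\<And>x. x \<notin> K \<Longrightarrow> G x = 0"
    and fin: "(\<integral>\<^sup>+x. ennreal (\<bar>v x\<bar> powr p) \<partial>lebesgue) < \<infinity>"
      "(\<integral>\<^sup>+x. ennreal (norm (G x) powr p) \<partial>lebesgue) < \<infinity>"
    and \<delta>: "\<delta> > 0"
  shows "\<exists>\<phi>\<in>test_functions U. (\<integral>\<^sup>+x. ennreal (\<bar>v x - \<phi> x\<bar> powr p) \<partial>lebesgue) \<le> ennreal \<delta> \<and>
     (\<integral>\<^sup>+x. ennreal (norm (G x - grad \<phi> x) powr p) \<partial>lebesgue) \<le> ennreal \<delta>"
proof -
  let ?n = "real CARD('n)"
  define \<delta>' where "\<delta>' = \<delta> / (?n powr p * ?n)"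
  have \<delta>': "\<delta>' > 0" using \<delta> by (simp add: \<delta>'_def)
  have li: "locally_integrable UNIV v" "locally_integrable UNIV G" using wg by (auto simp: is_weak_gradient_def)
  have indK: "(\<lambda>x. indicator K x *\<^sub>R v x) = v" "(\<lambda>x. indicator K x *\<^sub>R G x) = G"
    using off by (auto simp: fun_eq_iff indicator_def)
  have int: "integrable lebesgue v" "integrable lebesgue G"
    using locally_integrableD[OF li(1) K(1)] locally_integrableD[OF li(2) K(1)] unfolding indK by auto
  have intG: "integrable lebesgue (\<lambda>x. G x $ i)" for i
    using int(2) by (rule integrable_bounded_linear[OF bounded_linear_vec_nth])
  obtain \<rho> where \<rho>: "\<And>x. x \<in> K \<Longrightarrow> norm x \<le> \<rho>" using compact_imp_bounded[OF K(1)] by (auto simp: bounded_iff)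
  have K\<rho>: "K \<subseteq> cube 0 \<rho>"
    using order_trans[OF component_le_norm_cart \<rho>] by (auto simp: cube_def)
  obtain e where e: "e > 0" "(\<Union>x\<in>K. ball x e) \<subseteq> U"
    using compact_subset_open_imp_ball_epsilon_subset[OF K(1) U K(2)] .
  have offv: "v x = 0" "G x $ i = 0" if "x \<notin> cube 0 \<rho>" for x i
  proof -
    have "x \<notin> K" using that K\<rho> by blast
    then show "v x = 0" "G x $ i = 0" by (simp_all add: off)
  qed
  have finG: "(\<integral>\<^sup>+x. ennreal (\<bar>G x $ i\<bar> powr p) \<partial>lebesgue) < \<infinity>" for i
  proof -
    have "(\<integral>\<^sup>+x. ennreal (\<bar>G x $ i\<bar> powr p) \<partial>lebesgue) \<le> (\<integral>\<^sup>+x. ennreal (norm (G x) powr p) \<partial>lebesgue)"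
      using p by (intro nn_integral_mono ennreal_leI powr_mono2 component_le_norm_cart) auto
    then show ?thesis using fin(2) by (rule order.strict_trans1)
  qed
  define good where "good f \<epsilon> \<longleftrightarrow> \<epsilon> > 0 \<and> (\<forall>\<kappa>\<in>test_functions UNIV. (\<forall>x. \<kappa> x \<ge> 0) \<and> (LINT x|lborel. \<kappa> x) = 1 \<and>
      (\<forall>x. x \<notin> cube 0 \<epsilon> \<longrightarrow> \<kappa> x = 0) \<longrightarrow>
      (\<integral>\<^sup>+x. ennreal (\<bar>f x - conv \<kappa> f x\<bar> powr p) \<partial>lebesgue) \<le> ennreal (min \<delta> \<delta>'))" for f :: "real ^ 'n \<Rightarrow> real" and \<epsilon>
  have good: "\<exists>\<epsilon>. good f \<epsilon>" if h: "integrable lebesgue f" "(\<integral>\<^sup>+x. ennreal (\<bar>f x\<bar> powr p) \<partial>lebesgue) < \<infinity>"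
    "\<And>x. x \<notin> cube 0 \<rho> \<Longrightarrow> f x = 0" for f
  proof -
    have m: "min \<delta> \<delta>' > 0" using \<delta> \<delta>' by simp
    show ?thesis unfolding good_def
      by (rule conv_approx[OF p h(1,2), where \<rho>=\<rho> and \<delta>="min \<delta> \<delta>'"]) (erule h(3), rule m, intro exI conjI)
  qed
  then obtain \<epsilon>0 where \<epsilon>0: "good v \<epsilon>0" using good[OF int(1) fin(1) offv(1)] by blast
  have "\<exists>\<epsilon>. good (\<lambda>x. G x $ i) \<epsilon>" for i
    by (rule good[OF intG finG offv(2)])
  then obtain \<epsilon>i where \<epsilon>i: "\<And>i. good (\<lambda>x. G x $ i) (\<epsilon>i i)" by metis
  define \<epsilon> where "\<epsilon> = Min (insert \<epsilon>0 (insert (e / (2 * ?n)) (range \<epsilon>i)))"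
  have \<epsilon>: "\<epsilon> > 0" "\<epsilon> \<le> \<epsilon>0" "\<epsilon> \<le> e / (2 * ?n)" "\<epsilon> \<le> \<epsilon>i i" for i
  proof -
    have pos: "\<epsilon>0 > 0" "\<epsilon>i i > 0" "e / (2 * ?n) > 0" for i
      using \<epsilon>0 \<epsilon>i[of i] e(1) by (simp_all add: good_def)
    show "\<epsilon> > 0" unfolding \<epsilon>_def using pos by (subst Min_gr_iff) auto
    show "\<epsilon> \<le> \<epsilon>0" "\<epsilon> \<le> e / (2 * ?n)" "\<epsilon> \<le> \<epsilon>i i" unfolding \<epsilon>_def by (simp_all only: Min_le finite_insert finite_imageI finite insertI1 insertI2 rangeI)
  qed
  obtain \<kappa> :: "real ^ 'n \<Rightarrow> real" where \<kappa>: "\<kappa> \<in> test_functions UNIV" "\<And>x. \<kappa> x \<ge> 0" "(LINT x|lborel. \<kappa> x) = 1"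
    "\<And>x. x \<notin> cube 0 \<epsilon> \<Longrightarrow> \<kappa> x = 0" by (rule mollifier_exists[OF \<epsilon>(1)]) (blast intro: that)
  have ap: "(\<integral>\<^sup>+x. ennreal (\<bar>f x - conv \<kappa> f x\<bar> powr p) \<partial>lebesgue) \<le> ennreal (min \<delta> \<delta>')"
    if "good f \<epsilon>'" "\<epsilon> \<le> \<epsilon>'" for f \<epsilon>'
  proof -
    have "\<kappa> x = 0" if "x \<notin> cube 0 \<epsilon>'" for x
      using \<kappa>(4)[of x] that cube_mono[OF \<open>\<epsilon> \<le> \<epsilon>'\<close>, of 0] by blast
    then show ?thesis using that(1) \<kappa>(1-3) unfolding good_def by blast
  qed
  define \<phi> where "\<phi> = conv \<kappa> v"
  show ?thesis
  proof (rule bexI[of _ \<phi>], rule conjI)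
    define K2 where "K2 = (\<lambda>(x, y). x + y) ` (K \<times> cube (0 :: real ^ 'n) \<epsilon>)"
    show "\<phi> \<in> test_functions U"
    proof (rule test_functionI[of _ K2])
      show "smooth \<phi>" unfolding \<phi>_def by (rule smooth_conv[OF \<kappa>(1) int(1)])
      show "compact K2" unfolding K2_def
        by (intro compact_continuous_image compact_Times K(1) compact_cube)
          (auto simp: case_prod_unfold intro!: continuous_intros)
      show "K2 \<subseteq> U"
      proof
        fix z assume "z \<in> K2"
        then obtain x y where xy: "z = x + y" "x \<in> K" "y \<in> cube 0 \<epsilon>" by (auto simp: K2_def)
        have "norm y \<le> ?n * \<epsilon>" using cube_subset_ball[of 0 \<epsilon>] xy(3) by auto
        also have "\<dots> \<le> ?n * (e / (2 * ?n))" using \<epsilon>(3) by (intro mult_left_mono) auto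
        also have "\<dots> < e" using e(1) by simp
        finally have "z \<in> ball x e" by (simp add: xy(1) dist_norm)
        then show "z \<in> U" using e(2) xy(2) by blast
      qed
      show "\<phi> x = 0" if "x \<notin> K2" for x
      proof -
        have z: "\<kappa> (x - y) * v y = 0" for y
        proof (cases "y \<in> K")
          case True
          have "x - y \<notin> cube 0 \<epsilon>"
          proof
            assume "x - y \<in> cube 0 \<epsilon>"
            then have "x \<in> K2" unfolding K2_def using True by (intro image_eqI[of _ _ "(y, x - y)"]) auto
            with that show False by simp
          qed
          then show ?thesis by (simp add: \<kappa>(4))
        qed (simp add: off)
        show ?thesis unfolding \<phi>_def conv_def z by simp
      qed
    qed
    show "(\<integral>\<^sup>+x. ennreal (\<bar>v x - \<phi> x\<bar> powr p) \<partial>lebesgue) \<le> ennreal \<delta>"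
      unfolding \<phi>_def using ap[OF \<epsilon>0 \<epsilon>(2)] by (rule order_trans) (auto intro: ennreal_leI)
    have m: "(\<lambda>x. \<bar>G x $ i - conv \<kappa> (\<lambda>y. G y $ i) x\<bar> powr p) \<in> borel_measurable lebesgue" for i
    proof -
      have [measurable]: "(\<lambda>x. G x $ i) \<in> borel_measurable lebesgue" "conv \<kappa> (\<lambda>y. G y $ i) \<in> borel_measurable lebesgue"
        using borel_measurable_integrable[OF intG] smooth_lebesgue[OF smooth_conv[OF \<kappa>(1) intG]] by auto
      show ?thesis by measurable
    qed
    have "(\<integral>\<^sup>+x. ennreal (norm (G x - grad \<phi> x) powr p) \<partial>lebesgue)
        \<le> (\<integral>\<^sup>+x. ennreal (?n powr p) * (\<Sum>i\<in>UNIV. ennreal (\<bar>G x $ i - conv \<kappa> (\<lambda>y. G y $ i) x\<bar> powr p)) \<partial>lebesgue)"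
    proof (rule nn_integral_mono)
      fix x
      have "norm (G x - grad \<phi> x) powr p \<le> ?n powr p * (\<Sum>i\<in>UNIV. \<bar>(G x - grad \<phi> x) $ i\<bar> powr p)"
        using p by (intro norm_powr_le) auto
      then have "ennreal (norm (G x - grad \<phi> x) powr p) \<le> ennreal (?n powr p * (\<Sum>i\<in>UNIV. \<bar>(G x - grad \<phi> x) $ i\<bar> powr p))"
        by (rule ennreal_leI)
      also have "\<dots> = ennreal (?n powr p) * (\<Sum>i\<in>UNIV. ennreal (\<bar>(G x - grad \<phi> x) $ i\<bar> powr p))"
        by (subst sum_ennreal) (auto simp: ennreal_mult sum_nonneg)
      finally show "ennreal (norm (G x - grad \<phi> x) powr p)
          \<le> ennreal (?n powr p) * (\<Sum>i\<in>UNIV. ennreal (\<bar>G x $ i - conv \<kappa> (\<lambda>y. G y $ i) x\<bar> powr p))"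
        unfolding vector_minus_component \<phi>_def grad_conv[OF wg int(1) \<kappa>(1)] .
    qed
    also have "\<dots> = ennreal (?n powr p) * (\<Sum>i\<in>UNIV. \<integral>\<^sup>+x. ennreal (\<bar>G x $ i - conv \<kappa> (\<lambda>y. G y $ i) x\<bar> powr p) \<partial>lebesgue)"
    proof -
      let ?u = "\<lambda>i x. ennreal (\<bar>G x $ i - conv \<kappa> (\<lambda>y. G y $ i) x\<bar> powr p)"
      have u: "?u i \<in> borel_measurable lebesgue" for i
        by (rule measurable_compose[OF m measurable_ennreal])
      have "(\<integral>\<^sup>+x. ennreal (?n powr p) * (\<Sum>i\<in>UNIV. ?u i x) \<partial>lebesgue) = ennreal (?n powr p) * (\<integral>\<^sup>+x. (\<Sum>i\<in>UNIV. ?u i x) \<partial>lebesgue)"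
        using u by (intro nn_integral_cmult borel_measurable_sum)
      also have "(\<integral>\<^sup>+x. (\<Sum>i\<in>UNIV. ?u i x) \<partial>lebesgue) = (\<Sum>i\<in>UNIV. \<integral>\<^sup>+x. ?u i x \<partial>lebesgue)"
        using u by (intro nn_integral_sum)
      finally show ?thesis .
    qed
    also have "\<dots> \<le> ennreal (?n powr p) * (\<Sum>i\<in>(UNIV :: 'n set). ennreal \<delta>')"
      by (intro mult_left_mono sum_mono order_trans[OF ap[OF \<epsilon>i \<epsilon>(4)]] ennreal_leI) auto
    also have "\<dots> = ennreal (?n powr p * (\<Sum>i\<in>(UNIV :: 'n set). \<delta>'))"
      using \<delta>' by (subst sum_ennreal) (auto simp: ennreal_mult sum_nonneg)
    also have "\<dots> = ennreal \<delta>" by (simp add: \<delta>'_def)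
    finally show "(\<integral>\<^sup>+x. ennreal (norm (G x - grad \<phi> x) powr p) \<partial>lebesgue) \<le> ennreal \<delta>" .
  qed
qed

subsection \<open>Weighted power modulars\<close>

lemma AE_lebesgue_on_iff: "U \<in> sets lebesgue \<Longrightarrow> (AE x in lebesgue_on U. P x) \<longleftrightarrow> (AE x in lebesgue. x \<in> U \<longrightarrow> P x)"
  by (rule AE_restrict_space_iff) simp

lemma lebesgue_on_measurable_AE:
  fixes f g :: "real ^ 'n \<Rightarrow> 'b::euclidean_space"
  assumes U: "U \<in> sets lebesgue" and f: "f \<in> borel_measurable (lebesgue_on U)" and ae: "AE x in lebesgue. x \<in> U \<longrightarrow> f x = g x"
  shows "g \<in> borel_measurable (lebesgue_on U)"
proof -
  have "(\<lambda>x. indicator U x *\<^sub>R f x) \<in> borel_measurable lebesgue"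
    using f U by (subst (asm) borel_measurable_restrict_space_iff) auto
  moreover have "AE x in lebesgue. indicator U x *\<^sub>R f x = indicator U x *\<^sub>R g x"
    using ae by eventually_elim (auto simp: indicator_def)
  ultimately have "(\<lambda>x. indicator U x *\<^sub>R g x) \<in> borel_measurable lebesgue" by (rule borel_measurable_AE)
  then show ?thesis using U by (subst borel_measurable_restrict_space_iff) auto
qed

lemma locally_integrable_measurable:
  fixes g :: "real ^ 'n \<Rightarrow> 'b::{banach, second_countable_topology}"
  assumes g: "locally_integrable U g" and U: "open U"
  shows "g \<in> borel_measurable (lebesgue_on U)"
proof -
  obtain C :: "nat \<Rightarrow> (real ^ 'n) set" where C: "\<And>n. compact (C n)" "\<And>n. C n \<subseteq> U" "\<And>n. C n \<subseteq> interior (C (Suc n))"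
    "\<Union>(range C) = U" "\<And>K. \<lbrakk>compact K; K \<subseteq> U\<rbrakk> \<Longrightarrow> \<exists>N. \<forall>n\<ge>N. K \<subseteq> C n"
    by (rule open_Union_compact_subsets[OF U]) (rule that)
  have "(\<lambda>x. indicator U x *\<^sub>R g x) \<in> borel_measurable lebesgue"
  proof (rule borel_measurable_LIMSEQ_metric)
    show "(\<lambda>x. indicator (C n) x *\<^sub>R g x) \<in> borel_measurable lebesgue" for n
      by (rule borel_measurable_integrable[OF locally_integrableD[OF g C(1,2)]])
    show "(\<lambda>n. indicator (C n) x *\<^sub>R g x) \<longlonglongrightarrow> indicator U x *\<^sub>R g x" for x
    proof (cases "x \<in> U")
      case True
      then obtain N where "\<forall>n\<ge>N. {x} \<subseteq> C n" using C(5)[of "{x}"] by auto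
      then have "\<forall>\<^sub>F n in sequentially. g x = indicator (C n) x *\<^sub>R g x"
        unfolding eventually_sequentially by (intro exI[of _ N]) simp
      then show ?thesis using True by (auto intro: Lim_transform_eventually[OF tendsto_const])
    next
      case False
      then have "x \<notin> C n" for n using C(2)[of n] by blast
      then show ?thesis using False by simp
    qed
  qed
  then show ?thesis using U by (subst borel_measurable_restrict_space_iff) auto
qed

lemma weak_gradient_spec: "\<exists>g. is_weak_gradient U u g \<Longrightarrow> is_weak_gradient U u (weak_gradient U u)"
  unfolding weak_gradient_def by (erule someI_ex)

locale power_weight =
  fixes \<Omega> :: "(real ^ 'n) set" and A :: "real ^ 'n \<Rightarrow> real \<Rightarrow> real" and w :: "real ^ 'n \<Rightarrow> real" and p m M :: real
  assumes open_\<Omega>: "open \<Omega>" and bounded_\<Omega>: "bounded \<Omega>" and p1: "p > 1" and m0: "m > 0"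
    and w_meas: "w \<in> borel_measurable lebesgue" and w_bounds: "\<And>x. m \<le> w x \<and> w x \<le> M"
    and A_eq: "AE x in lebesgue. x \<in> \<Omega> \<longrightarrow> (\<forall>t. A x t = w x * \<bar>t\<bar> powr p)"
begin

definition J :: "(real ^ 'n) set \<Rightarrow> (real ^ 'n \<Rightarrow> real) \<Rightarrow> ennreal" where
  "J U v = (\<integral>\<^sup>+x. ennreal (\<bar>v x\<bar> powr p) \<partial>lebesgue_on U)"

lemma M0: "M > 0" using w_bounds[of undefined] m0 by linarith

lemma w_nonneg: "w x \<ge> 0" using w_bounds[of x] m0 by linarith

lemma w_on[measurable]: "w \<in> borel_measurable (lebesgue_on U)"
  using w_meas by (rule measurable_restrict_space1)

lemma modular_eq:
  assumes U: "U \<in> sets lebesgue" "U \<subseteq> \<Omega>"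
  shows "modular A U v = (\<integral>\<^sup>+x. ennreal (w x * \<bar>v x\<bar> powr p) \<partial>lebesgue_on U)"
  unfolding modular_def
proof (rule nn_integral_cong_AE)
  have "AE x in lebesgue. x \<in> U \<longrightarrow> ennreal (A x (v x)) = ennreal (w x * \<bar>v x\<bar> powr p)"
    using A_eq by eventually_elim (use U in auto)
  then show "AE x in lebesgue_on U. ennreal (A x (v x)) = ennreal (w x * \<bar>v x\<bar> powr p)"
    using U by (simp add: AE_lebesgue_on_iff)
qed

lemma modular_le:
  assumes U: "U \<in> sets lebesgue" "U \<subseteq> \<Omega>" and [measurable]: "v \<in> borel_measurable (lebesgue_on U)"
  shows "modular A U v \<le> ennreal M * J U v"
proof -
  have "modular A U v \<le> (\<integral>\<^sup>+x. ennreal M * ennreal (\<bar>v x\<bar> powr p) \<partial>lebesgue_on U)"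
    unfolding modular_eq[OF U] using w_bounds M0
    by (intro nn_integral_mono) (auto simp: ennreal_mult[symmetric] intro!: ennreal_leI mult_right_mono)
  then show ?thesis unfolding J_def by (subst nn_integral_cmult[symmetric]) measurable
qed

lemma modular_ge:
  assumes U: "U \<in> sets lebesgue" "U \<subseteq> \<Omega>" and [measurable]: "v \<in> borel_measurable (lebesgue_on U)"
  shows "ennreal m * J U v \<le> modular A U v"
proof -
  have "(\<integral>\<^sup>+x. ennreal m * ennreal (\<bar>v x\<bar> powr p) \<partial>lebesgue_on U) \<le> modular A U v"
    unfolding modular_eq[OF U] using w_bounds m0
    by (intro nn_integral_mono) (auto simp: ennreal_mult[symmetric] intro!: ennreal_leI mult_right_mono)
  then show ?thesis unfolding J_def by (subst nn_integral_cmult[symmetric]) measurable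
qed

lemma J_cmult:
  assumes [measurable]: "v \<in> borel_measurable (lebesgue_on U)"
  shows "J U (\<lambda>x. \<bar>v x\<bar> / l) = ennreal ((1 / \<bar>l\<bar>) powr p) * J U v"
proof -
  have "\<bar>\<bar>v x\<bar> / l\<bar> powr p = (1 / \<bar>l\<bar>) powr p * \<bar>v x\<bar> powr p" for x
    by (subst powr_mult[symmetric]) simp
  then show ?thesis unfolding J_def by (simp add: ennreal_mult nn_integral_cmult)
qed

lemma LA_iff:
  assumes U: "U \<in> sets lebesgue" "U \<subseteq> \<Omega>"
  shows "u \<in> LA A U \<longleftrightarrow> u \<in> borel_measurable (lebesgue_on U) \<and> J U u < \<infinity>"
proof (intro iffI conjI)
  assume u: "u \<in> LA A U"
  then show um[measurable]: "u \<in> borel_measurable (lebesgue_on U)" by (simp add: LA_def)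
  obtain l where l: "l > 0" "modular A U (\<lambda>x. \<bar>u x\<bar> / l) < \<infinity>" using u by (auto simp: LA_def)
  have "ennreal m * J U (\<lambda>x. \<bar>u x\<bar> / l) < \<infinity>"
    by (rule order.strict_trans1[OF modular_ge[OF U] l(2)]) measurable
  then have "J U (\<lambda>x. \<bar>u x\<bar> / l) < \<infinity>"
    using m0 by (auto simp: ennreal_mult_less_top)
  then show "J U u < \<infinity>" using l(1) unfolding J_cmult[OF um] by (auto simp: ennreal_mult_less_top)
next
  assume u: "u \<in> borel_measurable (lebesgue_on U) \<and> J U u < \<infinity>"
  then have [measurable]: "u \<in> borel_measurable (lebesgue_on U)" by simp
  have "modular A U (\<lambda>x. \<bar>u x\<bar> / 1) \<le> ennreal M * J U (\<lambda>x. \<bar>u x\<bar> / 1)"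
    by (rule modular_le[OF U]) measurable
  also have "J U (\<lambda>x. \<bar>u x\<bar> / 1) = J U u" by (simp add: J_def)
  also have "ennreal M * J U u < \<infinity>" using u by (auto simp: ennreal_mult_less_top)
  finally show "u \<in> LA A U" using u by (auto simp: LA_def intro!: exI[of _ 1])
qed

lemma J_cong_AE:
  assumes "U \<in> sets lebesgue" "AE x in lebesgue. x \<in> U \<longrightarrow> u x = v x"
  shows "J U u = J U v"
  unfolding J_def
proof (rule nn_integral_cong_AE)
  have "AE x in lebesgue. x \<in> U \<longrightarrow> ennreal (\<bar>u x\<bar> powr p) = ennreal (\<bar>v x\<bar> powr p)"
    using assms(2) by eventually_elim auto
  then show "AE x in lebesgue_on U. ennreal (\<bar>u x\<bar> powr p) = ennreal (\<bar>v x\<bar> powr p)"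
    using assms(1) by (simp add: AE_lebesgue_on_iff)
qed

lemma LA_cong_AE:
  assumes U: "U \<in> sets lebesgue" "U \<subseteq> \<Omega>" and u: "u \<in> LA A U" and ae: "AE x in lebesgue. x \<in> U \<longrightarrow> u x = v x"
  shows "v \<in> LA A U"
  using u lebesgue_on_measurable_AE[OF U(1) _ ae] J_cong_AE[OF U(1) ae] by (simp add: LA_iff[OF U])

lemma J_mono: "(\<And>x. \<bar>u x\<bar> \<le> \<bar>v x\<bar>) \<Longrightarrow> J U u \<le> J U v"
  using p1 unfolding J_def by (intro nn_integral_mono ennreal_leI powr_mono2) auto

lemma J_subset:
  assumes "U \<subseteq> V" "U \<in> sets lebesgue" "V \<in> sets lebesgue"
  shows "J U u \<le> J V u"
  using assms unfolding J_def by (simp add: nn_integral_restrict_space) (auto intro!: nn_integral_mono simp: indicator_def)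

lemma LA_norm_le:
  assumes U: "U \<in> sets lebesgue" "U \<subseteq> \<Omega>" and vm[measurable]: "v \<in> borel_measurable (lebesgue_on U)"
    and \<delta>: "\<delta> > 0" "J U v \<le> ennreal (\<delta> powr p / M)"
  shows "LA_norm A U v \<le> \<delta>"
  unfolding LA_norm_def
proof (rule cInf_lower)
  have "modular A U (\<lambda>x. \<bar>v x\<bar> / \<delta>) \<le> ennreal M * (ennreal ((1 / \<bar>\<delta>\<bar>) powr p) * J U v)"
    unfolding J_cmult[OF vm, symmetric] by (rule modular_le[OF U]) measurable
  also have "\<dots> \<le> ennreal M * (ennreal ((1 / \<bar>\<delta>\<bar>) powr p) * ennreal (\<delta> powr p / M))"
    using \<delta> by (intro mult_left_mono) auto
  also have "\<dots> = ennreal (M * ((1 / \<bar>\<delta>\<bar>) powr p * (\<delta> powr p / M)))"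
    using M0 by (simp only: ennreal_mult mult_nonneg_nonneg powr_ge_zero divide_nonneg_nonneg less_imp_le)
  also have "M * ((1 / \<bar>\<delta>\<bar>) powr p * (\<delta> powr p / M)) = 1"
    using M0 \<delta>(1) by (simp add: powr_divide)
  finally show "\<delta> \<in> {l. 0 < l \<and> modular A U (\<lambda>x. \<bar>v x\<bar> / l) \<le> 1}" using \<delta>(1) by simp
  show "bdd_below {l. 0 < l \<and> modular A U (\<lambda>x. \<bar>v x\<bar> / l) \<le> 1}" by (rule bdd_belowI[of _ 0]) auto
qed

lemma \<Omega>_sets: "\<Omega> \<in> sets lebesgue" using open_\<Omega> by simp

lemma weak_gradient_AE:
  assumes wg: "is_weak_gradient U u g" and U: "open U"
  shows "AE x in lebesgue. x \<in> U \<longrightarrow> weak_gradient U u x = g x"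
proof -
  have "is_weak_gradient U u (weak_gradient U u)" by (rule weak_gradient_spec) (use wg in blast)
  from weak_gradient_unique[OF this U wg U U] show ?thesis by simp
qed

lemma W1A_I:
  assumes wg: "is_weak_gradient U u g" and U: "open U" "U \<subseteq> \<Omega>" and u: "J U u < \<infinity>" and g: "J U (\<lambda>x. norm (g x)) < \<infinity>"
  shows "u \<in> W1A A U"
proof -
  have li: "locally_integrable U u" "locally_integrable U g" using wg by (auto simp: is_weak_gradient_def)
  have Us: "U \<in> sets lebesgue" using U by simp
  have "u \<in> LA A U" using u locally_integrable_measurable[OF li(1) U(1)] by (simp add: LA_iff[OF Us U(2)])
  moreover have "(\<lambda>x. norm (weak_gradient U u x)) \<in> LA A U"
  proof (rule LA_cong_AE[OF Us U(2)])
    have [measurable]: "g \<in> borel_measurable (lebesgue_on U)" by (rule locally_integrable_measurable[OF li(2) U(1)])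
    show "(\<lambda>x. norm (g x)) \<in> LA A U" using g by (simp add: LA_iff[OF Us U(2)])
    show "AE x in lebesgue. x \<in> U \<longrightarrow> norm (g x) = norm (weak_gradient U u x)"
      using weak_gradient_AE[OF wg U(1)] by eventually_elim auto
  qed
  ultimately show ?thesis using wg by (auto simp: W1A_def)
qed

lemma W1A_D:
  assumes wg: "is_weak_gradient U u g" and U: "open U" "U \<subseteq> \<Omega>" and u: "u \<in> W1A A U"
  shows "J U u < \<infinity>" "J U (\<lambda>x. norm (g x)) < \<infinity>"
proof -
  have Us: "U \<in> sets lebesgue" using U by simp
  show "J U u < \<infinity>" using u by (simp add: W1A_def LA_iff[OF Us U(2)])
  have "J U (\<lambda>x. norm (weak_gradient U u x)) < \<infinity>" using u by (simp add: W1A_def LA_iff[OF Us U(2)])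
  moreover have "J U (\<lambda>x. norm (weak_gradient U u x)) = J U (\<lambda>x. norm (g x))"
    by (rule J_cong_AE[OF Us]) (use weak_gradient_AE[OF wg U(1)] in \<open>auto elim: eventually_mono\<close>)
  ultimately show "J U (\<lambda>x. norm (g x)) < \<infinity>" by simp
qed

lemma W1A_norm_le:
  assumes wg: "is_weak_gradient \<Omega> u g" and \<delta>: "\<delta> > 0"
    and u: "J \<Omega> u \<le> ennreal (\<delta> powr p / M)" and g: "J \<Omega> (\<lambda>x. norm (g x)) \<le> ennreal (\<delta> powr p / M)"
  shows "W1A_norm A \<Omega> u \<le> 2 * \<delta>"
proof -
  let ?g = "weak_gradient \<Omega> u"
  have li: "locally_integrable \<Omega> u" using wg by (auto simp: is_weak_gradient_def)
  have "is_weak_gradient \<Omega> u ?g" by (rule weak_gradient_spec) (use wg in blast)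
  then have lig: "locally_integrable \<Omega> ?g" by (simp add: is_weak_gradient_def)
  have [measurable]: "u \<in> borel_measurable (lebesgue_on \<Omega>)" "?g \<in> borel_measurable (lebesgue_on \<Omega>)"
    using locally_integrable_measurable[OF li open_\<Omega>] locally_integrable_measurable[OF lig open_\<Omega>] .
  have "LA_norm A \<Omega> u \<le> \<delta>" by (rule LA_norm_le[OF \<Omega>_sets order_refl _ \<delta> u]) measurable
  moreover have "J \<Omega> (\<lambda>x. norm (?g x)) = J \<Omega> (\<lambda>x. norm (g x))"
    by (rule J_cong_AE[OF \<Omega>_sets]) (use weak_gradient_AE[OF wg open_\<Omega>] in \<open>auto elim: eventually_mono\<close>)
  then have "LA_norm A \<Omega> (\<lambda>x. norm (?g x)) \<le> \<delta>"
    by (intro LA_norm_le[OF \<Omega>_sets order_refl _ \<delta>]) (measurable, simp add: g)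
  ultimately show ?thesis by (simp add: W1A_norm_def)
qed

lemma J_UNIV: "J UNIV v = (\<integral>\<^sup>+x. ennreal (\<bar>v x\<bar> powr p) \<partial>lebesgue)"
  by (simp add: J_def lebesgue_on_UNIV_eq)

lemma J_bounded_finite:
  assumes "U \<in> sets lebesgue" "bounded U" "\<And>x. \<bar>v x\<bar> \<le> B"
  shows "J U v < \<infinity>"
proof -
  have "J U v \<le> (\<integral>\<^sup>+x. ennreal (B powr p) \<partial>lebesgue_on U)"
    unfolding J_def using assms(3) p1 by (intro nn_integral_mono ennreal_leI powr_mono2) auto
  also have "\<dots> = ennreal (B powr p) * emeasure lebesgue U"
    using assms(1) by (simp add: emeasure_restrict_space)
  also have "emeasure lebesgue U < \<infinity>"
    using fmeasurableD2[OF bounded_set_imp_lmeasurable[OF assms(2,1)]] by (simp add: less_top)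
  then have "ennreal (B powr p) * emeasure lebesgue U < \<infinity>" by (simp add: ennreal_mult_less_top)
  finally show ?thesis .
qed

lemma W1A_0_compact_support:
  assumes wg: "is_weak_gradient UNIV v G" and K: "compact K" "K \<subseteq> \<Omega>"
    and off: "\<And>x. x \<notin> K \<Longrightarrow> v x = 0" "\<And>x. x \<notin> K \<Longrightarrow> G x = 0"
    and fin: "J UNIV v < \<infinity>" "J UNIV (\<lambda>x. norm (G x)) < \<infinity>"
    and ae: "AE x in lebesgue. v x = \<phi> x"
  shows "\<phi> \<in> W1A_0 A \<Omega>"
proof -
  have wg\<phi>: "is_weak_gradient \<Omega> \<phi> G"
    by (rule is_weak_gradient_AE[OF is_weak_gradient_subset[OF wg open_UNIV open_\<Omega> subset_UNIV] open_\<Omega>])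
      (use ae in auto)
  have J\<Omega>: "J \<Omega> u \<le> J UNIV u" for u by (rule J_subset) (auto simp: \<Omega>_sets)
  have J\<phi>: "J \<Omega> \<phi> = J \<Omega> v" by (rule J_cong_AE[OF \<Omega>_sets]) (use ae in \<open>auto elim: eventually_mono\<close>)
  have "\<phi> \<in> W1A A \<Omega>"
    by (rule W1A_I[OF wg\<phi> open_\<Omega> order_refl])
      (use J\<phi> J\<Omega>[of v] J\<Omega>[of "\<lambda>x. norm (G x)"] fin in \<open>auto intro: order.strict_trans1\<close>)
  moreover have "\<exists>\<psi>\<in>test_functions \<Omega> \<inter> W1A A \<Omega>. W1A_norm A \<Omega> (\<lambda>x. \<phi> x - \<psi> x) < \<epsilon>" if \<epsilon>: "\<epsilon> > 0" for \<epsilon>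
  proof -
    define \<delta> where "\<delta> = (\<epsilon> / 3) powr p / M"
    have \<delta>: "\<delta> > 0" using \<epsilon> M0 by (simp add: \<delta>_def)
    obtain \<psi> where \<psi>: "\<psi> \<in> test_functions \<Omega>" "(\<integral>\<^sup>+x. ennreal (\<bar>v x - \<psi> x\<bar> powr p) \<partial>lebesgue) \<le> ennreal \<delta>"
      "(\<integral>\<^sup>+x. ennreal (norm (G x - grad \<psi> x) powr p) \<partial>lebesgue) \<le> ennreal \<delta>"
      using test_functions_dense[OF p1 wg K open_\<Omega> off _ _ \<delta>] fin by (auto simp: J_UNIV)
    have wg\<psi>: "is_weak_gradient \<Omega> \<psi> (grad \<psi>)" by (rule is_weak_gradient_smooth[OF test_smooth[OF \<psi>(1)] open_\<Omega>])
    obtain B where B: "\<And>x. \<bar>\<psi> x\<bar> \<le> B" using test_bounded[OF \<psi>(1)] by blast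
    have "\<exists>B. \<forall>x. \<bar>partial_deriv i \<psi> x\<bar> \<le> B" for i using test_bounded[OF test_partial[OF \<psi>(1)], of i] by metis
    then obtain B' where B': "\<And>i x. \<bar>partial_deriv i \<psi> x\<bar> \<le> B' i" by metis
    have "norm (grad \<psi> x) \<le> (\<Sum>i\<in>UNIV. B' i)" for x
      by (rule order_trans[OF norm_le_l1_cart]) (use B' in \<open>auto intro: sum_mono\<close>)
    then have "J \<Omega> (\<lambda>x. norm (grad \<psi> x)) < \<infinity>"
      by (intro J_bounded_finite[OF \<Omega>_sets bounded_\<Omega>]) simp
    then have \<psi>W: "\<psi> \<in> W1A A \<Omega>"
      using W1A_I[OF wg\<psi> open_\<Omega> order_refl J_bounded_finite[OF \<Omega>_sets bounded_\<Omega> B]] by simp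
    have "W1A_norm A \<Omega> (\<lambda>x. \<phi> x - \<psi> x) \<le> 2 * (\<epsilon> / 3)"
    proof (rule W1A_norm_le)
      show "is_weak_gradient \<Omega> (\<lambda>x. \<phi> x - \<psi> x) (\<lambda>x. G x - grad \<psi> x)"
        using is_weak_gradient_lincomb[OF wg\<phi> wg\<psi> open_\<Omega>, of "-1"] by simp
      show "\<epsilon> / 3 > 0" using \<epsilon> by simp
      have "J \<Omega> (\<lambda>x. \<phi> x - \<psi> x) = J \<Omega> (\<lambda>x. v x - \<psi> x)"
        by (rule J_cong_AE[OF \<Omega>_sets]) (use ae in \<open>auto elim: eventually_mono\<close>)
      also have "\<dots> \<le> J UNIV (\<lambda>x. v x - \<psi> x)" by (rule J\<Omega>)
      finally show "J \<Omega> (\<lambda>x. \<phi> x - \<psi> x) \<le> ennreal ((\<epsilon> / 3) powr p / M)"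
        using \<psi>(2) by (simp add: J_UNIV \<delta>_def)
      have "J \<Omega> (\<lambda>x. norm (G x - grad \<psi> x)) \<le> J UNIV (\<lambda>x. norm (G x - grad \<psi> x))" by (rule J\<Omega>)
      then show "J \<Omega> (\<lambda>x. norm (G x - grad \<psi> x)) \<le> ennreal ((\<epsilon> / 3) powr p / M)"
        using \<psi>(3) by (simp add: J_UNIV \<delta>_def)
    qed
    also have "\<dots> < \<epsilon>" using \<epsilon> by simp
    finally show ?thesis using \<psi>(1) \<psi>W by blast
  qed
  ultimately show ?thesis by (simp add: W1A_0_def)
qed

lemma W1A_loc_D:
  assumes u: "u \<in> W1A_loc A \<Omega>"
  shows "is_weak_gradient \<Omega> u (weak_gradient \<Omega> u)"
    "\<And>K. compact K \<Longrightarrow> K \<subseteq> \<Omega> \<Longrightarrow> J K u < \<infinity> \<and> J K (\<lambda>x. norm (weak_gradient \<Omega> u x)) < \<infinity>"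
proof -
  have loc: "u \<in> W1A A W" if "open W" "compact (closure W)" "closure W \<subseteq> \<Omega>" for W
    using u that by (simp add: W1A_loc_def)
  have "\<exists>g. is_weak_gradient \<Omega> u g"
    by (rule weak_gradient_glue[OF open_\<Omega>]) (use loc in \<open>simp add: W1A_def\<close>)
  then show wg: "is_weak_gradient \<Omega> u (weak_gradient \<Omega> u)" by (rule weak_gradient_spec)
  fix K assume K: "compact K" "K \<subseteq> \<Omega>"
  obtain C :: "nat \<Rightarrow> (real ^ 'n) set" where C: "\<And>n. compact (C n)" "\<And>n. C n \<subseteq> \<Omega>" "\<And>n. C n \<subseteq> interior (C (Suc n))"
    "\<Union>(range C) = \<Omega>" "\<And>K. \<lbrakk>compact K; K \<subseteq> \<Omega>\<rbrakk> \<Longrightarrow> \<exists>N. \<forall>n\<ge>N. K \<subseteq> C n"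
    by (rule open_Union_compact_subsets[OF open_\<Omega>]) (rule that)
  obtain N where "K \<subseteq> C N" using C(5)[OF K] by blast
  define W where "W = interior (C (Suc N))"
  have KW: "K \<subseteq> W" using \<open>K \<subseteq> C N\<close> C(3)[of N] by (auto simp: W_def)
  have clW: "closure W \<subseteq> C (Suc N)" unfolding W_def
    by (rule closure_minimal[OF interior_subset compact_imp_closed[OF C(1)]])
  have W: "open W" "compact (closure W)" "closure W \<subseteq> \<Omega>" "W \<subseteq> \<Omega>"
    using compact_Int_closed[OF C(1)[of "Suc N"] closed_closure, of W] clW C(2)[of "Suc N"] closure_subset[of W]
    by (simp_all add: Int_absorb1 W_def)
  note * = W1A_D[OF is_weak_gradient_subset[OF wg open_\<Omega> W(1,4)] W(1,4) loc[OF W(1-3)]]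
  have "J K v \<le> J W v" for v
    using KW W(1) fmeasurableD[OF lmeasurable_compact[OF K(1)]] by (intro J_subset) auto
  then show "J K u < \<infinity> \<and> J K (\<lambda>x. norm (weak_gradient \<Omega> u x)) < \<infinity>"
    using * by (meson order.strict_trans1)
qed

end

subsection \<open>The Caccioppoli inequality\<close>

lemma hole_filling_iteration:
  fixes \<theta> p :: real
  assumes \<theta>: "0 \<le> \<theta>" "\<theta> < 1" and p: "p > 0"
  obtains c where "c > 0"
    "\<And>(Z::real \<Rightarrow> real) B D M \<rho> R. \<lbrakk>\<rho> < R; 0 \<le> B; 0 \<le> D; \<And>t. \<rho> \<le> t \<Longrightarrow> t \<le> R \<Longrightarrow> Z t \<le> M;
       \<And>s t. \<rho> \<le> s \<Longrightarrow> s < t \<Longrightarrow> t \<le> R \<Longrightarrow> Z s \<le> \<theta> * Z t + B / (t - s) powr p + D\<rbrakk>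
      \<Longrightarrow> Z \<rho> \<le> c * (B / (R - \<rho>) powr p + D)"
proof -
  define \<tau> where "\<tau> = ((1 + \<theta>) / 2) powr (1 / p)"
  define \<sigma> where "\<sigma> = \<theta> / \<tau> powr p"
  have \<tau>p: "\<tau> powr p = (1 + \<theta>) / 2" using \<theta> p by (simp add: \<tau>_def powr_powr)
  have \<tau>: "0 < \<tau>" "\<tau> < 1"
  proof -
    show "0 < \<tau>" using \<theta> by (simp add: \<tau>_def)
    have "\<tau> < 1 powr (1 / p)" unfolding \<tau>_def using \<theta> p by (intro powr_less_mono2) auto
    then show "\<tau> < 1" by simp
  qed
  have \<sigma>: "0 \<le> \<sigma>" "\<sigma> < 1" using \<theta> by (auto simp: \<sigma>_def \<tau>p field_simps)
  define c where "c = 1 / (1 - \<tau>) powr p / (1 - \<sigma>) + 1 / (1 - \<theta>)"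
  show ?thesis
  proof (rule that[of c])
    show "c > 0" using \<tau> \<sigma> \<theta> by (auto simp: c_def intro!: add_pos_pos)
  next
    fix Z :: "real \<Rightarrow> real" and B D M \<rho> R
    assume R: "\<rho> < R" and BD: "0 \<le> B" "0 \<le> D" and M: "\<And>t. \<rho> \<le> t \<Longrightarrow> t \<le> R \<Longrightarrow> Z t \<le> M"
      and st: "\<And>s t. \<rho> \<le> s \<Longrightarrow> s < t \<Longrightarrow> t \<le> R \<Longrightarrow> Z s \<le> \<theta> * Z t + B / (t - s) powr p + D"
    define t where "t i = R - \<tau> ^ i * (R - \<rho>)" for i :: nat
    define b where "b = B / (1 - \<tau>) powr p / (R - \<rho>) powr p"
    have pw: "0 < \<tau> ^ i" "\<tau> ^ i \<le> 1" for i using \<tau> by (auto simp: power_le_one)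
    have t: "\<rho> \<le> t i" "t i < R" for i
    proof -
      have "\<tau> ^ i * (R - \<rho>) \<le> 1 * (R - \<rho>)" using pw[of i] R by (intro mult_right_mono) auto
      then show "\<rho> \<le> t i" by (simp add: t_def)
      show "t i < R" using pw[of i] R by (simp add: t_def)
    qed
    have tdiff: "t (Suc i) - t i = (1 - \<tau>) * \<tau> ^ i * (R - \<rho>)" for i
      by (simp add: t_def algebra_simps)
    have step: "Z (t i) \<le> \<theta> * Z (t (Suc i)) + b / (\<tau> powr p) ^ i + D" for i
    proof -
      have pos: "0 < (1 - \<tau>) * \<tau> ^ i * (R - \<rho>)" using \<tau> pw[of i] R by simp
      have "(t (Suc i) - t i) powr p = (1 - \<tau>) powr p * (\<tau> powr p) ^ i * (R - \<rho>) powr p"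
        using \<tau> pw[of i] R unfolding tdiff
        by (simp add: powr_mult less_imp_le powr_powr powr_realpow[symmetric] mult.commute)
      then show ?thesis
        using st[of "t i" "t (Suc i)"] t[of i] t[of "Suc i"] pos tdiff[of i] by (simp add: b_def mult_ac)
    qed
    have iter: "Z \<rho> \<le> \<theta> ^ k * Z (t k) + b * (\<Sum>i<k. \<sigma> ^ i) + D * (\<Sum>i<k. \<theta> ^ i)" for k
    proof (induction k)
      case 0
      then show ?case by (simp add: t_def)
    next
      case (Suc k)
      have "\<theta> ^ k * Z (t k) \<le> \<theta> ^ k * (\<theta> * Z (t (Suc k)) + b / (\<tau> powr p) ^ k + D)"
        using step \<theta> by (intro mult_left_mono) auto
      also have "\<dots> = \<theta> ^ Suc k * Z (t (Suc k)) + b * \<sigma> ^ k + D * \<theta> ^ k"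
        by (simp add: \<sigma>_def power_divide algebra_simps)
      finally show ?case using Suc by (simp add: algebra_simps)
    qed
    have b0: "b \<ge> 0" using BD by (simp add: b_def)
    have geo: "(\<Sum>i<k. x ^ i) \<le> 1 / (1 - x)" if "0 \<le> x" "x < 1" for x :: real and k
      using that by (auto simp: sum_gp_strict divide_right_mono)
    have "Z \<rho> \<le> \<theta> ^ k * M + (b * (1 / (1 - \<sigma>)) + D * (1 / (1 - \<theta>)))" for k
    proof -
      have "\<theta> ^ k * Z (t k) \<le> \<theta> ^ k * M" using M[of "t k"] t[of k] \<theta> by (intro mult_left_mono) auto
      moreover have "b * (\<Sum>i<k. \<sigma> ^ i) \<le> b * (1 / (1 - \<sigma>))" using geo[OF \<sigma>] b0 by (intro mult_left_mono)
      moreover have "D * (\<Sum>i<k. \<theta> ^ i) \<le> D * (1 / (1 - \<theta>))" using geo[OF \<theta>] BD by (intro mult_left_mono)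
      ultimately show ?thesis using iter[of k] by linarith
    qed
    moreover have "(\<lambda>k. \<theta> ^ k * M + (b * (1 / (1 - \<sigma>)) + D * (1 / (1 - \<theta>))))
      \<longlonglongrightarrow> 0 * M + (b * (1 / (1 - \<sigma>)) + D * (1 / (1 - \<theta>)))"
      using \<theta> by (intro tendsto_intros LIMSEQ_power_zero) auto
    ultimately have "Z \<rho> \<le> b * (1 / (1 - \<sigma>)) + D * (1 / (1 - \<theta>))"
      by (intro LIMSEQ_le_const[where X="\<lambda>k. \<theta> ^ k * M + (b * (1 / (1 - \<sigma>)) + D * (1 / (1 - \<theta>)))"]) auto
    also have "b * (1 / (1 - \<sigma>)) \<le> c * (B / (R - \<rho>) powr p)"
    proof -
      have "b * (1 / (1 - \<sigma>)) = 1 / (1 - \<tau>) powr p / (1 - \<sigma>) * (B / (R - \<rho>) powr p)"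
        by (simp add: b_def)
      also have "\<dots> \<le> c * (B / (R - \<rho>) powr p)"
        using \<theta> BD by (intro mult_right_mono) (auto simp: c_def)
      finally show ?thesis .
    qed
    also have "D * (1 / (1 - \<theta>)) \<le> c * D"
      using \<sigma> BD mult_right_mono[of "1 / (1 - \<theta>)" c D] by (auto simp: c_def mult.commute)
    finally show "Z \<rho> \<le> c * (B / (R - \<rho>) powr p + D)" by (simp add: algebra_simps)
  qed
qed

text \<open>Energies are compared on the support of the variation. Redefining the variation on a countable
  set makes that support the whole cube, also where \<open>u\<close> equals \<open>a\<close>.\<close>

lemma supp_fill_dense:
  fixes v :: "real ^ 'n \<Rightarrow> real"
  assumes t: "t > 0" and sub: "cube x0 t \<subseteq> \<Omega>" and off: "\<And>x. x \<notin> cube x0 t \<Longrightarrow> v x = 0"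
  obtains \<phi> where "AE x in lebesgue. v x = \<phi> x" "supp \<Omega> \<phi> = cube x0 t"
proof -
  obtain D :: "(real ^ 'n) set" where D: "countable D" "\<And>X. open X \<Longrightarrow> X \<noteq> {} \<Longrightarrow> \<exists>d\<in>D. d \<in> X"
    using countable_dense_setE by blast
  let ?B = "box (x0 - (\<chi> i. t)) (x0 + (\<chi> i. t))"
  define \<phi> where "\<phi> x = (if x \<in> D \<inter> ?B then 1 else v x)" for x
  have "x0 \<in> ?B" using t by (simp add: mem_box_cart)
  then have cl: "closure ?B = cube x0 t" unfolding cube_eq_cbox by (intro closure_box) blast
  have B: "?B \<subseteq> cube x0 t" unfolding cube_eq_cbox by (rule box_subset_cbox)
  show ?thesis
  proof (rule that[of \<phi>])
    have "D \<in> null_sets lebesgue"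
      by (rule null_sets_completionI[OF countable_imp_null_set_lborel[OF D(1)]])
    then have "AE x in lebesgue. x \<notin> D" by (rule AE_not_in)
    then show "AE x in lebesgue. v x = \<phi> x" by eventually_elim (simp add: \<phi>_def)
    show "supp \<Omega> \<phi> = cube x0 t"
    proof
      show "supp \<Omega> \<phi> \<subseteq> cube x0 t" unfolding supp_def
      proof (rule closure_minimal)
        show "{x \<in> \<Omega>. \<phi> x \<noteq> 0} \<subseteq> cube x0 t"
        proof
          fix x assume x: "x \<in> {x \<in> \<Omega>. \<phi> x \<noteq> 0}"
          show "x \<in> cube x0 t"
          proof (cases "x \<in> D \<inter> ?B")
            case True
            then show ?thesis using B by blast
          next
            case False
            then have "\<phi> x = v x" unfolding \<phi>_def by (rule if_not_P)
            then have "v x \<noteq> 0" using x by simp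
            then show ?thesis using off by blast
          qed
        qed
      qed simp
      have "?B \<subseteq> closure (D \<inter> ?B)"
      proof
        fix x assume x: "x \<in> ?B"
        show "x \<in> closure (D \<inter> ?B)" unfolding closure_iff_nhds_not_empty
        proof (intro allI impI)
          fix X V assume V: "V \<subseteq> X" "open V" "x \<in> V"
          then have "\<exists>d\<in>D. d \<in> V \<inter> ?B" using x by (intro D(2)) auto
          then show "D \<inter> ?B \<inter> X \<noteq> {}" using V by blast
        qed
      qed
      also have "closure (D \<inter> ?B) \<subseteq> supp \<Omega> \<phi>" unfolding supp_def
        by (rule closure_mono) (use B sub in \<open>auto simp: \<phi>_def\<close>)
      finally have "closure ?B \<subseteq> supp \<Omega> \<phi>" by (rule closure_minimal) (simp add: supp_def)
      then show "cube x0 t \<subseteq> supp \<Omega> \<phi>" by (simp add: cl)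
    qed
  qed
qed

lemma ennreal_diff_le_imp:
  assumes "enn2ereal P1 - enn2ereal N1 \<le> enn2ereal P2 - enn2ereal N2" "N1 < \<infinity>"
  shows "P1 \<le> P2 + N1"
proof -
  obtain n where n: "N1 = ennreal n" "n \<ge> 0" using assms(2) by (cases N1) auto
  have eN: "enn2ereal N1 = ereal n" using n by (simp add: enn2ereal_ennreal)
  have "enn2ereal P2 - enn2ereal N2 \<le> enn2ereal P2"
    using enn2ereal_nonneg[of N2] enn2ereal_nonneg[of P2] by (cases "enn2ereal P2"; cases "enn2ereal N2") auto
  then have "enn2ereal P1 - ereal n \<le> enn2ereal P2" using assms(1) unfolding eN by (rule order_trans[rotated])
  then have "enn2ereal P1 \<le> enn2ereal P2 + ereal n"
    by (cases "enn2ereal P1"; cases "enn2ereal P2") auto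
  then show ?thesis unfolding less_eq_ennreal.rep_eq plus_ennreal.rep_eq eN .
qed

context power_weight
begin

lemma modular_scale:
  assumes U: "U \<in> sets lebesgue" "U \<subseteq> \<Omega>" and [measurable]: "v \<in> borel_measurable (lebesgue_on U)"
    and vw: "\<And>x. \<bar>v' x\<bar> = c * \<bar>v x\<bar>" and c: "c \<ge> 0"
  shows "modular A U v' = ennreal (c powr p) * modular A U v"
proof -
  have "ennreal (w x * \<bar>v' x\<bar> powr p) = ennreal (c powr p) * ennreal (w x * \<bar>v x\<bar> powr p)" for x
    unfolding vw powr_mult using w_nonneg[of x] by (subst ennreal_mult[symmetric]) (auto simp: mult_ac)
  then show ?thesis unfolding modular_eq[OF U] by (simp only:) (rule nn_integral_cmult, measurable)
qed

lemma J_add: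
  assumes U: "U \<in> sets lebesgue" and [measurable]: "v1 \<in> borel_measurable (lebesgue_on U)" "v2 \<in> borel_measurable (lebesgue_on U)"
    and le: "\<And>x. x \<in> U \<Longrightarrow> \<bar>v x\<bar> \<le> \<bar>v1 x\<bar> + \<bar>v2 x\<bar>" and fin: "J U v1 < \<infinity>" "J U v2 < \<infinity>"
  shows "J U v < \<infinity>"
proof -
  have "J U v \<le> (\<integral>\<^sup>+x. ennreal (2 powr p) * (ennreal (\<bar>v1 x\<bar> powr p) + ennreal (\<bar>v2 x\<bar> powr p)) \<partial>lebesgue_on U)"
    unfolding J_def
  proof (rule nn_integral_mono)
    fix x assume x: "x \<in> space (lebesgue_on U)"
    have "\<bar>v x\<bar> powr p \<le> (\<bar>v1 x\<bar> + \<bar>v2 x\<bar>) powr p" using le[of x] x p1 by (intro powr_mono2) auto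
    also have "\<dots> \<le> 2 powr p * (\<bar>v1 x\<bar> powr p + \<bar>v2 x\<bar> powr p)" using p1 by (intro powr_add_le) auto
    finally have "ennreal (\<bar>v x\<bar> powr p) \<le> ennreal (2 powr p * (\<bar>v1 x\<bar> powr p + \<bar>v2 x\<bar> powr p))" by (rule ennreal_leI)
    then show "ennreal (\<bar>v x\<bar> powr p) \<le> ennreal (2 powr p) * (ennreal (\<bar>v1 x\<bar> powr p) + ennreal (\<bar>v2 x\<bar> powr p))"
      by (simp add: ennreal_mult)
  qed
  also have "\<dots> = ennreal (2 powr p) * (J U v1 + J U v2)"
    unfolding J_def by (simp add: nn_integral_cmult nn_integral_add)
  also have "\<dots> < \<infinity>" using fin by (simp add: ennreal_mult_less_top)
  finally show ?thesis .
qed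

lemma J_UNIV_supp:
  assumes K: "K \<in> sets lebesgue" and off: "\<And>x. x \<notin> K \<Longrightarrow> v x = 0"
  shows "J UNIV v = J K v"
  unfolding J_UNIV unfolding J_def using K off p1
  by (subst nn_integral_restrict_space) (auto intro!: nn_integral_cong simp: indicator_def)

lemma energy_comparison:
  assumes Q: "Q \<in> sets lebesgue" "Q \<subseteq> \<Omega>" "emeasure lebesgue Q < \<infinity>"
    and b: "b1 \<ge> 0" "b2 > 0" "b3 \<ge> 0" and gr: "growth_condition \<Omega> A b1 b2 b3 f"
    and le: "energy \<Omega> f u Q \<le> energy \<Omega> f v Q"
    and [measurable]: "weak_gradient \<Omega> u \<in> borel_measurable (lebesgue_on Q)" "weak_gradient \<Omega> v \<in> borel_measurable (lebesgue_on Q)"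
  shows "ennreal b2 * (\<integral>\<^sup>+x. ennreal (w x * (\<Sum>i\<in>UNIV. \<bar>weak_gradient \<Omega> u x $ i\<bar>) powr p) \<partial>lebesgue_on Q)
    \<le> ennreal b3 * (\<integral>\<^sup>+x. ennreal (w x * (\<Sum>i\<in>UNIV. \<bar>weak_gradient \<Omega> v x $ i\<bar>) powr p) \<partial>lebesgue_on Q)
      + ennreal (3 * b1) * emeasure lebesgue Q"
proof -
  define s1 where "s1 z = (\<Sum>i\<in>UNIV. \<bar>z $ i\<bar>)" for z :: "real ^ 'n"
  have s10: "s1 z \<ge> 0" for z by (auto simp: s1_def intro: sum_nonneg)
  have s1m[measurable]: "s1 \<in> borel_measurable borel"
    unfolding s1_def[abs_def] by (intro borel_measurable_continuous_onI continuous_intros)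
  define gu gv where "gu = weak_gradient \<Omega> u" and "gv = weak_gradient \<Omega> v"
  have [measurable]: "gu \<in> borel_measurable (lebesgue_on Q)" "gv \<in> borel_measurable (lebesgue_on Q)"
    unfolding gu_def gv_def by measurable
  define V where "V = emeasure lebesgue Q"
  have Vc: "(\<integral>\<^sup>+x. ennreal c \<partial>lebesgue_on Q) = ennreal c * V" for c
    using Q(1) by (simp add: V_def emeasure_restrict_space)
  have gr': "AE x in lebesgue_on Q. \<forall>z. b2 * (w x * s1 z powr p) - b1 \<le> f x z \<and> f x z \<le> b3 * (w x * s1 z powr p) + b1"
    unfolding AE_lebesgue_on_iff[OF Q(1)] using A_eq
  proof eventually_elim
    case (elim x)
    show ?case
    proof (intro impI allI)
      fix z assume "x \<in> Q"
      then have x: "x \<in> \<Omega>" using Q by blast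
      then have "A x (s1 z) = w x * s1 z powr p" using elim s10[of z] by simp
      then show "b2 * (w x * s1 z powr p) - b1 \<le> f x z \<and> f x z \<le> b3 * (w x * s1 z powr p) + b1"
        using gr x unfolding growth_condition_def s1_def by metis
    qed
  qed
  define P1 N1 P2 N2 where "P1 = (\<integral>\<^sup>+x. ennreal (f x (gu x)) \<partial>lebesgue_on Q)" and "N1 = (\<integral>\<^sup>+x. ennreal (- f x (gu x)) \<partial>lebesgue_on Q)"
    and "P2 = (\<integral>\<^sup>+x. ennreal (f x (gv x)) \<partial>lebesgue_on Q)" and "N2 = (\<integral>\<^sup>+x. ennreal (- f x (gv x)) \<partial>lebesgue_on Q)"
  have ws: "w x * s1 z powr p \<ge> 0" for x z using w_nonneg by simp
  have N1: "N1 \<le> ennreal b1 * V"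
    unfolding N1_def Vc[symmetric]
  proof (rule nn_integral_mono_AE)
    show "AE x in lebesgue_on Q. ennreal (- f x (gu x)) \<le> ennreal b1"
      using gr'
    proof eventually_elim
      case (elim x)
      then have "b2 * (w x * s1 (gu x) powr p) - b1 \<le> f x (gu x)" by blast
      moreover have "b2 * (w x * s1 (gu x) powr p) \<ge> 0" using ws b by simp
      ultimately show ?case by (intro ennreal_leI) linarith
    qed
  qed
  have P1: "ennreal b2 * (\<integral>\<^sup>+x. ennreal (w x * s1 (gu x) powr p) \<partial>lebesgue_on Q) \<le> P1 + ennreal b1 * V"
  proof -
    have "ennreal b2 * (\<integral>\<^sup>+x. ennreal (w x * s1 (gu x) powr p) \<partial>lebesgue_on Q)
        = (\<integral>\<^sup>+x. ennreal b2 * ennreal (w x * s1 (gu x) powr p) \<partial>lebesgue_on Q)"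
      by (rule nn_integral_cmult[symmetric]) measurable
    also have "\<dots> \<le> (\<integral>\<^sup>+x. ennreal (b2 * (w x * s1 (gu x) powr p) - b1) + ennreal b1 \<partial>lebesgue_on Q)"
    proof (rule nn_integral_mono)
      fix x
      have "ennreal b2 * ennreal (w x * s1 (gu x) powr p) = ennreal (b2 * (w x * s1 (gu x) powr p))"
        using b ws by (simp add: ennreal_mult)
      also have "\<dots> \<le> ennreal (max 0 (b2 * (w x * s1 (gu x) powr p) - b1) + b1)"
        by (intro ennreal_leI) linarith
      also have "\<dots> = ennreal (max 0 (b2 * (w x * s1 (gu x) powr p) - b1)) + ennreal b1"
        using b by (intro ennreal_plus) auto
      also have "ennreal (max 0 (b2 * (w x * s1 (gu x) powr p) - b1)) = ennreal (b2 * (w x * s1 (gu x) powr p) - b1)"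
        by (simp add: max_def ennreal_neg)
      finally show "ennreal b2 * ennreal (w x * s1 (gu x) powr p) \<le> ennreal (b2 * (w x * s1 (gu x) powr p) - b1) + ennreal b1" .
    qed
    also have "\<dots> = (\<integral>\<^sup>+x. ennreal (b2 * (w x * s1 (gu x) powr p) - b1) \<partial>lebesgue_on Q) + (\<integral>\<^sup>+x. ennreal b1 \<partial>lebesgue_on Q)"
      by (rule nn_integral_add) measurable
    also have "\<dots> \<le> P1 + ennreal b1 * V" unfolding Vc P1_def
      using gr' by (intro add_right_mono nn_integral_mono_AE) (auto elim!: eventually_mono intro: ennreal_leI)
    finally show ?thesis .
  qed
  have P2: "P2 \<le> ennreal b3 * (\<integral>\<^sup>+x. ennreal (w x * s1 (gv x) powr p) \<partial>lebesgue_on Q) + ennreal b1 * V"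
  proof -
    have "P2 \<le> (\<integral>\<^sup>+x. ennreal b3 * ennreal (w x * s1 (gv x) powr p) + ennreal b1 \<partial>lebesgue_on Q)"
      unfolding P2_def
    proof (rule nn_integral_mono_AE)
      show "AE x in lebesgue_on Q. ennreal (f x (gv x)) \<le> ennreal b3 * ennreal (w x * s1 (gv x) powr p) + ennreal b1"
        using gr'
      proof eventually_elim
        case (elim x)
        then have "ennreal (f x (gv x)) \<le> ennreal (b3 * (w x * s1 (gv x) powr p) + b1)" by (intro ennreal_leI) blast
        also have "\<dots> = ennreal b3 * ennreal (w x * s1 (gv x) powr p) + ennreal b1"
          using b ws by (simp add: ennreal_mult)
        finally show ?case .
      qed
    qed
    also have "\<dots> = (\<integral>\<^sup>+x. ennreal b3 * ennreal (w x * s1 (gv x) powr p) \<partial>lebesgue_on Q) + (\<integral>\<^sup>+x. ennreal b1 \<partial>lebesgue_on Q)"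
      by (rule nn_integral_add) measurable
    also have "(\<integral>\<^sup>+x. ennreal b3 * ennreal (w x * s1 (gv x) powr p) \<partial>lebesgue_on Q)
        = ennreal b3 * (\<integral>\<^sup>+x. ennreal (w x * s1 (gv x) powr p) \<partial>lebesgue_on Q)"
      by (rule nn_integral_cmult) measurable
    finally show ?thesis unfolding Vc .
  qed
  have "N1 < \<infinity>" by (rule order.strict_trans1[OF N1]) (use Q(3) in \<open>simp only: V_def[symmetric], simp add: ennreal_mult_less_top\<close>)
  then have "P1 \<le> P2 + N1"
    using le unfolding energy_def gu_def[symmetric] gv_def[symmetric] P1_def[symmetric] N1_def[symmetric] P2_def[symmetric] N2_def[symmetric]
    by (intro ennreal_diff_le_imp)
  then have "ennreal b2 * (\<integral>\<^sup>+x. ennreal (w x * s1 (gu x) powr p) \<partial>lebesgue_on Q)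
     \<le> (ennreal b3 * (\<integral>\<^sup>+x. ennreal (w x * s1 (gv x) powr p) \<partial>lebesgue_on Q) + ennreal b1 * V) + ennreal b1 * V + ennreal b1 * V"
    using P1 P2 N1 by (meson add_mono order_refl order_trans)
  also have "\<dots> = ennreal b3 * (\<integral>\<^sup>+x. ennreal (w x * s1 (gv x) powr p) \<partial>lebesgue_on Q) + (ennreal b1 + ennreal b1 + ennreal b1) * V"
    by (simp add: distrib_right add.assoc)
  also have "ennreal b1 + ennreal b1 + ennreal b1 = ennreal (3 * b1)"
    using b by (simp add: ennreal_plus[symmetric] del: ennreal_plus)
  finally show ?thesis unfolding s1_def gu_def gv_def V_def .
qed

lemma caccioppoli_step:
  assumes b: "b1 \<ge> 0" "b2 > 0" "b3 \<ge> 0" and gr: "growth_condition \<Omega> A b1 b2 b3 f"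
    and lm: "local_minimizer \<Omega> A f u" and Q: "cube x0 R \<subseteq> \<Omega>" and st: "0 < s" "s < t" "t \<le> R"
    and L: "L > 0" and \<eta>: "smooth \<eta>" "\<And>x. 0 \<le> \<eta> x \<and> \<eta> x \<le> 1" "\<And>x. x \<in> cube x0 s \<Longrightarrow> \<eta> x = 1"
      "\<And>x. x \<notin> cube x0 t \<Longrightarrow> \<eta> x = 0" "\<And>x i. \<bar>partial_deriv i \<eta> x\<bar> \<le> L / (t - s)"
  defines "F \<equiv> \<lambda>x. ennreal (w x * norm (weak_gradient \<Omega> u x) powr p)"
  shows "ennreal b2 * (\<integral>\<^sup>+x. F x \<partial>lebesgue_on (cube x0 t))
    \<le> ennreal (b3 * (2 * real CARD('n)) powr p) *
        ((\<integral>\<^sup>+x. F x * indicator (cube x0 t - cube x0 s) x \<partial>lebesgue_on (cube x0 t))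
          + ennreal ((L / (t - s)) powr p) * modular A (cube x0 R) (\<lambda>x. u x - a))
      + ennreal (3 * b1) * emeasure lebesgue (cube x0 R)"
proof -
  let ?Q = "cube x0 t"
  define n where "n = real CARD('n)"
  define C where "C = L / (t - s)"
  have n: "n > 0" and C: "C > 0" using L st by (auto simp: n_def C_def)
  have QR: "?Q \<subseteq> cube x0 R" by (rule cube_mono[OF st(3)])
  then have Q\<Omega>: "?Q \<subseteq> \<Omega>" using Q by blast
  have t0: "t > 0" using st by simp
  define gu where "gu = weak_gradient \<Omega> u"
  have u: "u \<in> W1A_loc A \<Omega>" using lm by (simp add: local_minimizer_def)
  have wgu: "is_weak_gradient \<Omega> u gu" unfolding gu_def by (rule W1A_loc_D(1)[OF u])
  have Ju: "J ?Q u < \<infinity>" "J ?Q (\<lambda>x. norm (gu x)) < \<infinity>"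
    using W1A_loc_D(2)[OF u compact_cube Q\<Omega>] by (auto simp: gu_def)
  have meas: "h \<in> borel_measurable (lebesgue_on U)" if "locally_integrable \<Omega> h" "U \<subseteq> \<Omega>"
    for h :: "real ^ 'n \<Rightarrow> 'b::{banach, second_countable_topology}" and U
    using locally_integrable_measurable[OF that(1) open_\<Omega>] that(2) by (rule measurable_restrict_mono)
  have liu: "locally_integrable \<Omega> u" "locally_integrable \<Omega> gu" using wgu by (auto simp: is_weak_gradient_def)
  have [measurable]: "u \<in> borel_measurable (lebesgue_on ?Q)" "gu \<in> borel_measurable (lebesgue_on ?Q)"
    "u \<in> borel_measurable (lebesgue_on (cube x0 R))"
    using meas[OF liu(1)] meas[OF liu(2)] Q\<Omega> Q by blast+
  have \<eta>t: "\<eta> \<in> test_functions \<Omega>" by (rule test_functionI[OF \<eta>(1) compact_cube Q\<Omega> \<eta>(4)])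
  have grad_s: "grad \<eta> x = 0" if "x \<in> cube x0 s" for x
    using partial_deriv_extremum_0[OF smooth_differentiable[OF \<eta>(1)], of x] \<eta>(2) \<eta>(3)[OF that] by (simp add: vec_eq_iff)
  have grad_off: "grad \<eta> x = 0" if "x \<notin> ?Q" for x
    using partial_deriv_extremum_0[OF smooth_differentiable[OF \<eta>(1)], of x] \<eta>(2) \<eta>(4)[OF that] by (simp add: vec_eq_iff)
  have grad_bd: "norm (grad \<eta> x) \<le> n * C" for x
  proof -
    have "norm (grad \<eta> x) \<le> (\<Sum>i\<in>UNIV. \<bar>grad \<eta> x $ i\<bar>)" by (rule norm_le_l1_cart)
    also have "\<dots> \<le> (\<Sum>i\<in>(UNIV :: 'n set). C)" using \<eta>(5) by (intro sum_mono) (simp add: C_def)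
    finally show ?thesis by (simp add: n_def)
  qed
  define h where "h x = a + (-1) * u x" for x
  define v where "v x = \<eta> x * h x" for x
  define G where "G x = \<eta> x *\<^sub>R (0 + (-1) *\<^sub>R gu x) + h x *\<^sub>R grad \<eta> x" for x
  have [measurable]: "h \<in> borel_measurable (lebesgue_on ?Q)" "h \<in> borel_measurable (lebesgue_on (cube x0 R))"
    unfolding h_def by measurable
  have wgv: "is_weak_gradient UNIV v G"
    unfolding v_def G_def h_def
    by (rule is_weak_gradient_cutoff[OF is_weak_gradient_lincomb[OF is_weak_gradient_const[OF open_\<Omega>] wgu open_\<Omega>] open_\<Omega> \<eta>t])
  have off: "v x = 0" "G x = 0" if "x \<notin> ?Q" for x
    using \<eta>(4)[OF that] grad_off[OF that] by (simp_all add: v_def G_def)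
  have Qb: "bounded ?Q" by (rule compact_imp_bounded[OF compact_cube])
  have Jh: "J ?Q h < \<infinity>"
    by (rule J_add[OF cube_lebesgue, where ?v1.0="\<lambda>_. a" and ?v2.0=u])
      (use Ju J_bounded_finite[OF cube_lebesgue Qb, of "\<lambda>_. a" "\<bar>a\<bar>"] in \<open>auto simp: h_def\<close>)
  have Jv: "J UNIV v < \<infinity>"
  proof -
    have "J ?Q v \<le> J ?Q h"
      using \<eta>(2) by (intro J_mono) (auto simp: v_def abs_mult intro: mult_left_le_one_le)
    then show ?thesis using Jh by (subst J_UNIV_supp[OF cube_lebesgue off(1)]) (auto intro: order.strict_trans1)
  qed
  have JG: "J UNIV (\<lambda>x. norm (G x)) < \<infinity>"
  proof -
    have Jnh: "J ?Q (\<lambda>x. \<bar>h x\<bar> / (1 / (n * C))) < \<infinity>"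
      using Jh by (subst J_cmult) (auto simp: ennreal_mult_less_top)
    have "J ?Q (\<lambda>x. norm (G x)) < \<infinity>"
    proof (rule J_add[OF cube_lebesgue, where ?v1.0="\<lambda>x. norm (gu x)" and ?v2.0="\<lambda>x. \<bar>h x\<bar> / (1 / (n * C))"])
      fix x
      have "norm (G x) \<le> norm (\<eta> x *\<^sub>R gu x) + norm (h x *\<^sub>R grad \<eta> x)"
        unfolding G_def by (rule order_trans[OF norm_triangle_ineq]) simp
      also have "norm (\<eta> x *\<^sub>R gu x) \<le> norm (gu x)"
        using \<eta>(2)[of x] by (simp add: mult_left_le_one_le)
      also have "norm (h x *\<^sub>R grad \<eta> x) \<le> \<bar>h x\<bar> * (n * C)"
        using grad_bd by (simp add: mult_left_mono)
      finally show "\<bar>norm (G x)\<bar> \<le> \<bar>norm (gu x)\<bar> + \<bar>\<bar>h x\<bar> / (1 / (n * C))\<bar>"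
        using n C by (simp add: abs_mult)
    qed (use Ju Jnh in auto)
    then show ?thesis using off(2) by (subst J_UNIV_supp[OF cube_lebesgue]) auto
  qed
  obtain \<phi> where \<phi>: "AE x in lebesgue. v x = \<phi> x" "supp \<Omega> \<phi> = ?Q"
    by (rule supp_fill_dense[OF t0 Q\<Omega> off(1)])
  have "\<phi> \<in> W1A_0 A \<Omega>"
    by (rule W1A_0_compact_support[OF wgv compact_cube Q\<Omega> off Jv JG \<phi>(1)])
  then have "compact (supp \<Omega> \<phi>) \<and> supp \<Omega> \<phi> \<subseteq> \<Omega> \<longrightarrow>
      energy \<Omega> f u (supp \<Omega> \<phi>) \<le> energy \<Omega> f (\<lambda>x. u x + \<phi> x) (supp \<Omega> \<phi>)"
    using lm[unfolded local_minimizer_def] by (elim conjE ballE) auto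
  then have en: "energy \<Omega> f u ?Q \<le> energy \<Omega> f (\<lambda>x. u x + \<phi> x) ?Q"
    unfolding \<phi>(2) using Q\<Omega> compact_cube by blast
  define gs where "gs = weak_gradient \<Omega> (\<lambda>x. u x + \<phi> x)"
  have "is_weak_gradient \<Omega> \<phi> G"
    by (rule is_weak_gradient_AE[OF is_weak_gradient_subset[OF wgv open_UNIV open_\<Omega> subset_UNIV] open_\<Omega>])
      (use \<phi>(1) in auto)
  then have wgs: "is_weak_gradient \<Omega> (\<lambda>x. u x + \<phi> x) (\<lambda>x. gu x + G x)"
    using is_weak_gradient_lincomb[OF wgu _ open_\<Omega>, of \<phi> G 1] by simp
  have "is_weak_gradient \<Omega> (\<lambda>x. u x + \<phi> x) gs" unfolding gs_def by (rule weak_gradient_spec) (use wgs in blast)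
  then have "locally_integrable \<Omega> gs" by (simp add: is_weak_gradient_def)
  then have gsm[measurable]: "gs \<in> borel_measurable (lebesgue_on ?Q)" using Q\<Omega> by (rule meas)
  have gs_eq: "AE x in lebesgue_on ?Q. gs x = gu x + G x"
    using weak_gradient_AE[OF wgs open_\<Omega>] Q\<Omega> unfolding AE_lebesgue_on_iff[OF cube_lebesgue] gs_def
    by (auto elim!: eventually_mono)
  define s1 where "s1 z = (\<Sum>i\<in>UNIV. \<bar>z $ i\<bar>)" for z :: "real ^ 'n"
  have Vfin: "emeasure lebesgue ?Q < \<infinity>" by (subst emeasure_cube) simp
  have cmp: "ennreal b2 * (\<integral>\<^sup>+x. ennreal (w x * s1 (gu x) powr p) \<partial>lebesgue_on ?Q)
    \<le> ennreal b3 * (\<integral>\<^sup>+x. ennreal (w x * s1 (gs x) powr p) \<partial>lebesgue_on ?Q) + ennreal (3 * b1) * emeasure lebesgue ?Q"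
    unfolding s1_def gu_def gs_def
    by (rule energy_comparison[OF cube_lebesgue Q\<Omega> Vfin b gr en]) (fold gu_def gs_def, measurable)
  have [measurable]: "F \<in> borel_measurable (lebesgue_on ?Q)" unfolding F_def gu_def[symmetric] by measurable
  have F: "F x = ennreal (w x * norm (gu x) powr p)" for x by (simp add: F_def gu_def)
  have lhs: "(\<integral>\<^sup>+x. F x \<partial>lebesgue_on ?Q) \<le> (\<integral>\<^sup>+x. ennreal (w x * s1 (gu x) powr p) \<partial>lebesgue_on ?Q)"
    unfolding F s1_def using p1 w_nonneg
    by (intro nn_integral_mono ennreal_leI mult_left_mono powr_mono2 norm_le_l1_cart) auto
  let ?H = "\<lambda>x. ennreal (C powr p) * ennreal (w x * \<bar>h x\<bar> powr p)"
  let ?I = "\<lambda>x. F x * indicator (?Q - cube x0 s) x"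
  have pt: "AE x in lebesgue_on ?Q. ennreal (w x * s1 (gs x) powr p) \<le> ennreal ((2 * n) powr p) * (?I x + ?H x)"
    using gs_eq AE_space[of "lebesgue_on ?Q"]
  proof eventually_elim
    case (elim x)
    then have xQ: "x \<in> ?Q" by simp
    show ?case
    proof (cases "x \<in> cube x0 s")
      case True
      then have "gs x = 0" using elim(1) \<eta>(3)[OF True] grad_s[OF True] by (simp add: G_def)
      then show ?thesis using p1 by (simp add: s1_def)
    next
      case False
      have cmpt: "\<bar>gs x $ i\<bar> \<le> norm (gu x) + C * \<bar>h x\<bar>" for i
      proof -
        have "gs x $ i = (1 - \<eta> x) * gu x $ i + h x * partial_deriv i \<eta> x"
        proof -
          have "gs x $ i = gu x $ i + G x $ i" using elim(1) by simp
          also have "G x $ i = - (\<eta> x * gu x $ i) + h x * partial_deriv i \<eta> x" by (simp add: G_def)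
          finally show ?thesis by (simp add: algebra_simps)
        qed
        also have "\<bar>\<dots>\<bar> \<le> \<bar>1 - \<eta> x\<bar> * \<bar>gu x $ i\<bar> + \<bar>h x\<bar> * \<bar>partial_deriv i \<eta> x\<bar>"
          by (rule order_trans[OF abs_triangle_ineq]) (simp add: abs_mult)
        also have "\<dots> \<le> 1 * norm (gu x) + \<bar>h x\<bar> * C"
          using \<eta>(2)[of x] \<eta>(5)[of i x] unfolding C_def
          by (intro add_mono mult_mono mult_left_mono component_le_norm_cart) auto
        finally show ?thesis by (simp add: mult.commute)
      qed
      have "s1 (gs x) \<le> (\<Sum>i\<in>(UNIV::'n set). norm (gu x) + C * \<bar>h x\<bar>)"
        unfolding s1_def by (intro sum_mono cmpt)
      then have "s1 (gs x) \<le> n * (norm (gu x) + C * \<bar>h x\<bar>)" by (simp add: n_def)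
      then have "s1 (gs x) powr p \<le> (n * (norm (gu x) + C * \<bar>h x\<bar>)) powr p"
        using p1 by (intro powr_mono2) (auto simp: s1_def sum_nonneg)
      also have "\<dots> = n powr p * (norm (gu x) + C * \<bar>h x\<bar>) powr p" by (rule powr_mult)
      also have "\<dots> \<le> n powr p * (2 powr p * (norm (gu x) powr p + (C * \<bar>h x\<bar>) powr p))"
        using p1 C by (intro mult_left_mono powr_add_le) auto
      also have "\<dots> = (2 * n) powr p * (norm (gu x) powr p + C powr p * \<bar>h x\<bar> powr p)"
        unfolding powr_mult by simp
      finally have "w x * s1 (gs x) powr p \<le> w x * ((2 * n) powr p * (norm (gu x) powr p + C powr p * \<bar>h x\<bar> powr p))"
        using w_nonneg by (intro mult_left_mono)
      also have "\<dots> = (2 * n) powr p * (w x * norm (gu x) powr p + C powr p * (w x * \<bar>h x\<bar> powr p))"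
        by (simp add: algebra_simps)
      finally have "ennreal (w x * s1 (gs x) powr p)
          \<le> ennreal ((2 * n) powr p * (w x * norm (gu x) powr p + C powr p * (w x * \<bar>h x\<bar> powr p)))"
        by (rule ennreal_leI)
      also have "\<dots> = ennreal ((2 * n) powr p) * (F x + ?H x)"
        using w_nonneg[of x] by (simp add: F ennreal_mult)
      also have "F x = ?I x" using xQ False by simp
      finally show ?thesis .
    qed
  qed
  have "(\<integral>\<^sup>+x. ennreal (w x * s1 (gs x) powr p) \<partial>lebesgue_on ?Q)
      \<le> (\<integral>\<^sup>+x. ennreal ((2 * n) powr p) * (?I x + ?H x) \<partial>lebesgue_on ?Q)"
    by (rule nn_integral_mono_AE[OF pt])
  also have "\<dots> = ennreal ((2 * n) powr p) * ((\<integral>\<^sup>+x. ?I x \<partial>lebesgue_on ?Q) + ennreal (C powr p) * (\<integral>\<^sup>+x. ennreal (w x * \<bar>h x\<bar> powr p) \<partial>lebesgue_on ?Q))"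
  proof -
    have "cube x0 t - cube x0 s \<in> sets lebesgue" by (intro sets.Diff cube_lebesgue)
    then have [measurable]: "(indicator (?Q - cube x0 s) :: _ \<Rightarrow> ennreal) \<in> borel_measurable (lebesgue_on ?Q)"
      by (intro measurable_restrict_space1 borel_measurable_indicator)
    show ?thesis by (simp add: nn_integral_cmult nn_integral_add)
  qed
  also have "(\<integral>\<^sup>+x. ennreal (w x * \<bar>h x\<bar> powr p) \<partial>lebesgue_on ?Q) \<le> (\<integral>\<^sup>+x. ennreal (w x * \<bar>h x\<bar> powr p) \<partial>lebesgue_on (cube x0 R))"
    using QR by (simp add: nn_integral_restrict_space) (auto intro!: nn_integral_mono simp: indicator_def)
  also have "\<dots> = modular A (cube x0 R) (\<lambda>x. u x - a)"
    unfolding modular_eq[OF cube_lebesgue Q] by (intro nn_integral_cong) (simp add: h_def abs_minus_commute)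
  finally have rhs: "(\<integral>\<^sup>+x. ennreal (w x * s1 (gs x) powr p) \<partial>lebesgue_on ?Q)
      \<le> ennreal ((2 * n) powr p) * ((\<integral>\<^sup>+x. ?I x \<partial>lebesgue_on ?Q) + ennreal (C powr p) * modular A (cube x0 R) (\<lambda>x. u x - a))"
    by (simp add: mult_left_mono add_left_mono)
  have "ennreal b2 * (\<integral>\<^sup>+x. F x \<partial>lebesgue_on ?Q) \<le> ennreal b2 * (\<integral>\<^sup>+x. ennreal (w x * s1 (gu x) powr p) \<partial>lebesgue_on ?Q)"
    by (intro mult_left_mono lhs) simp
  also note cmp
  also have "ennreal b3 * (\<integral>\<^sup>+x. ennreal (w x * s1 (gs x) powr p) \<partial>lebesgue_on ?Q) + ennreal (3 * b1) * emeasure lebesgue ?Q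
     \<le> ennreal b3 * (ennreal ((2 * n) powr p) * ((\<integral>\<^sup>+x. ?I x \<partial>lebesgue_on ?Q) + ennreal (C powr p) * modular A (cube x0 R) (\<lambda>x. u x - a)))
       + ennreal (3 * b1) * emeasure lebesgue (cube x0 R)"
    by (intro add_mono mult_left_mono rhs emeasure_mono QR cube_lebesgue) auto
  also have "ennreal b3 * (ennreal ((2 * n) powr p) * X) = ennreal (b3 * (2 * n) powr p) * X" for X
    using b by (simp add: ennreal_mult mult.assoc)
  finally show ?thesis unfolding n_def C_def .
qed

proposition caccioppoli:
  assumes b: "b1 \<ge> 0" "b2 > 0" "b3 \<ge> 0"
  obtains c3 c4 where "c3 > 0" "c4 > 0"
    "\<And>f u x0 R \<rho> a. \<lbrakk>growth_condition \<Omega> A b1 b2 b3 f; local_minimizer \<Omega> A f u; cube x0 R \<subseteq> \<Omega>; 0 < \<rho>; \<rho> < R\<rbrakk> \<Longrightarrow>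
       modular A (cube x0 \<rho>) (\<lambda>x. norm (weak_gradient \<Omega> u x))
       \<le> ennreal c3 * modular A (cube x0 R) (\<lambda>x. \<bar>(u x - a) / (R - \<rho>)\<bar>) + ennreal c4 * emeasure lebesgue (cube x0 R)"
proof -
  obtain L :: real where L: "L > 0" and cut: "\<And>(x0 :: real ^ 'n) s t. s < t \<Longrightarrow>
      \<exists>\<eta>. smooth \<eta> \<and> (\<forall>x. 0 \<le> \<eta> x \<and> \<eta> x \<le> 1) \<and>
       (\<forall>x\<in>cube x0 s. \<eta> x = 1) \<and> (\<forall>x. x \<notin> cube x0 t \<longrightarrow> \<eta> x = 0) \<and>
       (\<forall>x i. \<bar>partial_deriv i \<eta> x\<bar> \<le> L / (t - s))"
    by (rule cutoff_exists) (rule that)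
  define k where "k = b3 * (2 * real CARD('n)) powr p"
  define \<theta> where "\<theta> = k / (b2 + k)"
  have k: "k \<ge> 0" using b by (simp add: k_def)
  have bk: "b2 + k > 0" using b k by linarith
  have \<theta>: "0 \<le> \<theta>" "\<theta> < 1" using b k bk by (simp_all add: \<theta>_def)
  have p0: "p > 0" using p1 by simp
  obtain c where c: "c > 0" and it: "\<And>(Z::real \<Rightarrow> real) B D M \<rho> R. \<lbrakk>\<rho> < R; 0 \<le> B; 0 \<le> D; \<And>t. \<rho> \<le> t \<Longrightarrow> t \<le> R \<Longrightarrow> Z t \<le> M;
       \<And>s t. \<rho> \<le> s \<Longrightarrow> s < t \<Longrightarrow> t \<le> R \<Longrightarrow> Z s \<le> \<theta> * Z t + B / (t - s) powr p + D\<rbrakk>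
      \<Longrightarrow> Z \<rho> \<le> c * (B / (R - \<rho>) powr p + D)"
    using hole_filling_iteration[OF \<theta> p0] by metis
  define c3 where "c3 = c * (k * L powr p / (b2 + k)) + 1"
  define c4 where "c4 = c * (3 * b1 / (b2 + k)) + 1"
  have nn: "k * L powr p / (b2 + k) \<ge> 0" "3 * b1 / (b2 + k) \<ge> 0" using k bk b by auto
  have c34: "c3 > 0" "c4 > 0"
    unfolding c3_def c4_def by (intro add_nonneg_pos mult_nonneg_nonneg less_imp_le[OF c] nn zero_less_one)+
  show ?thesis
  proof (rule that[OF c34])
    fix f u x0 R \<rho> a
    assume gr: "growth_condition \<Omega> A b1 b2 b3 f" and lm: "local_minimizer \<Omega> A f u"
      and Q: "cube x0 R \<subseteq> \<Omega>" and \<rho>: "0 < \<rho>" "\<rho> < R"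
    have u: "u \<in> W1A_loc A \<Omega>" using lm by (simp add: local_minimizer_def)
    define gu where "gu = weak_gradient \<Omega> u"
    have wgu: "is_weak_gradient \<Omega> u gu" unfolding gu_def by (rule W1A_loc_D(1)[OF u])
    have liu: "locally_integrable \<Omega> u" "locally_integrable \<Omega> gu" using wgu by (auto simp: is_weak_gradient_def)
    have um: "u \<in> borel_measurable (lebesgue_on (cube x0 R))"
      using locally_integrable_measurable[OF liu(1) open_\<Omega>] Q by (rule measurable_restrict_mono)
    have gm: "gu \<in> borel_measurable (lebesgue_on (cube x0 R))"
      using locally_integrable_measurable[OF liu(2) open_\<Omega>] Q by (rule measurable_restrict_mono)
    define F where "F x = ennreal (w x * norm (gu x) powr p)" for x
    define I where "I t = (\<integral>\<^sup>+x. F x \<partial>lebesgue_on (cube x0 t))" for t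
    define B where "B = modular A (cube x0 R) (\<lambda>x. u x - a)"
    have sub: "cube x0 t \<subseteq> cube x0 R" "cube x0 t \<subseteq> \<Omega>" if "t \<le> R" for t
      using cube_mono[OF that, of x0] Q by auto
    have Ieq: "I t = modular A (cube x0 t) (\<lambda>x. norm (gu x))" if "t \<le> R" for t
      using modular_eq[OF cube_lebesgue sub(2)[OF that]] by (simp add: I_def F_def)
    have Imono: "I s \<le> I t" if "s \<le> t" for s t
      using cube_mono[OF that, of x0] unfolding I_def
      by (simp add: nn_integral_restrict_space) (auto intro!: nn_integral_mono simp: indicator_def)
    have "I R \<le> ennreal M * J (cube x0 R) (\<lambda>x. norm (gu x))"
      unfolding Ieq[OF order_refl] by (rule modular_le[OF cube_lebesgue Q]) (use gm in measurable)
    also have "\<dots> < \<infinity>" using W1A_loc_D(2)[OF u compact_cube Q] by (simp add: ennreal_mult_less_top gu_def)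
    finally have IR: "I R < \<infinity>" .
    have Ifin: "I t < \<infinity>" if "t \<le> R" for t using Imono[OF that] IR by (rule order.strict_trans1)
    have Bscale: "modular A (cube x0 R) (\<lambda>x. \<bar>(u x - a) / (R - \<rho>)\<bar>) = ennreal ((1 / (R - \<rho>)) powr p) * B"
      unfolding B_def
      by (rule modular_scale[OF cube_lebesgue Q]) (use um \<rho> in \<open>auto simp: abs_div\<close>)
    define V where "V = measure lebesgue (cube x0 R)"
    have V: "emeasure lebesgue (cube x0 R) = ennreal V" "V \<ge> 0" by (auto simp: V_def emeasure_cube)
    have "I \<rho> \<le> ennreal c3 * (ennreal ((1 / (R - \<rho>)) powr p) * B) + ennreal c4 * ennreal V"
    proof (cases "B = \<infinity>")
      case True
      then show ?thesis using c34 \<rho> by (simp add: ennreal_mult_eq_top_iff ennreal_top_mult ennreal_mult_top)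
    next
      case False
      then obtain Br where Br: "B = ennreal Br" "Br \<ge> 0" by (cases B) auto
      define Z where "Z t = enn2real (I t)" for t
      have IZ: "I t = ennreal (Z t)" if "t \<le> R" for t using Ifin[OF that] by (simp add: Z_def)
      have Z0: "Z t \<ge> 0" for t by (simp add: Z_def)
      have Zmono: "Z s \<le> Z t" if "s \<le> t" "t \<le> R" for s t
        using Imono[OF that(1)] IZ[of s] IZ[of t] that Z0 by simp
      have step: "Z s \<le> \<theta> * Z t + (k * L powr p / (b2 + k) * Br) / (t - s) powr p + 3 * b1 / (b2 + k) * V"
        if st: "\<rho> \<le> s" "s < t" "t \<le> R" for s t
      proof -
        obtain \<eta> where \<eta>: "smooth \<eta>" "\<And>x. 0 \<le> \<eta> x \<and> \<eta> x \<le> 1" "\<And>x. x \<in> cube x0 s \<Longrightarrow> \<eta> x = 1"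
          "\<And>x. x \<notin> cube x0 t \<Longrightarrow> \<eta> x = 0" "\<And>x i. \<bar>partial_deriv i \<eta> x\<bar> \<le> L / (t - s)"
          using cut[OF st(2), of x0] by blast
        let ?I = "\<integral>\<^sup>+x. F x * indicator (cube x0 t - cube x0 s) x \<partial>lebesgue_on (cube x0 t)"
        have s0: "0 < s" using \<rho> st by simp
        have Fm[measurable]: "F \<in> borel_measurable (lebesgue_on (cube x0 t))"
          using measurable_restrict_mono[OF gm sub(1)[OF st(3)]] unfolding F_def by measurable
        have main: "ennreal b2 * I t \<le> ennreal k * (?I + ennreal ((L / (t - s)) powr p) * B) + ennreal (3 * b1) * ennreal V"
          using caccioppoli_step[OF b gr lm Q s0 st(2,3) L \<eta>, of a]
          unfolding k_def I_def F_def gu_def B_def V by simp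
        have "I s + ?I = I t"
        proof -
          have cs: "cube x0 s \<subseteq> cube x0 t" using st by (intro cube_mono) simp
          have im: "(indicator (cube x0 s) :: _ \<Rightarrow> ennreal) \<in> borel_measurable (lebesgue_on (cube x0 t))"
            "(indicator (cube x0 t - cube x0 s) :: _ \<Rightarrow> ennreal) \<in> borel_measurable (lebesgue_on (cube x0 t))"
            by (intro measurable_restrict_space1 borel_measurable_indicator sets.Diff cube_lebesgue)+
          have "I s = (\<integral>\<^sup>+x. F x * indicator (cube x0 s) x \<partial>lebesgue_on (cube x0 t))"
            using cs unfolding I_def
            by (simp add: nn_integral_restrict_space) (auto intro!: nn_integral_cong simp: indicator_def)
          then have "I s + ?I = (\<integral>\<^sup>+x. F x * indicator (cube x0 s) x + F x * indicator (cube x0 t - cube x0 s) x \<partial>lebesgue_on (cube x0 t))"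
            using im by (simp add: nn_integral_add)
          also have "\<dots> = I t" unfolding I_def
            by (intro nn_integral_cong) (auto simp: indicator_def)
          finally show ?thesis .
        qed
        moreover obtain Za where Za: "?I = ennreal Za" "Za \<ge> 0"
        proof -
          have "?I \<le> I t" unfolding \<open>I s + ?I = I t\<close>[symmetric] by simp
          then have "?I < \<infinity>" using Ifin[OF st(3)] by (rule order.strict_trans1)
          then show ?thesis using that by (cases ?I) auto
        qed
        ultimately have ZZ: "Za = Z t - Z s"
          using IZ[of s] IZ[of t] st Z0 by (simp add: ennreal_plus[symmetric] del: ennreal_plus)
        have "ennreal (b2 * Z t) \<le> ennreal (k * (Za + (L / (t - s)) powr p * Br) + 3 * b1 * V)"
          using main IZ[OF st(3)] Za Br k b V(2) Z0 by (simp add: ennreal_mult)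
        then have "b2 * Z t \<le> k * (Z t - Z s + (L / (t - s)) powr p * Br) + 3 * b1 * V"
          using k b V(2) Br Za(2) unfolding ZZ by (subst (asm) ennreal_le_iff) auto
        moreover have "b2 * Z s \<le> b2 * Z t" using Zmono[of s t] st b by simp
        ultimately have "(b2 + k) * Z s \<le> k * Z t + k * (L / (t - s)) powr p * Br + 3 * b1 * V"
          by (simp add: algebra_simps)
        then have "Z s \<le> (k * Z t + k * (L / (t - s)) powr p * Br + 3 * b1 * V) / (b2 + k)"
          using bk by (simp add: pos_le_divide_eq mult.commute)
        also have "(L / (t - s)) powr p = L powr p / (t - s) powr p"
          using L st by (simp add: powr_divide)
        finally show ?thesis by (simp add: \<theta>_def add_divide_distrib mult.commute[of "b2 + k"])
      qed
      have "Z \<rho> \<le> c * ((k * L powr p / (b2 + k) * Br) / (R - \<rho>) powr p + 3 * b1 / (b2 + k) * V)"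
        by (rule it[OF \<rho>(2) mult_nonneg_nonneg[OF nn(1) Br(2)] mult_nonneg_nonneg[OF nn(2) V(2)] _ step, where M="Z R"])
          (use Zmono in auto)
      also have "\<dots> = (c3 - 1) * ((1 / (R - \<rho>)) powr p * Br) + (c4 - 1) * V"
        using \<rho> by (simp add: c3_def c4_def powr_divide algebra_simps)
      also have "\<dots> \<le> c3 * ((1 / (R - \<rho>)) powr p * Br) + c4 * V"
        using Br V by (intro add_mono mult_right_mono) auto
      finally have "ennreal (Z \<rho>) \<le> ennreal (c3 * ((1 / (R - \<rho>)) powr p * Br) + c4 * V)" by (rule ennreal_leI)
      also have "\<dots> = ennreal c3 * (ennreal ((1 / (R - \<rho>)) powr p) * B) + ennreal c4 * ennreal V"
        using c34 Br V(2) by (simp add: ennreal_mult)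
      finally show ?thesis using IZ[of \<rho>] \<rho> by simp
    qed
    then show "modular A (cube x0 \<rho>) (\<lambda>x. norm (weak_gradient \<Omega> u x))
       \<le> ennreal c3 * modular A (cube x0 R) (\<lambda>x. \<bar>(u x - a) / (R - \<rho>)\<bar>) + ennreal c4 * emeasure lebesgue (cube x0 R)"
      using \<rho> unfolding Bscale V(1) by (simp add: Ieq[symmetric] gu_def[symmetric])
  qed
qed

lemma caccioppoli_mean:
  assumes Q: "cube x0 R \<subseteq> \<Omega>" and R: "R > 0" and um: "u \<in> borel_measurable (lebesgue_on (cube x0 R))"
    and c: "c3 \<ge> 0" "c4 \<ge> 0"
    and le: "X \<le> ennreal c3 * modular A (cube x0 R) (\<lambda>x. \<bar>(u x - a) / (R - R / 2)\<bar>) + ennreal c4 * emeasure lebesgue (cube x0 R)"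
  shows "ennreal (1 / measure lebesgue (cube x0 (R / 2))) * X
    \<le> ennreal (2 ^ CARD('n) * c3 * 2 powr p / measure lebesgue (cube x0 R)) * modular A (cube x0 R) (\<lambda>x. \<bar>(u x - a) / R\<bar>)
      + ennreal (2 ^ CARD('n) * c4)"
proof -
  let ?N = "CARD('n)"
  have m: "measure lebesgue (cube x0 (R / 2)) = R ^ ?N" "measure lebesgue (cube x0 R) = 2 ^ ?N * R ^ ?N"
    using R measure_cube[of "R / 2" x0] measure_cube[of R x0] by (simp_all add: power_mult_distrib)
  have "modular A (cube x0 R) (\<lambda>x. \<bar>(u x - a) / (R - R / 2)\<bar>) = ennreal (2 powr p) * modular A (cube x0 R) (\<lambda>x. \<bar>(u x - a) / R\<bar>)"
  proof (rule modular_scale[OF cube_lebesgue Q])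
    show "(\<lambda>x. \<bar>(u x - a) / R\<bar>) \<in> borel_measurable (lebesgue_on (cube x0 R))" using um by measurable
    fix x
    have "(u x - a) / (R - R / 2) = 2 * ((u x - a) / R)" using R by (simp add: field_simps)
    then show "\<bar>\<bar>(u x - a) / (R - R / 2)\<bar>\<bar> = 2 * \<bar>\<bar>(u x - a) / R\<bar>\<bar>" by (simp only: abs_mult abs_idempotent abs_numeral)
  qed simp
  then have "ennreal (1 / R ^ ?N) * X \<le> ennreal (1 / R ^ ?N) * (ennreal c3 * (ennreal (2 powr p) * modular A (cube x0 R) (\<lambda>x. \<bar>(u x - a) / R\<bar>)) + ennreal c4 * ennreal (2 ^ ?N * R ^ ?N))"
    using le by (intro mult_left_mono) (simp_all add: emeasure_cube m)
  also have "\<dots> = (ennreal (1 / R ^ ?N) * ennreal c3 * ennreal (2 powr p)) * modular A (cube x0 R) (\<lambda>x. \<bar>(u x - a) / R\<bar>)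
      + ennreal (1 / R ^ ?N) * ennreal c4 * ennreal (2 ^ ?N * R ^ ?N)"
    by (simp add: distrib_left mult.assoc)
  also have "ennreal (1 / R ^ ?N) * ennreal c3 * ennreal (2 powr p) = ennreal (2 ^ ?N * c3 * 2 powr p / (2 ^ ?N * R ^ ?N))"
    using R c by (subst ennreal_mult[symmetric], simp, simp, subst ennreal_mult[symmetric]) (auto simp: field_simps)
  also have "ennreal (1 / R ^ ?N) * ennreal c4 * ennreal (2 ^ ?N * R ^ ?N) = ennreal (2 ^ ?N * c4)"
    using R c by (subst ennreal_mult[symmetric], simp, simp, subst ennreal_mult[symmetric]) (auto simp: field_simps)
  finally show ?thesis unfolding m .
qed

end

lemma power_weight_exists:
  fixes \<Omega> :: "(real ^ 'n) set"
  assumes \<Omega>: "open \<Omega>" "bounded \<Omega>" and A: "N_class \<Omega> A" and p: "1 < p" and m: "0 < m"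
    and ae: "AE x in lebesgue_on \<Omega>. m \<le> A x 1 \<and> A x 1 \<le> M \<and> (\<forall>t. A x t = A x 1 * \<bar>t\<bar> powr p)"
  obtains w where "power_weight \<Omega> A w p m (max m M)"
proof -
  define w where "w x = max m (min M (if x \<in> \<Omega> then A x 1 else 0))" for x
  have "(\<lambda>x. A x 1) \<in> borel_measurable (lebesgue_on \<Omega>)" using A by (simp add: N_class_def)
  then have "(\<lambda>x. indicator \<Omega> x *\<^sub>R A x 1) \<in> borel_measurable lebesgue"
    using \<Omega>(1) by (subst (asm) borel_measurable_restrict_space_iff) auto
  moreover have "(\<lambda>x. indicator \<Omega> x *\<^sub>R A x 1) = (\<lambda>x. if x \<in> \<Omega> then A x 1 else 0)"
    by (auto simp: fun_eq_iff)
  ultimately have [measurable]: "(\<lambda>x. if x \<in> \<Omega> then A x 1 else 0) \<in> borel_measurable lebesgue" by metis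
  have "w \<in> borel_measurable lebesgue" unfolding w_def[abs_def] by (intro borel_measurable_max borel_measurable_min) measurable
  moreover have \<Omega>s: "\<Omega> \<in> sets lebesgue" using \<Omega>(1) by simp
  moreover have "AE x in lebesgue. x \<in> \<Omega> \<longrightarrow> (\<forall>t. A x t = w x * \<bar>t\<bar> powr p)"
    using ae unfolding AE_lebesgue_on_iff[OF \<Omega>s]
  proof eventually_elim
    case (elim x)
    show ?case
    proof (intro impI allI)
      fix t assume x: "x \<in> \<Omega>"
      have "m \<le> A x 1" "A x 1 \<le> M" and Ax: "A x t = A x 1 * \<bar>t\<bar> powr p" using elim x by blast+
      then have "w x = A x 1" using x by (simp add: w_def)
      then show "A x t = w x * \<bar>t\<bar> powr p" unfolding Ax by simp
    qed
  qed
  ultimately have "power_weight \<Omega> A w p m (max m M)"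
    using \<Omega> p m by unfold_locales (auto simp: w_def)
  then show ?thesis by (rule that)
qed

theorem lemma4p2:
  fixes \<Omega> :: "(real ^ 'n) set"
    and A As :: "real ^ 'n \<Rightarrow> real \<Rightarrow> real"
    and CA :: "(real ^ 'n) set \<Rightarrow> real \<Rightarrow> real"
    and b1 b2 b3 :: real
  assumes n: "CARD('n) \<ge> 2"
    and \<Omega>: "domain \<Omega>" "bounded \<Omega>" "cone_property \<Omega>"
    and i: "assumption_i \<Omega> A"
    and star: "is_A_star \<Omega> A As"
    and ii: "N_class \<Omega> As"
    and iii: "assumption_iii \<Omega> As"
    and iv: "assumption_iv \<Omega> As"
    and v: "assumption_v \<Omega> As CA"
    and control: "star_defined CARD('n) (CA \<Omega>)"
    and refl: "reflexive_space (LA A \<Omega>) (LA_norm A \<Omega>)"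
      "reflexive_space (W1A A \<Omega>) (W1A_norm A \<Omega>)"
      "reflexive_space (W1A_0 A \<Omega>) (W1A_norm A \<Omega>)"
    and A1: "(INF x\<in>\<Omega>. A x 1) > 0"
    and b: "b1 \<ge> 0" "b2 > 0" "b3 \<ge> 0"
    and T0: "\<exists>T0\<ge>1. hat_op (control_function \<Omega> CA) T0 = 1"
  shows
    "(\<exists>c3>0. \<exists>c4>0. \<forall>f u.
        caratheodory_function \<Omega> f \<and> growth_condition \<Omega> A b1 b2 b3 f \<and> local_minimizer \<Omega> A f u \<longrightarrow>
        (\<forall>x0\<in>\<Omega>. \<forall>R \<rho> a. cube x0 R \<subseteq> \<Omega> \<and> 0 < \<rho> \<and> \<rho> < R \<longrightarrow>
           modular A (cube x0 \<rho>) (\<lambda>x. norm (weak_gradient \<Omega> u x))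
           \<le> ennreal c3 * modular A (cube x0 R) (\<lambda>x. \<bar>(u x - a) / (R - \<rho>)\<bar>)
             + ennreal c4 * emeasure lebesgue (cube x0 R)))
     \<and>
     (\<exists>c5>0. \<exists>c6>0. \<forall>f u.
        caratheodory_function \<Omega> f \<and> growth_condition \<Omega> A b1 b2 b3 f \<and> local_minimizer \<Omega> A f u \<longrightarrow>
        (\<forall>x0\<in>\<Omega>. \<forall>R>0. cube x0 R \<subseteq> \<Omega> \<longrightarrow>
           ennreal (1 / measure lebesgue (cube x0 (R / 2))) *
             modular A (cube x0 (R / 2)) (\<lambda>x. norm (weak_gradient \<Omega> u x))
           \<le> ennreal (c5 / measure lebesgue (cube x0 R)) *
               modular A (cube x0 R) (\<lambda>x. \<bar>(u x - mean_value (cube x0 R) u) / R\<bar>)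
             + ennreal c6))"
proof -
  have op: "open \<Omega>" and ne: "\<Omega> \<noteq> {}" using \<Omega> by (auto simp: domain_def)
  obtain p m M where p: "1 < p" and m: "0 < m"
    and ae: "AE x in lebesgue_on \<Omega>. m \<le> A x 1 \<and> A x 1 \<le> M \<and> (\<forall>t. A x t = A x 1 * \<bar>t\<bar> powr p)"
    by (rule power_structure[OF \<Omega>(2) ne \<Omega>(3) op i star ii iii v control T0])
  have NA: "N_class \<Omega> A" using i by (simp add: assumption_i_def)
  obtain w where pw: "power_weight \<Omega> A w p m (max m M)"
    by (rule power_weight_exists[OF op \<Omega>(2) NA p m ae])
  interpret power_weight \<Omega> A w p m "max m M" by (rule pw)
  obtain c3 c4 where c: "c3 > 0" "c4 > 0" and cac:
    "\<And>f u x0 R \<rho> a. \<lbrakk>growth_condition \<Omega> A b1 b2 b3 f; local_minimizer \<Omega> A f u; cube x0 R \<subseteq> \<Omega>; 0 < \<rho>; \<rho> < R\<rbrakk> \<Longrightarrow>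
       modular A (cube x0 \<rho>) (\<lambda>x. norm (weak_gradient \<Omega> u x))
       \<le> ennreal c3 * modular A (cube x0 R) (\<lambda>x. \<bar>(u x - a) / (R - \<rho>)\<bar>) + ennreal c4 * emeasure lebesgue (cube x0 R)"
    by (rule caccioppoli[OF b]) (rule that)
  let ?c5 = "2 ^ CARD('n) * c3 * 2 powr p" and ?c6 = "2 ^ CARD('n) * c4"
  have mean: "ennreal (1 / measure lebesgue (cube x0 (R / 2))) *
             modular A (cube x0 (R / 2)) (\<lambda>x. norm (weak_gradient \<Omega> u x))
           \<le> ennreal (?c5 / measure lebesgue (cube x0 R)) *
               modular A (cube x0 R) (\<lambda>x. \<bar>(u x - mean_value (cube x0 R) u) / R\<bar>)
             + ennreal ?c6"
    if h: "growth_condition \<Omega> A b1 b2 b3 f" "local_minimizer \<Omega> A f u" "cube x0 R \<subseteq> \<Omega>" "R > 0" for f u x0 R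
  proof (rule caccioppoli_mean[OF h(3,4)])
    have "u \<in> W1A_loc A \<Omega>" using h(2) by (simp add: local_minimizer_def)
    from W1A_loc_D(1)[OF this] have "locally_integrable \<Omega> u" by (simp add: is_weak_gradient_def)
    from locally_integrable_measurable[OF this open_\<Omega>] h(3)
    show "u \<in> borel_measurable (lebesgue_on (cube x0 R))" by (rule measurable_restrict_mono)
    show "modular A (cube x0 (R / 2)) (\<lambda>x. norm (weak_gradient \<Omega> u x))
      \<le> ennreal c3 * modular A (cube x0 R) (\<lambda>x. \<bar>(u x - mean_value (cube x0 R) u) / (R - R / 2)\<bar>) + ennreal c4 * emeasure lebesgue (cube x0 R)"
      using h by (intro cac) auto
  qed (use c in auto)
  have c56: "?c5 > 0" "?c6 > 0" using c by auto
  show ?thesis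
  proof (rule conjI)
    show "\<exists>c3>0. \<exists>c4>0. \<forall>f u.
        caratheodory_function \<Omega> f \<and> growth_condition \<Omega> A b1 b2 b3 f \<and> local_minimizer \<Omega> A f u \<longrightarrow>
        (\<forall>x0\<in>\<Omega>. \<forall>R \<rho> a. cube x0 R \<subseteq> \<Omega> \<and> 0 < \<rho> \<and> \<rho> < R \<longrightarrow>
           modular A (cube x0 \<rho>) (\<lambda>x. norm (weak_gradient \<Omega> u x))
           \<le> ennreal c3 * modular A (cube x0 R) (\<lambda>x. \<bar>(u x - a) / (R - \<rho>)\<bar>)
             + ennreal c4 * emeasure lebesgue (cube x0 R))"
      using c by (intro exI[of _ c3] exI[of _ c4] conjI allI impI ballI cac) auto
    show "\<exists>c5>0. \<exists>c6>0. \<forall>f u.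
        caratheodory_function \<Omega> f \<and> growth_condition \<Omega> A b1 b2 b3 f \<and> local_minimizer \<Omega> A f u \<longrightarrow>
        (\<forall>x0\<in>\<Omega>. \<forall>R>0. cube x0 R \<subseteq> \<Omega> \<longrightarrow>
           ennreal (1 / measure lebesgue (cube x0 (R / 2))) *
             modular A (cube x0 (R / 2)) (\<lambda>x. norm (weak_gradient \<Omega> u x))
           \<le> ennreal (c5 / measure lebesgue (cube x0 R)) *
               modular A (cube x0 R) (\<lambda>x. \<bar>(u x - mean_value (cube x0 R) u) / R\<bar>)
             + ennreal c6)"
      using c56 by (intro exI[of _ ?c5] exI[of _ ?c6] conjI allI impI ballI mean) auto
  qed
qed

end
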